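(* Let $p\ge 2$ be an integer, $\mu_p=\mathbf{E}Z_1^p$, $m_p=\mathrm{Var}(Z_1^p)$, and for $N\ge1$ let $$V_{N,p}(Z)=\sqrt{2^{[N^\gamma]}}\left(\frac{2^{pHN}}{2^{[N^\gamma]}}\sum_{l=1}^{2^{[N^\gamma]}}(\Delta Z_{l,N})^p-\mu_p\right).$$ Then $V_{N,p}(Z)$ converges in distribution, as $N\to\infty$, to the Gaussian law $N(0,m_p)$. Moreover, there is a constant $C>0$ not depending on $N$ such that, for $N$ sufficiently large, $$d_W\left(V_{N,p}(Z),N(0,m_p)\right)\le C\,2^{-\frac{N^\gamma}{2}}.$$
   Context: Fix an integer $q\ge1$ and $H\in(1/2,1)$. Let $(B(y))_{y\in\mathbb{R}}$ be a two-sided standard Brownian motion and $I_q$ the multiple Wiener-Itô integral of order $q$ with respect to $B$ (so $\mathbf{E}I_q(f)^2=q!\|f\|^2_{L^2(\mathbb{R}^q)}$ for symmetric $f$). For $u\ge 0$ put $f_u(y_1,\dots,y_q)=d(q,H)\prod_{i=1}^q(u-y_i)_+^{-(\frac12+\frac{1-H}{q})}$, where $x_+^a=x^a$ if $x>0$ and $0$ otherwise. The Hermite process of order $q$ and self-similarity index $H$ is $Z_t=I_q\left(\int_0^t f_u\,du\right)$, $t\ge0$, with $d(q,H)>0$ the constant such that $\mathbf{E}Z_t^2=t^{2H}$ for all $t\ge 0$. $[x]$ denotes the integer part of $x$. Fix $\gamma\in(0,1)$. For integers $N\ge1$ and $l=1,\dots,2^{[N^\gamma]}$, $\Delta Z_{l,N}=Z_{l2^{-[N^\gamma]}+2^{-N}}-Z_{l2^{-[N^\gamma]}}$.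 $d_W$ is the Wasserstein distance between laws: $d_W(F,G)=\sup|\mathbf{E}g(F)-\mathbf{E}g(G)|$ over all Lipschitz $g:\mathbb{R}\to\mathbb{R}$ with Lipschitz constant at most $1$. *)

theory Defs
  imports "HOL-Probability.Probability"
begin

section \<open>Two-sided Brownian motion\<close>

definition two_sided_brownian_motion :: "'a measure \<Rightarrow> (real \<Rightarrow> 'a \<Rightarrow> real) \<Rightarrow> bool" where
  "two_sided_brownian_motion M B \<longleftrightarrow>
     prob_space M \<and>
     (\<forall>t. B t \<in> borel_measurable M) \<and>
     (AE \<omega> in M. B 0 \<omega> = 0) \<and>
     (\<forall>s t. s < t \<longrightarrow>
        distributed M lborel (\<lambda>\<omega>. B t \<omega> - B s \<omega>) (normal_density 0 (sqrt (t - s)))) \<and>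
     (\<forall>n (t :: nat \<Rightarrow> real). strict_mono_on {..n} t \<longrightarrow>
        prob_space.indep_vars M (\<lambda>_. borel) (\<lambda>i \<omega>. B (t (Suc i)) \<omega> - B (t i) \<omega>) {..<n}) \<and>
     (AE \<omega> in M. continuous_on UNIV (\<lambda>t. B t \<omega>))"


section \<open>Multiple Wiener--Ito integrals\<close>

text \<open>
  Points of \<open>\<real>\<^sup>q\<close> are functions on \<open>{..<q}\<close>, and Lebesgue measure on \<open>\<real>\<^sup>q\<close> is the product
  measure \<open>Pi\<^sub>M {..<q} (\<lambda>_. lborel)\<close>.

  The integral is constructed as by Ito.  Let \<open>t 0 < \<dots> < t n\<close>.  An off-diagonal step function on
  the grid is a combination of indicators of the boxes
  \<open>{t (k 0)<..t (k 0 + 1)} \<times> \<dots> \<times> {t (k (q-1))<..t (k (q-1) + 1)}\<close> over multi-indices \<open>k\<close> whose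
  entries are pairwise distinct (injectivity of \<open>k\<close>, i.e. no box meets a diagonal), and its
  integral is the same combination of products of increments of \<open>B\<close>.  The integral of a
  square-integrable \<open>f\<close> is the \<open>L\<^sup>2\<close>-limit along step functions tending to \<open>f\<close> in \<open>L\<^sup>2(\<real>\<^sup>q)\<close>.
  Since the coefficients need not be symmetric, the integral of \<open>f\<close> is that of its
  symmetrization, and its second moment is \<open>q!\<close> times the squared norm when \<open>f\<close> is symmetric.
\<close>

definition multi_indices :: "nat \<Rightarrow> nat \<Rightarrow> (nat \<Rightarrow> nat) set" where
  "multi_indices q n = {k \<in> {..<q} \<rightarrow>\<^sub>E {..<n}. inj_on k {..<q}}"

definition step_function ::
  "nat \<Rightarrow> nat \<Rightarrow> (nat \<Rightarrow> real) \<Rightarrow> ((nat \<Rightarrow> nat) \<Rightarrow> real) \<Rightarrow> (nat \<Rightarrow> real) \<Rightarrow> real" where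
  "step_function q n t a y =
     (\<Sum>k\<in>multi_indices q n. a k * (\<Prod>i<q. indicator {t (k i)<..t (Suc (k i))} (y i)))"

definition step_integral ::
  "(real \<Rightarrow> 'a \<Rightarrow> real) \<Rightarrow> nat \<Rightarrow> nat \<Rightarrow> (nat \<Rightarrow> real) \<Rightarrow> ((nat \<Rightarrow> nat) \<Rightarrow> real) \<Rightarrow> 'a \<Rightarrow> real" where
  "step_integral B q n t a \<omega> =
     (\<Sum>k\<in>multi_indices q n. a k * (\<Prod>i<q. B (t (Suc (k i))) \<omega> - B (t (k i)) \<omega>))"

text \<open>
  \<open>is_multiple_wiener_integral M B q f X\<close> says that \<open>X\<close> is a version of \<open>I\<^sub>q(f)\<close>, which is only
  determined up to null sets.  Square integrability of \<open>f\<close> is implied by its being an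
  \<open>L\<^sup>2\<close>-limit of step functions.
\<close>

definition is_multiple_wiener_integral ::
  "'a measure \<Rightarrow> (real \<Rightarrow> 'a \<Rightarrow> real) \<Rightarrow> nat \<Rightarrow> ((nat \<Rightarrow> real) \<Rightarrow> real) \<Rightarrow> ('a \<Rightarrow> real) \<Rightarrow> bool" where
  "is_multiple_wiener_integral M B q f X \<longleftrightarrow>
     f \<in> borel_measurable (Pi\<^sub>M {..<q} (\<lambda>_. lborel)) \<and>
     X \<in> borel_measurable M \<and>
     (\<exists>(n :: nat \<Rightarrow> nat) (t :: nat \<Rightarrow> nat \<Rightarrow> real) (a :: nat \<Rightarrow> (nat \<Rightarrow> nat) \<Rightarrow> real).
        (\<forall>j. strict_mono_on {..n j} (t j)) \<and>
        (\<lambda>j. \<integral>\<^sup>+ y. ennreal ((f y - step_function q (n j) (t j) (a j) y)\<^sup>2)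
               \<partial>Pi\<^sub>M {..<q} (\<lambda>_. lborel)) \<longlonglongrightarrow> 0 \<and>
        (\<lambda>j. \<integral>\<^sup>+ \<omega>. ennreal ((X \<omega> - step_integral B q (n j) (t j) (a j) \<omega>)\<^sup>2) \<partial>M) \<longlonglongrightarrow> 0)"


section \<open>The Hermite process\<close>

definition pos_powr :: "real \<Rightarrow> real \<Rightarrow> real" where
  "pos_powr x a = (if x > 0 then x powr a else 0)"

definition hermite_kernel :: "real \<Rightarrow> nat \<Rightarrow> real \<Rightarrow> real \<Rightarrow> (nat \<Rightarrow> real) \<Rightarrow> real" where
  "hermite_kernel d q H u y = d * (\<Prod>i<q. pos_powr (u - y i) (- (1/2 + (1 - H) / real q)))"

text \<open>
  The integral over \<open>u\<close> is taken pointwise in \<open>y\<close>.  It converges whenever the coordinates of \<open>y\<close>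
  are pairwise distinct; on the remaining null set the Bochner integral may take its default
  value 0.
\<close>

definition hermite_process ::
  "'a measure \<Rightarrow> (real \<Rightarrow> 'a \<Rightarrow> real) \<Rightarrow> nat \<Rightarrow> real \<Rightarrow> (real \<Rightarrow> 'a \<Rightarrow> real) \<Rightarrow> bool" where
  "hermite_process M B q H Z \<longleftrightarrow>
     (\<exists>d>0.
        (\<forall>t\<ge>0. is_multiple_wiener_integral M B q
                  (\<lambda>y. LBINT u:{0..t}. hermite_kernel d q H u y) (Z t)) \<and>
        (\<forall>t\<ge>0. prob_space.expectation M (\<lambda>\<omega>. (Z t \<omega>)\<^sup>2) = t powr (2 * H)))"


section \<open>The rescaled power variation\<close>

definition scale_exp :: "real \<Rightarrow> nat \<Rightarrow> nat" where
  "scale_exp \<gamma> N = nat \<lfloor>real N powr \<gamma>\<rfloor>"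

definition hermite_increment ::
  "(real \<Rightarrow> 'a \<Rightarrow> real) \<Rightarrow> real \<Rightarrow> nat \<Rightarrow> nat \<Rightarrow> 'a \<Rightarrow> real" where
  "hermite_increment Z \<gamma> l N \<omega> =
     Z (real l / 2 ^ scale_exp \<gamma> N + 1 / 2 ^ N) \<omega> - Z (real l / 2 ^ scale_exp \<gamma> N) \<omega>"

definition power_variation ::
  "'a measure \<Rightarrow> (real \<Rightarrow> 'a \<Rightarrow> real) \<Rightarrow> real \<Rightarrow> real \<Rightarrow> nat \<Rightarrow> nat \<Rightarrow> 'a \<Rightarrow> real" where
  "power_variation M Z H \<gamma> p N \<omega> =
     sqrt (2 ^ scale_exp \<gamma> N) *
       (2 powr (real p * H * real N) / 2 ^ scale_exp \<gamma> N *
          (\<Sum>l = 1..2 ^ scale_exp \<gamma> N. (hermite_increment Z \<gamma> l N \<omega>) ^ p)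
        - prob_space.expectation M (\<lambda>\<omega>. (Z 1 \<omega>) ^ p))"


section \<open>Gaussian laws and the Wasserstein distance\<close>

text \<open>
  \<open>gaussian_law m v\<close> is the normal law with mean \<open>m\<close> and variance \<open>v\<close>; the image of the standard
  normal law is used so that \<open>v = 0\<close> gives the point mass at \<open>m\<close>.
\<close>

definition gaussian_law :: "real \<Rightarrow> real \<Rightarrow> real measure" where
  "gaussian_law m v = distr std_normal_distribution borel (\<lambda>x. m + sqrt v * x)"

lemma gaussian_law_eq_density:
  assumes "v > 0"
  shows "gaussian_law m v = density lborel (normal_density m (sqrt v))"
proof -
  interpret std: prob_space std_normal_distribution
    by (rule prob_space_normal_density) simp
  have "distributed std_normal_distribution lborel (\<lambda>x. x) std_normal_density"
    by (auto simp: distributed_def distr_id2 cong: distr_cong)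
  from std.normal_density_affine[OF this, of "sqrt v" m] assms
  have "distributed std_normal_distribution lborel (\<lambda>x. m + sqrt v * x) (normal_density m (sqrt v))"
    by simp
  then have "distr std_normal_distribution lborel (\<lambda>x. m + sqrt v * x)
      = density lborel (normal_density m (sqrt v))"
    by (simp add: distributed_def)
  moreover have "distr std_normal_distribution lborel (\<lambda>x. m + sqrt v * x)
      = distr std_normal_distribution borel (\<lambda>x. m + sqrt v * x)"
    by (rule distr_cong) auto
  ultimately show ?thesis
    by (simp add: gaussian_law_def)
qed

text \<open>
  For laws with finite first moment all the integrals below exist.  The value \<open>\<infinity>\<close> otherwise keeps
  the default value 0 of non-convergent Bochner integrals out of the supremum.
\<close>

definition wasserstein_dist :: "real measure \<Rightarrow> real measure \<Rightarrow> ennreal" where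
  "wasserstein_dist \<mu> \<nu> =
     (if integrable \<mu> (\<lambda>x. x) \<and> integrable \<nu> (\<lambda>x. x)
      then SUP g\<in>{g :: real \<Rightarrow> real. 1-lipschitz_on UNIV g}. ennreal \<bar>(\<integral>x. g x \<partial>\<mu>) - (\<integral>x. g x \<partial>\<nu>)\<bar>
      else \<infinity>)"

end

theory Submission
  imports Defs "HOL-Real_Asymp.Real_Asymp"
begin

text \<open>
  The sampling windows \<open>[l 2\<^sup>-\<^sup>k, l 2\<^sup>-\<^sup>k + 2\<^sup>-\<^sup>N]\<close>, \<open>k = [N\<^sup>\<gamma>]\<close>, are separated by gaps that are longer than the
  windows by a factor \<open>T\<close> of order \<open>2\<^sup>N\<^sup>-\<^sup>k\<close>.  Cutting the kernel of each increment off at the end of the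
  preceding window changes it in \<open>L\<^sup>2\<close> by a negative power of \<open>T\<close>, which is much smaller than any
  power of \<open>2\<^sup>-\<^sup>k\<close> because \<open>\<gamma> < 1\<close>; the truncated integrals live on disjoint intervals and are therefore
  independent.  By hypercontractivity of Gaussian chaos (an induction on the number of Gaussian
  variables) closeness in \<open>L\<^sup>2\<close> entails closeness of all moments, and by self-similarity the moments of
  the rescaled increments are those of \<open>Z\<^sub>1\<close>.  What remains is the central limit theorem with rate
  \<open>n\<^sup>-\<^sup>1\<^sup>/\<^sup>2\<close>, \<open>n = 2\<^sup>k\<close>, in the Wasserstein distance for independent variables, which is Stein's method: the
  solution \<open>f\<close> of \<open>f' x - x f x = g x - E g\<close> has a Lipschitz derivative when \<open>g\<close> is Lipschitz.  The
  integrals are approximated by step integrals throughout, so independence is only needed for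
  finitely many Brownian increments.
\<close>

section \<open>Stein's equation\<close>

text \<open>An error budget fixes the sizes. Replacing n summands in a sum divided by sqrt n costs
  sqrt n times the L1 error of one p-th power, so each rescaled increment must be known within 1 / n
  in L2. The approximants do not have exactly the moments of Z_1: their means and variances are off
  by O(1 / n), so the central limit theorem is stated for variances merely close to m, with one
  constant for all index sets. It also calls for third moments of the p-th powers, which L2 bounds
  on the integrals alone cannot supply; this is where the hypercontractive bounds, of order up to 6
  p, come in. The limiting variance m is only known to be nonnegative, so m = 0 is a separate case.
  Multiple integrals enter through two facts: the L2 distance of two integrals is at most a constant
  depending on q times that of the kernels (a substitute for the Ito isometry), and kernels related
  by an affine substitution give equal moments. The exponent that makes the truncation effective is
  2 * \<alpha> - 1 = 2 * (1 - H) / q, positive exactly because H < 1.\<close>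

text \<open>The primitive is the integral of k over [x, \<infinity>), remembered only through its
  derivative and its two limits, so that later estimates never touch improper integrals.\<close>

lemma tail_integral_exists:
  fixes k :: "real \<Rightarrow> real"
  assumes k: "integrable lborel k" and c: "continuous_on UNIV k"
  shows "\<exists>P. (\<forall>x. (P has_real_derivative - k x) (at x)) \<and> (P \<longlongrightarrow> 0) at_top
           \<and> (P \<longlongrightarrow> (\<integral>x. k x \<partial>lborel)) at_bot"
proof -
  define I where "I y = (\<integral>x. indicator {..y} x *\<^sub>R k x \<partial>lborel)" for y
  have sint: "set_integrable lborel A k" if "A \<in> sets lborel" for A
    unfolding set_integrable_def using integrable_mult_indicator[OF that k] .
  have split: "I y = I a + integral {a..y} k" if "a \<le> y" for a y
  proof -
    have "integral {a..y} k = (LBINT x:{a..y}. k x)"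
      by (rule set_borel_integral_eq_integral(2)[OF sint, symmetric]) auto
    also have "\<dots> = (LBINT x:{a<..y}. k x)"
      unfolding set_lebesgue_integral_def
      by (rule integral_cong_AE)
         (use k AE_lborel_singleton[of a] in \<open>auto split: split_indicator elim!: eventually_mono\<close>)
    finally have e: "integral {a..y} k = (LBINT x:{a<..y}. k x)" .
    have "{..y} = {..a} \<union> {a<..y}" using that by auto
    then have "(LBINT x:{..y}. k x) = (LBINT x:{..a}. k x) + (LBINT x:{a<..y}. k x)"
      by (simp add: set_integral_Un sint disjoint_iff)
    then show ?thesis using e by (simp add: I_def set_lebesgue_integral_def)
  qed
  have dI: "(I has_real_derivative k x) (at x)" for x
  proof -
    \<comment> \<open>The base point x - 1 makes x an interior point, so the fundamental theorem
      within a closed interval yields a two-sided derivative.\<close>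
    have "((\<lambda>y. integral {x-1..y} k) has_real_derivative k x) (at x within {x-1..x+1})"
      by (rule integral_has_real_derivative) (auto intro: continuous_on_subset[OF c])
    then have "((\<lambda>y. integral {x-1..y} k) has_real_derivative k x) (at x)"
      by (simp add: at_within_Icc_at)
    then have "((\<lambda>y. I (x-1) + integral {x-1..y} k) has_real_derivative k x) (at x)"
      by (auto intro!: derivative_eq_intros)
    then show ?thesis
    proof (rule DERIV_cong_ev[THEN iffD1, rotated -1])
      show "\<forall>\<^sub>F y in nhds x. I (x-1) + integral {x-1..y} k = I y"
        using eventually_nhds_in_open[of "{x-1<..}" x]
        by (auto elim!: eventually_mono simp: split[symmetric])
    qed auto
  qed
  have top: "(I \<longlongrightarrow> (\<integral>x. k x \<partial>lborel)) at_top"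
    unfolding I_def by (rule tendsto_integral_at_top) (auto simp: k)
  have bot: "(I \<longlongrightarrow> 0) at_bot"
  proof -
    \<comment> \<open>The limit at -\<infinity> is reduced to the one at \<infinity> by the
      reflection x -> -x.\<close>
    have k': "integrable lborel (\<lambda>x. k (- x))"
      using lborel_integrable_real_affine[OF k, of "-1" 0] by simp
    have "((\<lambda>y. \<integral>x. indicator {..y} x *\<^sub>R k (-x) \<partial>lborel) \<longlongrightarrow> (\<integral>x. k (-x) \<partial>lborel)) at_top"
      by (rule tendsto_integral_at_top) (auto simp: k')
    then have "((\<lambda>y. (\<integral>x. k (-x) \<partial>lborel) - (\<integral>x. indicator {..y} x *\<^sub>R k (-x) \<partial>lborel)) \<longlongrightarrow> 0) at_top"
      by (auto intro!: tendsto_eq_intros)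
    moreover have "(\<integral>x. k (-x) \<partial>lborel) - (\<integral>x. indicator {..y} x *\<^sub>R k (-x) \<partial>lborel) = I (- y)" for y
    proof -
      have "I (- y) = (\<integral>x. indicator {..-y} (-x) *\<^sub>R k (-x) \<partial>lborel)"
        unfolding I_def
        by (subst lborel_integral_real_affine[where c="-1" and t=0]) auto
      also have "\<dots> = (\<integral>x. k (-x) - indicator {..y} x *\<^sub>R k (-x) \<partial>lborel)"
        by (rule integral_cong_AE)
           (use k' k AE_lborel_singleton[of y] in \<open>auto split: split_indicator elim!: eventually_mono\<close>)
      finally show ?thesis
        using k' integrable_mult_indicator[OF _ k', of "{..y}"] by simp
    qed
    ultimately show ?thesis by (simp add: filterlim_at_bot_mirror)
  qed
  show ?thesis
  proof (intro exI conjI allI)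
    show "((\<lambda>y. (\<integral>x. k x \<partial>lborel) - I y) has_real_derivative - k x) (at x)" for x
      using dI by (auto intro!: derivative_eq_intros)
    show "((\<lambda>y. (\<integral>x. k x \<partial>lborel) - I y) \<longlongrightarrow> 0) at_top"
      using top by (auto intro!: tendsto_eq_intros)
    show "((\<lambda>y. (\<integral>x. k x \<partial>lborel) - I y) \<longlongrightarrow> (\<integral>x. k x \<partial>lborel)) at_bot"
      using bot by (auto intro!: tendsto_eq_intros)
  qed
qed

text \<open>Turns each inequality between Gaussian tails below into the sign of a derivative: after
  differentiation the tail integrals are gone and only multiples of the density remain.\<close>

lemma nonneg_if_decreasing_to_zero:
  fixes D :: "real \<Rightarrow> real"
  assumes D: "\<And>t. t \<ge> x \<Longrightarrow> (D has_real_derivative D' t) (at t)" "\<And>t. t \<ge> x \<Longrightarrow> D' t \<le> 0"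
    and lim: "(D \<longlongrightarrow> 0) at_top"
  shows "0 \<le> D x"
proof (rule tendsto_upperbound[OF lim])
  show "\<forall>\<^sub>F t in at_top. D t \<le> D x"
    using eventually_ge_at_top[of x]
  proof eventually_elim
    case (elim t)
    then show ?case
      by (rule DERIV_nonpos_imp_nonincreasing) (use D in blast)
  qed
qed simp

lemma std_normal_density_deriv:
  "(std_normal_density has_real_derivative - x * std_normal_density x) (at x)"
  unfolding std_normal_density_def
  by (auto intro!: derivative_eq_intros simp: field_simps)

text \<open>With f = - P / \<open>std_normal_density\<close>, which solves f' = x f + h, the
  quantity bounded here is the derivative of x f. Freezing h at the point x splits it into a part
  governed by the Mills ratio, at most 8, and a remainder governed by the Lipschitz bound, at most
  1.\<close>

lemma stein_bound_nonneg:
  fixes h P :: "real \<Rightarrow> real"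
  assumes h: "\<And>a b. \<bar>h a - h b\<bar> \<le> \<bar>a - b\<bar>" "\<bar>h 0\<bar> \<le> 1"
    and P: "\<And>t. (P has_real_derivative - h t * std_normal_density t) (at t)" "(P \<longlongrightarrow> 0) at_top"
    and x: "0 \<le> x"
  shows "\<bar>x * h x - (1 + x\<^sup>2) * (P x / std_normal_density x)\<bar> \<le> 9"
proof -
  let ?p = std_normal_density
  note dp = std_normal_density_deriv
  have pos: "?p t > 0" for t by (simp add: std_normal_density_def)
  have sq: "1 + t\<^sup>2 \<noteq> (0::real)" for t by (smt (verit) zero_le_power2)
  have "continuous_on UNIV ?p"
    by (auto intro!: continuous_at_imp_continuous_on DERIV_isCont[OF dp])
  with tail_integral_exists[of ?p] integrable_normal_moment[of 1 0 0]
  obtain M where M: "\<And>t. (M has_real_derivative - ?p t) (at t)" "(M \<longlongrightarrow> 0) at_top"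
    by auto
  \<comment> \<open>P x - h x * M x is the integral of (h t - h x) against the density over t \<ge>
    x, and ?p x - x * M x is that of t - x; the two signs of the modulus are treated in
    turn.\<close>
  have r: "\<bar>P x - h x * M x\<bar> \<le> ?p x - x * M x"
  proof -
    have lim: "(?p \<longlongrightarrow> 0) at_top" unfolding std_normal_density_def by real_asymp
    have "0 \<le> (?p x - x * M x) - (P x - h x * M x)"
    proof (rule nonneg_if_decreasing_to_zero[where D="\<lambda>t. (?p t - x * M t) - (P t - h x * M t)"])
      show "((\<lambda>t. (?p t - x * M t) - (P t - h x * M t)) has_real_derivative
          (- (t - x) + (h t - h x)) * ?p t) (at t)" for t
        by (rule derivative_eq_intros dp M P refl)+ (simp add: algebra_simps)
      show "(- (t - x) + (h t - h x)) * ?p t \<le> 0" if "t \<ge> x" for t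
        using h(1)[of t x] that pos[of t] by (intro mult_nonpos_nonneg) auto
      show "((\<lambda>t. (?p t - x * M t) - (P t - h x * M t)) \<longlongrightarrow> 0) at_top"
        by (rule tendsto_eq_intros lim M P refl)+ simp
    qed
    moreover have "0 \<le> (?p x - x * M x) + (P x - h x * M x)"
    proof (rule nonneg_if_decreasing_to_zero[where D="\<lambda>t. (?p t - x * M t) + (P t - h x * M t)"])
      show "((\<lambda>t. (?p t - x * M t) + (P t - h x * M t)) has_real_derivative
          (- (t - x) - (h t - h x)) * ?p t) (at t)" for t
        by (rule derivative_eq_intros dp M P refl)+ (simp add: algebra_simps)
      show "(- (t - x) - (h t - h x)) * ?p t \<le> 0" if "t \<ge> x" for t
        using h(1)[of t x] that pos[of t] by (intro mult_nonpos_nonneg) auto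
      show "((\<lambda>t. (?p t - x * M t) + (P t - h x * M t)) \<longlongrightarrow> 0) at_top"
        by (rule tendsto_eq_intros lim M P refl)+ simp
    qed
    ultimately show ?thesis by linarith
  qed
  \<comment> \<open>In terms of the Mills ratio \<rho> this says 1 - x * \<rho> \<le> 1 / (1 + x^2),
    which absorbs the factor 1 + x^2 in front of the remainder R.\<close>
  have lower: "0 \<le> M x - x / (1 + x\<^sup>2) * ?p x"
  proof (rule nonneg_if_decreasing_to_zero[where D="\<lambda>t. M t - t / (1 + t\<^sup>2) * ?p t"])
    show "((\<lambda>t. M t - t / (1 + t\<^sup>2) * ?p t) has_real_derivative
        - 2 / (1 + t\<^sup>2)\<^sup>2 * ?p t) (at t)" for t
    proof -
      have "((\<lambda>t. M t - t / (1 + t\<^sup>2) * ?p t) has_real_derivative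
          - ?p t - ((1 * (1 + t\<^sup>2) - t * (2 * t)) / ((1 + t\<^sup>2) * (1 + t\<^sup>2)) * ?p t
            + (- t * ?p t) * (t / (1 + t\<^sup>2)))) (at t)"
        using sq[of t] by (intro DERIV_diff DERIV_mult' DERIV_mult DERIV_divide M dp) (auto intro!: derivative_eq_intros)
      moreover have "- p - ((1 * u - t * (2 * t)) / (u * u) * p + (- t * p) * (t / u)) = - 2 / u\<^sup>2 * p"
        if "u = 1 + t\<^sup>2" for u p :: real
      proof -
        have "u \<noteq> 0" and t: "t * t = u - 1" using sq[of t] that by (auto simp: power2_eq_square)
        have "- p - ((1 * u - t * (2 * t)) / (u * u) * p + (- t * p) * (t / u))
          = - p - ((u - 2 * (t * t)) / (u * u) * p - (t * t) * p / u)" by (simp add: algebra_simps)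
        also have "\<dots> = - 2 / u\<^sup>2 * p"
          unfolding t using \<open>u \<noteq> 0\<close> by (simp add: field_simps power2_eq_square)
        finally show ?thesis .
      qed
      ultimately show ?thesis by simp
    qed
    show "- 2 / (1 + t\<^sup>2)\<^sup>2 * ?p t \<le> 0" for t
      using pos[of t] by (intro mult_nonpos_nonneg) auto
    have "((\<lambda>t. t / (1 + t\<^sup>2) * ?p t) \<longlongrightarrow> 0) at_top"
      unfolding std_normal_density_def by real_asymp
    from tendsto_diff[OF M(2) this]
    show "((\<lambda>t. M t - t / (1 + t\<^sup>2) * ?p t) \<longlongrightarrow> 0) at_top" by simp
  qed
  \<comment> \<open>Two upper bounds for the Mills ratio: 2 / (1 + x) stays finite at 0, while 1 / x
    is accurate enough for large x to compensate the growth of h.\<close>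
  have upper1: "0 \<le> 2 / (1 + x) * ?p x - M x"
  proof (rule nonneg_if_decreasing_to_zero[where D="\<lambda>t. 2 / (1 + t) * ?p t - M t"])
    show "((\<lambda>t. 2 / (1 + t) * ?p t - M t) has_real_derivative
        - (1 + t\<^sup>2) / (1 + t)\<^sup>2 * ?p t) (at t)" if "t \<ge> x" for t
    proof -
      have t1: "1 + t \<noteq> 0" using that x by simp
      have "((\<lambda>t. 2 / (1 + t) * ?p t - M t) has_real_derivative
          ((0 * (1 + t) - 2 * 1) / ((1 + t) * (1 + t)) * ?p t
            + (- t * ?p t) * (2 / (1 + t))) - - ?p t) (at t)"
        using t1 by (intro DERIV_diff DERIV_mult DERIV_divide M dp) (auto intro!: derivative_eq_intros)
      moreover have "(0 * u - 2 * 1) / (u * u) * p + (- (u - 1) * p) * (2 / u) - - p = - (1 + (u - 1)\<^sup>2) / u\<^sup>2 * p"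
        if "u \<noteq> 0" for u p :: real
        using that by (simp add: field_simps power2_eq_square)
      from this[OF t1, of "?p t"] have "(0 * (1 + t) - 2 * 1) / ((1 + t) * (1 + t)) * ?p t
            + (- t * ?p t) * (2 / (1 + t)) - - ?p t = - (1 + t\<^sup>2) / (1 + t)\<^sup>2 * ?p t" by simp
      ultimately show ?thesis by simp
    qed
    show "- (1 + t\<^sup>2) / (1 + t)\<^sup>2 * ?p t \<le> 0" for t
      using pos[of t] by (intro mult_nonpos_nonneg divide_nonpos_nonneg) (auto intro: order_trans[of _ 0])
    have "((\<lambda>t. 2 / (1 + t) * ?p t) \<longlongrightarrow> 0) at_top"
      unfolding std_normal_density_def by real_asymp
    from tendsto_diff[OF this M(2)]
    show "((\<lambda>t. 2 / (1 + t) * ?p t - M t) \<longlongrightarrow> 0) at_top" by simp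
  qed
  have upper2: "0 \<le> 1 / x * ?p x - M x" if x1: "x \<ge> 1"
  proof (rule nonneg_if_decreasing_to_zero[where D="\<lambda>t. 1 / t * ?p t - M t"])
    show "((\<lambda>t. 1 / t * ?p t - M t) has_real_derivative - 1 / t\<^sup>2 * ?p t) (at t)" if "t \<ge> x" for t
    proof -
      have t0: "t \<noteq> 0" using that x1 by simp
      have "((\<lambda>t. 1 / t * ?p t - M t) has_real_derivative
          ((0 * t - 1 * 1) / (t * t) * ?p t + (- t * ?p t) * (1 / t)) - - ?p t) (at t)"
        using t0 by (intro DERIV_diff DERIV_mult DERIV_divide M dp) (auto intro!: derivative_eq_intros)
      moreover have "((0 * t - 1 * 1) / (t * t) * ?p t + (- t * ?p t) * (1 / t)) - - ?p t = - 1 / t\<^sup>2 * ?p t"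
        using t0 by (simp add: power2_eq_square)
      ultimately show ?thesis by simp
    qed
    show "- 1 / t\<^sup>2 * ?p t \<le> 0" for t
      using pos[of t] by (intro mult_nonpos_nonneg) auto
    have "((\<lambda>t. 1 / t * ?p t) \<longlongrightarrow> 0) at_top"
      unfolding std_normal_density_def by real_asymp
    from tendsto_diff[OF this M(2)]
    show "((\<lambda>t. 1 / t * ?p t - M t) \<longlongrightarrow> 0) at_top" by simp
  qed
  define \<rho> where "\<rho> = M x / ?p x"
  define R where "R = (P x - h x * M x) / ?p x"
  have eq: "x * h x - (1 + x\<^sup>2) * (P x / ?p x) = - (h x * ((1 + x\<^sup>2) * \<rho> - x)) - (1 + x\<^sup>2) * R"
    unfolding \<rho>_def R_def using pos[of x] by (simp add: field_simps)
  have \<rho>l: "x / (1 + x\<^sup>2) \<le> \<rho>" unfolding \<rho>_def using lower pos[of x] by (simp add: field_simps)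
  have \<rho>l': "0 \<le> (1 + x\<^sup>2) * \<rho> - x"
    using \<rho>l sq[of x] by (simp add: divide_le_eq mult.commute add_pos_nonneg)
  have "\<bar>R\<bar> \<le> 1 - x * \<rho>" unfolding R_def \<rho>_def using r pos[of x] by (simp add: abs_divide field_simps)
  also have "\<dots> \<le> 1 - x * (x / (1 + x\<^sup>2))" using \<rho>l x by (intro diff_left_mono mult_left_mono) auto
  also have "\<dots> = 1 / (1 + x\<^sup>2)" using sq[of x] by (simp add: field_simps power2_eq_square)
  finally have R: "(1 + x\<^sup>2) * \<bar>R\<bar> \<le> 1" using sq[of x] by (simp add: field_simps add_pos_nonneg)
  have hx: "\<bar>h x\<bar> \<le> 1 + x" using h(1)[of x 0] h(2) x by auto
  \<comment> \<open>The worst case is x < 1, with h x at most 2 in modulus and (1 + x^2) * \<rho> at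
    most 4; for x \<ge> 1 the product is at most (1 + x) / x \<le> 2.\<close>
  have "\<bar>h x\<bar> * ((1 + x\<^sup>2) * \<rho> - x) \<le> 8"
  proof (cases "x \<ge> 1")
    case True
    have "\<rho> \<le> 1 / x" unfolding \<rho>_def using upper2[OF True] pos[of x] by (simp add: field_simps)
    then have "(1 + x\<^sup>2) * \<rho> - x \<le> (1 + x\<^sup>2) * (1 / x) - x"
      by (intro diff_right_mono mult_left_mono) auto
    also have "\<dots> = 1 / x" using True by (simp add: field_simps power2_eq_square)
    finally have "\<bar>h x\<bar> * ((1 + x\<^sup>2) * \<rho> - x) \<le> (1 + x) * (1 / x)"
      using hx \<rho>l' x by (intro mult_mono) auto
    also have "\<dots> \<le> 8" using True by (simp add: field_simps)
    finally show ?thesis .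
  next
    case False
    have "\<rho> \<le> 2 / (1 + x)" unfolding \<rho>_def using upper1 pos[of x] x by (simp add: field_simps)
    also have "\<dots> \<le> 2" using x by (simp add: field_simps)
    finally have \<rho>2: "\<rho> \<le> 2" .
    have "x\<^sup>2 \<le> 1" using False x by (simp add: power_le_one)
    then have "(1 + x\<^sup>2) * \<rho> \<le> 2 * 2" using \<rho>2 \<rho>l' x
      by (intro mult_mono) (auto simp: \<open>x / (1 + x\<^sup>2) \<le> \<rho>\<close> intro: order_trans[OF _ \<rho>l])
    then have "\<bar>h x\<bar> * ((1 + x\<^sup>2) * \<rho> - x) \<le> 2 * 4"
      using hx \<rho>l' x False by (intro mult_mono) auto
    then show ?thesis by simp
  qed
  then have "\<bar>h x * ((1 + x\<^sup>2) * \<rho> - x)\<bar> \<le> 8" using \<rho>l' by (simp add: abs_mult)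
  moreover have "\<bar>(1 + x\<^sup>2) * R\<bar> \<le> 1" using R by (simp add: abs_mult)
  ultimately show ?thesis unfolding eq by linarith
qed

text \<open>The solution is f = - P / \<open>std_normal_density\<close> with P the tail integral of
  the centered g against the density. Then f' = x f + h, where x f is 9-Lipschitz by
  \<open>stein_bound_nonneg\<close> and h is 1-Lipschitz, which gives 10. The bound at 0 turns the
  Lipschitz property into linear growth of f', used for integrability.\<close>

lemma stein_solution:
  fixes g :: "real \<Rightarrow> real"
  assumes g: "1-lipschitz_on UNIV g"
  shows "\<exists>f f'. (\<forall>x. (f has_real_derivative f' x) (at x))
    \<and> (\<forall>x. f' x - x * f x = g x - (\<integral>z. g z \<partial>std_normal_distribution))
    \<and> (\<forall>x y. \<bar>f' x - f' y\<bar> \<le> 10 * \<bar>x - y\<bar>) \<and> \<bar>f' 0\<bar> \<le> 1"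
proof -
  let ?p = std_normal_density
  note dp = std_normal_density_deriv
  interpret N: prob_space std_normal_distribution by (rule prob_space_normal_density) simp
  have pos: "?p t > 0" for t by (simp add: std_normal_density_def)
  have total: "measure std_normal_distribution UNIV = 1" using N.prob_space by simp
  have lip: "\<bar>g x - g y\<bar> \<le> \<bar>x - y\<bar>" for x y
    using lipschitz_onD[OF g, of x y] by (simp add: dist_real_def)
  have gc: "continuous_on UNIV g" using lipschitz_on_continuous_on[OF g] .
  have gm[measurable]: "g \<in> borel_measurable borel" using gc by (rule borel_measurable_continuous_onI)
  have int2: "integrable std_normal_distribution (\<lambda>z. z\<^sup>2)" "(\<integral>z. z\<^sup>2 \<partial>std_normal_distribution) = 1"
    using std_normal_moment_even[of 1] by (auto simp: integrable_density integral_density has_bochner_integral_iff)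
  have inta: "integrable std_normal_distribution (\<lambda>z. \<bar>z\<bar>)"
    using integrable_std_normal_moment_abs[of 1] by (auto simp: integrable_density)
  have intg: "integrable std_normal_distribution g"
  proof (rule Bochner_Integration.integrable_bound[of _ "\<lambda>z. \<bar>g 0\<bar> + \<bar>z\<bar>"])
    show "AE z in std_normal_distribution. norm (g z) \<le> norm (\<bar>g 0\<bar> + \<bar>z\<bar>)"
    proof (rule AE_I2)
      show "norm (g z) \<le> norm (\<bar>g 0\<bar> + \<bar>z\<bar>)" for z using lip[of z 0] by auto
    qed
  qed (use inta in auto)
  define c where "c = (\<integral>z. g z \<partial>std_normal_distribution)"
  define h where "h x = g x - c" for x
  have h_lip: "\<bar>h x - h y\<bar> \<le> \<bar>x - y\<bar>" for x y using lip[of x y] by (simp add: h_def)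
  \<comment> \<open>g 0 - g z is at most the modulus of z, hence at most (1 + z^2) / 2, whose
    Gaussian mean is 1.\<close>
  have h0: "\<bar>h 0\<bar> \<le> 1"
  proof -
    have "h 0 = (\<integral>z. g 0 - g z \<partial>std_normal_distribution)"
      using intg by (simp add: h_def c_def total)
    also have "\<bar>\<dots>\<bar> \<le> (\<integral>z. (1 + z\<^sup>2) / 2 \<partial>std_normal_distribution)"
    proof (rule integral_abs_bound_integral)
      show "\<bar>g 0 - g z\<bar> \<le> (1 + z\<^sup>2) / 2" for z
      proof -
        have "2 * \<bar>z\<bar> \<le> 1 + z\<^sup>2" using sum_squares_bound[of 1 "\<bar>z\<bar>"] by simp
        then show ?thesis using lip[of 0 z] by simp
      qed
    qed (use intg int2 in auto)
    also have "\<dots> = 1" using int2 by (simp add: total)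
    finally show ?thesis .
  qed
  have hc: "continuous_on UNIV h" unfolding h_def by (intro continuous_intros gc)
  have hint: "integrable std_normal_distribution h" unfolding h_def using intg by auto
  have ih: "integrable lborel (\<lambda>x. h x * ?p x)" "(\<integral>x. h x * ?p x \<partial>lborel) = 0"
  proof -
    show "integrable lborel (\<lambda>x. h x * ?p x)"
    proof -
      have [measurable]: "h \<in> borel_measurable borel" unfolding h_def by measurable
      show ?thesis using hint by (simp add: integrable_density mult.commute)
    qed
    have "(\<integral>x. h x \<partial>std_normal_distribution) = 0" unfolding h_def using intg
      by (simp add: total c_def)
    then show "(\<integral>x. h x * ?p x \<partial>lborel) = 0" by (simp add: integral_density h_def mult.commute)
  qed
  have "continuous_on UNIV (\<lambda>x. h x * ?p x)"
    by (intro continuous_intros hc) (auto intro!: continuous_at_imp_continuous_on DERIV_isCont[OF dp])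
  \<comment> \<open>Centering makes the total integral 0, so P vanishes at both ends and the
    half-line estimate can be used on either side of 0.\<close>
  from tail_integral_exists[OF ih(1) this] obtain P where
    P: "\<And>x. (P has_real_derivative - (h x * ?p x)) (at x)" "(P \<longlongrightarrow> 0) at_top" "(P \<longlongrightarrow> 0) at_bot"
    using ih(2) by auto
  define f where "f x = - P x / ?p x" for x
  define f' where "f' x = x * f x + h x" for x
  have df: "(f has_real_derivative f' x) (at x)" for x
    unfolding f_def [abs_def] f'_def
    by (rule derivative_eq_intros dp P refl)+ (use pos[of x] in \<open>auto simp: field_simps f_def\<close>)
  have bound: "\<bar>(1 + x\<^sup>2) * f x + x * h x\<bar> \<le> 9" for x
  proof (cases "0 \<le> x")
    case True
    have "\<bar>x * h x - (1 + x\<^sup>2) * (P x / ?p x)\<bar> \<le> 9"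
      by (rule stein_bound_nonneg[OF h_lip h0 _ _ True]) (use P in auto)
    then show ?thesis by (simp add: f_def)
  next
    case False
    \<comment> \<open>For x < 0 the reflected pair h (- t) and - P (- t) satisfies the same
      hypotheses.\<close>
    have sym: "?p (- t) = ?p t" for t by (simp add: std_normal_density_def)
    have "\<bar>(- x) * h (- (- x)) - (1 + (- x)\<^sup>2) * (- P (- (- x)) / ?p (- x))\<bar> \<le> 9"
    proof (rule stein_bound_nonneg[where h="\<lambda>t. h (- t)" and P="\<lambda>t. - P (- t)"])
      show "\<bar>h (- a) - h (- b)\<bar> \<le> \<bar>a - b\<bar>" for a b using h_lip[of "-a" "-b"] by simp
      show "\<bar>h (- 0)\<bar> \<le> 1" using h0 by simp
      have "((\<lambda>t. - P (- t)) has_real_derivative - (- (h (- t) * ?p (- t)) * (- 1))) (at t)" for t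
        by (intro DERIV_minus DERIV_chain2[OF P(1)]) (auto intro!: derivative_eq_intros)
      then show "((\<lambda>t. - P (- t)) has_real_derivative - h (- t) * ?p t) (at t)" for t
        by (simp add: sym)
      show "((\<lambda>t. - P (- t)) \<longlongrightarrow> 0) at_top"
        using P(3) by (auto simp: filterlim_at_bot_mirror intro!: tendsto_eq_intros)
    qed (use False in auto)
    then show ?thesis by (simp add: f_def sym abs_minus_commute)
  qed
  have f'_lip: "\<bar>f' x - f' y\<bar> \<le> 10 * \<bar>x - y\<bar>" for x y
  proof -
    have "\<bar>x * f x - y * f y\<bar> \<le> 9 * \<bar>x - y\<bar>"
    proof -
      have "norm ((\<lambda>x. x * f x) x - (\<lambda>x. x * f x) y) \<le> 9 * norm (x - y)"
      proof (rule field_differentiable_bound[of UNIV _ "\<lambda>x. (1 + x\<^sup>2) * f x + x * h x"])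
        show "((\<lambda>x. x * f x) has_field_derivative (1 + x\<^sup>2) * f x + x * h x) (at x within UNIV)" for x
          by (rule derivative_eq_intros df refl)+ (simp add: f'_def algebra_simps power2_eq_square)
      qed (use bound in auto)
      then show ?thesis by simp
    qed
    moreover have "f' x - f' y = (x * f x - y * f y) + (h x - h y)" by (simp add: f'_def)
    ultimately show ?thesis
      using h_lip[of x y] abs_triangle_ineq[of "x * f x - y * f y" "h x - h y"] by simp
  qed
  show ?thesis
  proof (rule exI[of _ f], rule exI[of _ f'], intro conjI allI)
    show "f' x - x * f x = g x - (\<integral>z. g z \<partial>std_normal_distribution)" for x
      by (simp add: f'_def h_def c_def)
    show "\<bar>f' 0\<bar> \<le> 1" using h0 by (simp add: f'_def)
  qed (use df f'_lip in auto)
qed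

section \<open>Random variables with moments of all orders\<close>

text \<open>This class is closed under sums, products and powers, so integrability of every
  polynomial expression below reduces to membership, by \<open>all_moments_intros\<close>.\<close>

definition all_moments :: "'a measure \<Rightarrow> ('a \<Rightarrow> real) \<Rightarrow> bool" where
  "all_moments M X \<longleftrightarrow> X \<in> borel_measurable M \<and> (\<forall>k. integrable M (\<lambda>\<omega>. \<bar>X \<omega>\<bar> ^ k))"

lemma all_moments_measurable[measurable_dest]: "all_moments M X \<Longrightarrow> X \<in> borel_measurable M"
  by (simp add: all_moments_def)

lemma all_moments_integrable_abs_power: "all_moments M X \<Longrightarrow> integrable M (\<lambda>\<omega>. \<bar>X \<omega>\<bar> ^ k)"
  by (simp add: all_moments_def)

lemma all_moments_integrable_power:
  assumes "all_moments M X" shows "integrable M (\<lambda>\<omega>. X \<omega> ^ k)"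
proof (rule Bochner_Integration.integrable_bound[OF all_moments_integrable_abs_power[OF assms, of k]])
  show "(\<lambda>\<omega>. X \<omega> ^ k) \<in> borel_measurable M" using assms by measurable
qed (auto simp: power_abs)

lemma all_moments_integrable: "all_moments M X \<Longrightarrow> integrable M X"
  using all_moments_integrable_power[of M X 1] by simp

lemma all_moments_integrable_abs: "all_moments M X \<Longrightarrow> integrable M (\<lambda>\<omega>. \<bar>X \<omega>\<bar>)"
  using all_moments_integrable_abs_power[of M X 1] by simp

lemma all_moments_bound:
  assumes "all_moments M X" "Y \<in> borel_measurable M" "\<And>\<omega>. \<omega> \<in> space M \<Longrightarrow> \<bar>Y \<omega>\<bar> \<le> \<bar>X \<omega>\<bar>"
  shows "all_moments M Y"
  unfolding all_moments_def
proof (intro conjI allI)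
  fix k
  show "integrable M (\<lambda>\<omega>. \<bar>Y \<omega>\<bar> ^ k)"
    by (rule Bochner_Integration.integrable_bound[OF all_moments_integrable_abs_power[OF assms(1), of k]])
       (use assms in \<open>auto intro!: power_mono\<close>)
qed (rule assms)

lemma abs_integral_le:
  fixes f :: "'a \<Rightarrow> real"
  assumes "integrable M f" "integrable M g" "\<And>x. x \<in> space M \<Longrightarrow> \<bar>f x\<bar> \<le> g x"
  shows "\<bar>\<integral>x. f x \<partial>M\<bar> \<le> (\<integral>x. g x \<partial>M)"
proof -
  have "\<bar>\<integral>x. f x \<partial>M\<bar> \<le> (\<integral>x. \<bar>f x\<bar> \<partial>M)" using integral_norm_bound[of M f] by simp
  also have "\<dots> \<le> (\<integral>x. g x \<partial>M)" by (rule integral_mono) (use assms in auto)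
  finally show ?thesis .
qed

lemma abs_mult_power_le: "\<bar>x * y\<bar> ^ k \<le> \<bar>x\<bar> ^ (2 * k) + \<bar>y\<bar> ^ (2 * k)" for x y :: real
proof -
  have "\<bar>x\<bar> ^ k * \<bar>y\<bar> ^ k \<le> (\<bar>x\<bar> ^ k)\<^sup>2 + (\<bar>y\<bar> ^ k)\<^sup>2"
  proof -
    have "0 \<le> \<bar>x\<bar> ^ k * \<bar>y\<bar> ^ k" by simp
    then show ?thesis using sum_squares_bound[of "\<bar>x\<bar> ^ k" "\<bar>y\<bar> ^ k"] by linarith
  qed
  then show ?thesis by (simp add: abs_mult power_mult_distrib power_even_eq)
qed

lemma abs_add_power_le: "\<bar>x + y\<bar> ^ k \<le> 2 ^ k * (\<bar>x\<bar> ^ k + \<bar>y\<bar> ^ k)" for x y :: real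
proof -
  have "\<bar>x + y\<bar> ^ k \<le> (2 * max \<bar>x\<bar> \<bar>y\<bar>) ^ k" by (intro power_mono) auto
  also have "\<dots> \<le> 2 ^ k * (\<bar>x\<bar> ^ k + \<bar>y\<bar> ^ k)"
    by (auto simp: power_mult_distrib max_def)
  finally show ?thesis .
qed

lemma all_moments_mult:
  assumes X: "all_moments M X" and Y: "all_moments M Y"
  shows "all_moments M (\<lambda>\<omega>. X \<omega> * Y \<omega>)"
proof -
  note [measurable] = all_moments_measurable[OF X] all_moments_measurable[OF Y]
  have "integrable M (\<lambda>\<omega>. \<bar>X \<omega> * Y \<omega>\<bar> ^ k)" for k
    by (rule Bochner_Integration.integrable_bound[of M "\<lambda>\<omega>. \<bar>X \<omega>\<bar> ^ (2 * k) + \<bar>Y \<omega>\<bar> ^ (2 * k)"])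
       (use all_moments_integrable_abs_power[OF X] all_moments_integrable_abs_power[OF Y]
         in \<open>auto intro!: abs_mult_power_le\<close>)
  then show ?thesis by (auto simp: all_moments_def)
qed

lemma all_moments_add:
  assumes X: "all_moments M X" and Y: "all_moments M Y"
  shows "all_moments M (\<lambda>\<omega>. X \<omega> + Y \<omega>)"
proof -
  note [measurable] = all_moments_measurable[OF X] all_moments_measurable[OF Y]
  have "integrable M (\<lambda>\<omega>. \<bar>X \<omega> + Y \<omega>\<bar> ^ k)" for k
    by (rule Bochner_Integration.integrable_bound[of M "\<lambda>\<omega>. 2 ^ k * (\<bar>X \<omega>\<bar> ^ k + \<bar>Y \<omega>\<bar> ^ k)"])
       (use all_moments_integrable_abs_power[OF X] all_moments_integrable_abs_power[OF Y]
         in \<open>auto intro!: abs_add_power_le\<close>)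
  then show ?thesis by (auto simp: all_moments_def)
qed

lemma (in finite_measure) all_moments_const: "all_moments M (\<lambda>_. c)"
  by (simp add: all_moments_def)

context prob_space
begin

lemma all_moments_cmult: "all_moments M X \<Longrightarrow> all_moments M (\<lambda>\<omega>. c * X \<omega>)"
  by (rule all_moments_mult[OF all_moments_const])

lemma all_moments_minus: "all_moments M X \<Longrightarrow> all_moments M (\<lambda>\<omega>. - X \<omega>)"
  using all_moments_cmult[of X "-1"] by simp

lemma all_moments_diff:
  "all_moments M X \<Longrightarrow> all_moments M Y \<Longrightarrow> all_moments M (\<lambda>\<omega>. X \<omega> - Y \<omega>)"
  using all_moments_add[of M X "\<lambda>\<omega>. - Y \<omega>"] all_moments_minus[of Y] by simp

lemma all_moments_abs: "all_moments M X \<Longrightarrow> all_moments M (\<lambda>\<omega>. \<bar>X \<omega>\<bar>)"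
  by (auto simp: all_moments_def)

lemma all_moments_power: "all_moments M X \<Longrightarrow> all_moments M (\<lambda>\<omega>. X \<omega> ^ k)"
  by (induction k) (auto intro: all_moments_mult all_moments_const)

lemma all_moments_sum:
  "(\<And>i. i \<in> I \<Longrightarrow> all_moments M (X i)) \<Longrightarrow> all_moments M (\<lambda>\<omega>. \<Sum>i\<in>I. X i \<omega>)"
  by (induction I rule: infinite_finite_induct) (auto intro: all_moments_add all_moments_const)

lemma all_moments_prod:
  "(\<And>i. i \<in> I \<Longrightarrow> all_moments M (X i)) \<Longrightarrow> all_moments M (\<lambda>\<omega>. \<Prod>i\<in>I. X i \<omega>)"
  by (induction I rule: infinite_finite_induct) (auto intro: all_moments_mult all_moments_const)

lemmas all_moments_intros =
  all_moments_cmult all_moments_minus all_moments_diff all_moments_abs all_moments_power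
  all_moments_sum all_moments_prod all_moments_const all_moments_mult all_moments_add

lemma expectation_abs_le:
  assumes "all_moments M X" shows "expectation (\<lambda>\<omega>. \<bar>X \<omega>\<bar>) \<le> 1 + expectation (\<lambda>\<omega>. (X \<omega>)\<^sup>2)"
proof -
  have "expectation (\<lambda>\<omega>. \<bar>X \<omega>\<bar>) \<le> expectation (\<lambda>\<omega>. 1 + (X \<omega>)\<^sup>2)"
  proof (rule integral_mono)
    show "\<bar>X \<omega>\<bar> \<le> 1 + (X \<omega>)\<^sup>2" for \<omega>
      using sum_squares_bound[of 1 "\<bar>X \<omega>\<bar>"] by simp
  qed (use assms in \<open>auto intro!: all_moments_integrable_abs all_moments_integrable_power\<close>)
  also have "\<dots> = 1 + expectation (\<lambda>\<omega>. (X \<omega>)\<^sup>2)"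
    using assms by (simp add: prob_space all_moments_integrable_power)
  finally show ?thesis .
qed

text \<open>Cauchy-Schwarz, from the nonnegative quadratic t -> E (t X + Y)^2.\<close>

lemma expectation_mult_le_sqrt:
  assumes X: "all_moments M X" and Y: "all_moments M Y"
  shows "\<bar>expectation (\<lambda>\<omega>. X \<omega> * Y \<omega>)\<bar>
    \<le> sqrt (expectation (\<lambda>\<omega>. (X \<omega>)\<^sup>2)) * sqrt (expectation (\<lambda>\<omega>. (Y \<omega>)\<^sup>2))"
proof -
  let ?a = "expectation (\<lambda>\<omega>. (X \<omega>)\<^sup>2)" and ?b = "expectation (\<lambda>\<omega>. X \<omega> * Y \<omega>)"
    and ?c = "expectation (\<lambda>\<omega>. (Y \<omega>)\<^sup>2)"
  have i: "integrable M (\<lambda>\<omega>. (X \<omega>)\<^sup>2)" "integrable M (\<lambda>\<omega>. X \<omega> * Y \<omega>)" "integrable M (\<lambda>\<omega>. (Y \<omega>)\<^sup>2)"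
    using X Y by (auto intro!: all_moments_integrable_power all_moments_integrable all_moments_intros)
  have q: "0 \<le> ?a * t\<^sup>2 + 2 * ?b * t + ?c" for t
  proof -
    have "0 \<le> expectation (\<lambda>\<omega>. (t * X \<omega> + Y \<omega>)\<^sup>2)" by simp
    also have "(\<lambda>\<omega>. (t * X \<omega> + Y \<omega>)\<^sup>2) = (\<lambda>\<omega>. t\<^sup>2 * (X \<omega>)\<^sup>2 + (2 * t) * (X \<omega> * Y \<omega>) + (Y \<omega>)\<^sup>2)"
      by (auto simp: power2_eq_square algebra_simps)
    also have "expectation (\<lambda>\<omega>. t\<^sup>2 * (X \<omega>)\<^sup>2 + (2 * t) * (X \<omega> * Y \<omega>) + (Y \<omega>)\<^sup>2) = t\<^sup>2 * ?a + (2 * t) * ?b + ?c"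
      using i by (simp del: mult.assoc)
    finally show ?thesis by (simp add: ac_simps)
  qed
  have a: "0 \<le> ?a" and c: "0 \<le> ?c" by simp_all
  have "?b\<^sup>2 \<le> ?a * ?c"
  proof (cases "?a = 0")
    case True
    have "?b = 0"
    proof (rule ccontr)
      assume "?b \<noteq> 0"
      \<comment> \<open>For ?a = 0 the quadratic is affine in t and takes the value -1 at this
        point.\<close>
      then show False using q[of "- (?c + 1) / (2 * ?b)"] True by (simp add: field_simps)
    qed
    then show ?thesis using True by simp
  next
    case False
    then have "0 < ?a" using a by (metis less_le)
    then show ?thesis using q[of "- ?b / ?a"] by (simp add: field_simps power2_eq_square)
  qed
  then have "sqrt (?b\<^sup>2) \<le> sqrt (?a * ?c)" by (rule real_sqrt_le_mono)
  then show ?thesis by (simp add: real_sqrt_mult)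
qed

lemma expectation_abs_le_sqrt:
  assumes "all_moments M X"
  shows "expectation (\<lambda>\<omega>. \<bar>X \<omega>\<bar>) \<le> sqrt (expectation (\<lambda>\<omega>. (X \<omega>)\<^sup>2))"
  using expectation_mult_le_sqrt[of "\<lambda>\<omega>. \<bar>X \<omega>\<bar>" "\<lambda>_. 1"] assms
  by (simp add: all_moments_abs all_moments_const prob_space)

section \<open>Rate of convergence in the central limit theorem\<close>

lemma indep_var_expectation_mult:
  assumes "indep_var borel X borel Y" "\<phi> \<in> borel_measurable borel" "\<psi> \<in> borel_measurable borel"
    and "integrable M (\<lambda>\<omega>. \<phi> (X \<omega>) :: real)" "integrable M (\<lambda>\<omega>. \<psi> (Y \<omega>) :: real)"
  shows "expectation (\<lambda>\<omega>. \<phi> (X \<omega>) * \<psi> (Y \<omega>)) = expectation (\<lambda>\<omega>. \<phi> (X \<omega>)) * expectation (\<lambda>\<omega>. \<psi> (Y \<omega>))"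
  using indep_var_lebesgue_integral[OF indep_var_compose[OF assms(1-3), unfolded comp_def] assms(4,5)] .

lemma expectation_sum_square:
  fixes \<xi> :: "'i \<Rightarrow> 'a \<Rightarrow> real"
  assumes I: "finite I" and indep: "indep_vars (\<lambda>_. borel) \<xi> I"
    and am: "\<And>i. i \<in> I \<Longrightarrow> all_moments M (\<xi> i)" and z: "\<And>i. i \<in> I \<Longrightarrow> expectation (\<xi> i) = 0"
  shows "expectation (\<lambda>\<omega>. (\<Sum>i\<in>I. \<xi> i \<omega>)\<^sup>2) = (\<Sum>i\<in>I. expectation (\<lambda>\<omega>. (\<xi> i \<omega>)\<^sup>2))"
  using assms
proof (induction I)
  case (insert i I)
  have ind: "indep_var borel (\<xi> i) borel (\<lambda>\<omega>. \<Sum>j\<in>I. \<xi> j \<omega>)"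
    by (rule indep_vars_sum) (use insert in auto)
  have ams: "all_moments M (\<lambda>\<omega>. \<Sum>j\<in>I. \<xi> j \<omega>)" and ami: "all_moments M (\<xi> i)"
    using insert by (auto intro!: all_moments_intros)
  have "expectation (\<lambda>\<omega>. \<xi> i \<omega> * (\<Sum>j\<in>I. \<xi> j \<omega>)) = 0"
    using indep_var_lebesgue_integral[OF ind all_moments_integrable[OF ami] all_moments_integrable[OF ams]]
      insert by simp
  moreover have "expectation (\<lambda>\<omega>. (\<Sum>i\<in>I. \<xi> i \<omega>)\<^sup>2) = (\<Sum>i\<in>I. expectation (\<lambda>\<omega>. (\<xi> i \<omega>)\<^sup>2))"
    using insert by (intro insert.IH) (auto intro: indep_vars_subset)
  moreover have "(\<lambda>\<omega>. (\<Sum>i\<in>insert i I. \<xi> i \<omega>)\<^sup>2)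
      = (\<lambda>\<omega>. (\<xi> i \<omega>)\<^sup>2 + 2 * (\<xi> i \<omega> * (\<Sum>j\<in>I. \<xi> j \<omega>)) + (\<Sum>i\<in>I. \<xi> i \<omega>)\<^sup>2)"
    using insert by (auto simp: power2_eq_square algebra_simps)
  moreover have "integrable M (\<lambda>\<omega>. (\<xi> i \<omega>)\<^sup>2)" "integrable M (\<lambda>\<omega>. (\<Sum>j\<in>I. \<xi> j \<omega>)\<^sup>2)"
      "integrable M (\<lambda>\<omega>. \<xi> i \<omega> * (\<Sum>j\<in>I. \<xi> j \<omega>))"
    using ams ami by (auto intro!: all_moments_integrable_power all_moments_integrable all_moments_intros)
  ultimately show ?case using insert by simp
qed simp

text \<open>By Stein's equation the distance is E f'(W) - E (W f(W)). In each term E (\<xi>_i f(W))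
  the sum W is compared with W - \<xi>_i, which is independent of \<xi>_i; the first-order term then
  produces the variance of \<xi>_i times E f', and the rest is of third order. The variances need
  not add up to 1: the defect multiplies a bound on the mean modulus of f'(W).\<close>

lemma stein_clt:
  fixes \<xi> :: "'i \<Rightarrow> 'a \<Rightarrow> real"
  assumes I: "finite I" and indep: "indep_vars (\<lambda>_. borel) \<xi> I"
    and am: "\<And>i. i \<in> I \<Longrightarrow> all_moments M (\<xi> i)" and z: "\<And>i. i \<in> I \<Longrightarrow> expectation (\<xi> i) = 0"
    and g: "1-lipschitz_on UNIV g"
  defines "W \<equiv> \<lambda>\<omega>. \<Sum>i\<in>I. \<xi> i \<omega>"
  shows "\<bar>expectation (\<lambda>\<omega>. g (W \<omega>)) - (\<integral>x. g x \<partial>std_normal_distribution)\<bar>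
    \<le> \<bar>1 - (\<Sum>i\<in>I. expectation (\<lambda>\<omega>. (\<xi> i \<omega>)\<^sup>2))\<bar> * (1 + 10 * expectation (\<lambda>\<omega>. \<bar>W \<omega>\<bar>))
      + 10 * (\<Sum>i\<in>I. expectation (\<lambda>\<omega>. \<bar>\<xi> i \<omega>\<bar> ^ 3)
                + expectation (\<lambda>\<omega>. (\<xi> i \<omega>)\<^sup>2) * expectation (\<lambda>\<omega>. \<bar>\<xi> i \<omega>\<bar>))"
proof -
  from stein_solution[OF g] obtain f f' where
    df: "\<And>x. (f has_real_derivative f' x) (at x)" and
    eq: "\<And>x. f' x - x * f x = g x - (\<integral>z. g z \<partial>std_normal_distribution)" and
    lip: "\<And>x y. \<bar>f' x - f' y\<bar> \<le> 10 * \<bar>x - y\<bar>" and f0: "\<bar>f' 0\<bar> \<le> 1" by blast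
  have f'b: "\<bar>f' x\<bar> \<le> 1 + 10 * \<bar>x\<bar>" for x using lip[of x 0] f0 by auto
  \<comment> \<open>A first-order expansion with quadratic remainder; as f' is only Lipschitz, it
    rests on the mean value theorem and not on a second derivative.\<close>
  have expand: "\<bar>f (x + y) - f x - y * f' x\<bar> \<le> 10 * y\<^sup>2" for x y
  proof (cases "y = 0")
    case False
    let ?a = "min x (x + y)" and ?b = "max x (x + y)"
    have "?a < ?b" using False by auto
    from MVT2[OF this, of f f'] df obtain c where c: "?a < c" "c < ?b" "f ?b - f ?a = (?b - ?a) * f' c" by auto
    have "f (x + y) - f x = y * f' c" using c(3) by (cases "y > 0") (auto simp: min_def max_def algebra_simps split: if_splits)
    then have "\<bar>f (x + y) - f x - y * f' x\<bar> = \<bar>y\<bar> * \<bar>f' c - f' x\<bar>"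
      by (simp add: abs_mult[symmetric] algebra_simps)
    also have "\<dots> \<le> \<bar>y\<bar> * (10 * \<bar>c - x\<bar>)" by (intro mult_left_mono lip) auto
    also have "\<dots> \<le> \<bar>y\<bar> * (10 * \<bar>y\<bar>)" using c by (intro mult_left_mono) auto
    finally show ?thesis by (simp add: power2_eq_square abs_mult[symmetric])
  qed simp
  have fb: "\<bar>f x\<bar> \<le> \<bar>f 0\<bar> + \<bar>x\<bar> + 10 * x\<^sup>2" for x
  proof -
    have "\<bar>x * f' 0\<bar> \<le> \<bar>x\<bar> * 1" unfolding abs_mult by (intro mult_left_mono f0) auto
    then show ?thesis using expand[of 0 x] by simp
  qed
  have "continuous_on UNIV f" using df by (intro continuous_at_imp_continuous_on) (auto intro: DERIV_isCont)
  then have [measurable]: "f \<in> borel_measurable borel" by (rule borel_measurable_continuous_onI)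
  have "10-lipschitz_on UNIV f'" by (rule lipschitz_onI) (auto simp: dist_real_def lip)
  then have [measurable]: "f' \<in> borel_measurable borel"
    by (intro borel_measurable_continuous_onI lipschitz_on_continuous_on)
  have [measurable]: "g \<in> borel_measurable borel"
    by (intro borel_measurable_continuous_onI lipschitz_on_continuous_on[OF g])
  have amf: "all_moments M (\<lambda>\<omega>. f (X \<omega>))" if "all_moments M X" for X
    by (rule all_moments_bound[of _ "\<lambda>\<omega>. \<bar>f 0\<bar> + \<bar>X \<omega>\<bar> + 10 * (X \<omega>)\<^sup>2"])
       (use that fb in \<open>auto intro!: all_moments_intros simp: abs_of_nonneg\<close>)
  have amf': "all_moments M (\<lambda>\<omega>. f' (X \<omega>))" if "all_moments M X" for X
    by (rule all_moments_bound[of _ "\<lambda>\<omega>. 1 + 10 * \<bar>X \<omega>\<bar>"])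
       (use that f'b in \<open>auto intro!: all_moments_intros simp: abs_of_nonneg\<close>)
  have amW: "all_moments M W" unfolding W_def using am by (auto intro!: all_moments_intros)
  have summand: "\<bar>expectation (\<lambda>\<omega>. \<xi> i \<omega> * f (W \<omega>)) - expectation (\<lambda>\<omega>. (\<xi> i \<omega>)\<^sup>2) * expectation (\<lambda>\<omega>. f' (W \<omega>))\<bar>
      \<le> 10 * (expectation (\<lambda>\<omega>. \<bar>\<xi> i \<omega>\<bar> ^ 3) + expectation (\<lambda>\<omega>. (\<xi> i \<omega>)\<^sup>2) * expectation (\<lambda>\<omega>. \<bar>\<xi> i \<omega>\<bar>))"
    if i: "i \<in> I" for i
  proof -
    \<comment> \<open>Leaving out the i-th summand makes V independent of \<xi> i.\<close>
    define V where "V = (\<lambda>\<omega>. \<Sum>j\<in>I - {i}. \<xi> j \<omega>)"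
    have W: "W \<omega> = V \<omega> + \<xi> i \<omega>" for \<omega>
      unfolding W_def V_def using I i by (simp add: sum.remove)
    have ind: "indep_var borel (\<xi> i) borel V"
      unfolding V_def by (rule indep_vars_sum) (use I i indep in \<open>auto simp: insert_absorb\<close>)
    have amV: "all_moments M V" unfolding V_def using am by (auto intro!: all_moments_intros)
    note ami = am[OF i]
    have i1: "integrable M (\<lambda>\<omega>. \<xi> i \<omega> * f (W \<omega>))" "integrable M (\<lambda>\<omega>. (\<xi> i \<omega>)\<^sup>2 * f' (V \<omega>))"
        "integrable M (\<lambda>\<omega>. \<xi> i \<omega> * f (V \<omega>))" "integrable M (\<lambda>\<omega>. f' (V \<omega>))" "integrable M (\<lambda>\<omega>. f' (W \<omega>))"
        "integrable M (\<lambda>\<omega>. (\<xi> i \<omega>)\<^sup>2)" "integrable M (\<lambda>\<omega>. f (V \<omega>))"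
      by (intro all_moments_integrable all_moments_intros amf amf' ami amW amV)+
    have e1: "expectation (\<lambda>\<omega>. \<xi> i \<omega> * f (V \<omega>)) = 0"
      using indep_var_expectation_mult[OF ind, of "\<lambda>x. x" f] z[OF i] i1 all_moments_integrable[OF ami] by simp
    have e2: "expectation (\<lambda>\<omega>. (\<xi> i \<omega>)\<^sup>2 * f' (V \<omega>)) = expectation (\<lambda>\<omega>. (\<xi> i \<omega>)\<^sup>2) * expectation (\<lambda>\<omega>. f' (V \<omega>))"
      using indep_var_expectation_mult[OF ind, of "\<lambda>x. x\<^sup>2" f'] i1 by simp
    have "expectation (\<lambda>\<omega>. \<xi> i \<omega> * f (W \<omega>)) - expectation (\<lambda>\<omega>. (\<xi> i \<omega>)\<^sup>2) * expectation (\<lambda>\<omega>. f' (V \<omega>))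
      = expectation (\<lambda>\<omega>. \<xi> i \<omega> * (f (V \<omega> + \<xi> i \<omega>) - f (V \<omega>) - \<xi> i \<omega> * f' (V \<omega>)))"
    proof -
      have "expectation (\<lambda>\<omega>. \<xi> i \<omega> * (f (V \<omega> + \<xi> i \<omega>) - f (V \<omega>) - \<xi> i \<omega> * f' (V \<omega>)))
        = expectation (\<lambda>\<omega>. \<xi> i \<omega> * f (W \<omega>) - \<xi> i \<omega> * f (V \<omega>) - (\<xi> i \<omega>)\<^sup>2 * f' (V \<omega>))"
        by (simp add: W algebra_simps power2_eq_square)
      then show ?thesis using i1 e1 e2 by simp
    qed
    also have "\<bar>\<dots>\<bar> \<le> expectation (\<lambda>\<omega>. 10 * \<bar>\<xi> i \<omega>\<bar> ^ 3)"
    proof (rule abs_integral_le)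
      show "\<bar>\<xi> i \<omega> * (f (V \<omega> + \<xi> i \<omega>) - f (V \<omega>) - \<xi> i \<omega> * f' (V \<omega>))\<bar> \<le> 10 * \<bar>\<xi> i \<omega>\<bar> ^ 3" for \<omega>
      proof -
        have "\<bar>\<xi> i \<omega>\<bar> * \<bar>f (V \<omega> + \<xi> i \<omega>) - f (V \<omega>) - \<xi> i \<omega> * f' (V \<omega>)\<bar> \<le> \<bar>\<xi> i \<omega>\<bar> * (10 * (\<xi> i \<omega>)\<^sup>2)"
          by (intro mult_left_mono expand) auto
        then show ?thesis by (simp add: abs_mult power3_eq_cube power2_eq_square)
      qed
    qed (use amV ami in \<open>auto intro!: all_moments_integrable all_moments_intros amf amf'\<close>)
    finally have A: "\<bar>expectation (\<lambda>\<omega>. \<xi> i \<omega> * f (W \<omega>)) - expectation (\<lambda>\<omega>. (\<xi> i \<omega>)\<^sup>2) * expectation (\<lambda>\<omega>. f' (V \<omega>))\<bar>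
      \<le> 10 * expectation (\<lambda>\<omega>. \<bar>\<xi> i \<omega>\<bar> ^ 3)" by simp
    have "expectation (\<lambda>\<omega>. f' (V \<omega>)) - expectation (\<lambda>\<omega>. f' (W \<omega>)) = expectation (\<lambda>\<omega>. f' (V \<omega>) - f' (W \<omega>))"
      using i1 by simp
    also have "\<bar>\<dots>\<bar> \<le> expectation (\<lambda>\<omega>. 10 * \<bar>\<xi> i \<omega>\<bar>)"
    proof (rule abs_integral_le)
      show "\<bar>f' (V \<omega>) - f' (W \<omega>)\<bar> \<le> 10 * \<bar>\<xi> i \<omega>\<bar>" for \<omega> using lip[of "V \<omega>" "W \<omega>"] by (simp add: W)
    qed (use amV amW ami in \<open>auto intro!: all_moments_integrable all_moments_intros amf amf'\<close>)
    finally have B: "\<bar>expectation (\<lambda>\<omega>. f' (V \<omega>)) - expectation (\<lambda>\<omega>. f' (W \<omega>))\<bar> \<le> 10 * expectation (\<lambda>\<omega>. \<bar>\<xi> i \<omega>\<bar>)"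
      by simp
    have "\<bar>expectation (\<lambda>\<omega>. (\<xi> i \<omega>)\<^sup>2) * expectation (\<lambda>\<omega>. f' (V \<omega>))
        - expectation (\<lambda>\<omega>. (\<xi> i \<omega>)\<^sup>2) * expectation (\<lambda>\<omega>. f' (W \<omega>))\<bar>
      = expectation (\<lambda>\<omega>. (\<xi> i \<omega>)\<^sup>2) * \<bar>expectation (\<lambda>\<omega>. f' (V \<omega>)) - expectation (\<lambda>\<omega>. f' (W \<omega>))\<bar>"
      by (simp add: abs_mult right_diff_distrib[symmetric])
    also have "\<dots> \<le> expectation (\<lambda>\<omega>. (\<xi> i \<omega>)\<^sup>2) * (10 * expectation (\<lambda>\<omega>. \<bar>\<xi> i \<omega>\<bar>))"
      by (intro mult_left_mono B) auto
    finally show ?thesis using A by (simp add: algebra_simps)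
  qed
  define s where "s = (\<Sum>i\<in>I. expectation (\<lambda>\<omega>. (\<xi> i \<omega>)\<^sup>2))"
  have EWf: "expectation (\<lambda>\<omega>. W \<omega> * f (W \<omega>)) = (\<Sum>i\<in>I. expectation (\<lambda>\<omega>. \<xi> i \<omega> * f (W \<omega>)))"
  proof -
    have "(\<lambda>\<omega>. W \<omega> * f (W \<omega>)) = (\<lambda>\<omega>. \<Sum>i\<in>I. \<xi> i \<omega> * f (W \<omega>))"
      by (auto simp: W_def sum_distrib_right)
    then show ?thesis
      using am amW by (auto intro!: Bochner_Integration.integral_sum all_moments_integrable all_moments_intros amf)
  qed
  have "\<bar>expectation (\<lambda>\<omega>. W \<omega> * f (W \<omega>)) - s * expectation (\<lambda>\<omega>. f' (W \<omega>))\<bar>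
    \<le> (\<Sum>i\<in>I. \<bar>expectation (\<lambda>\<omega>. \<xi> i \<omega> * f (W \<omega>)) - expectation (\<lambda>\<omega>. (\<xi> i \<omega>)\<^sup>2) * expectation (\<lambda>\<omega>. f' (W \<omega>))\<bar>)"
    unfolding EWf s_def sum_distrib_right sum_subtractf[symmetric] by (rule sum_abs)
  also have "\<dots> \<le> (\<Sum>i\<in>I. 10 * (expectation (\<lambda>\<omega>. \<bar>\<xi> i \<omega>\<bar> ^ 3) + expectation (\<lambda>\<omega>. (\<xi> i \<omega>)\<^sup>2) * expectation (\<lambda>\<omega>. \<bar>\<xi> i \<omega>\<bar>)))"
    by (intro sum_mono summand)
  finally have 1: "\<bar>expectation (\<lambda>\<omega>. W \<omega> * f (W \<omega>)) - s * expectation (\<lambda>\<omega>. f' (W \<omega>))\<bar>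
     \<le> 10 * (\<Sum>i\<in>I. expectation (\<lambda>\<omega>. \<bar>\<xi> i \<omega>\<bar> ^ 3) + expectation (\<lambda>\<omega>. (\<xi> i \<omega>)\<^sup>2) * expectation (\<lambda>\<omega>. \<bar>\<xi> i \<omega>\<bar>))"
    by (simp add: sum_distrib_left)
  have "\<bar>expectation (\<lambda>\<omega>. f' (W \<omega>))\<bar> \<le> expectation (\<lambda>\<omega>. 1 + 10 * \<bar>W \<omega>\<bar>)"
    by (rule abs_integral_le)
       (use f'b amW in \<open>auto intro!: all_moments_integrable all_moments_intros amf'\<close>)
  also have "\<dots> = 1 + 10 * expectation (\<lambda>\<omega>. \<bar>W \<omega>\<bar>)"
    using all_moments_integrable_abs[OF amW] by (simp add: prob_space)
  finally have 2: "\<bar>1 - s\<bar> * \<bar>expectation (\<lambda>\<omega>. f' (W \<omega>))\<bar> \<le> \<bar>1 - s\<bar> * (1 + 10 * expectation (\<lambda>\<omega>. \<bar>W \<omega>\<bar>))"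
    by (intro mult_left_mono) auto
  have "expectation (\<lambda>\<omega>. g (W \<omega>)) - (\<integral>x. g x \<partial>std_normal_distribution)
    = expectation (\<lambda>\<omega>. f' (W \<omega>)) - expectation (\<lambda>\<omega>. W \<omega> * f (W \<omega>))"
  proof -
    have "g (W \<omega>) = f' (W \<omega>) - W \<omega> * f (W \<omega>) + (\<integral>x. g x \<partial>std_normal_distribution)" for \<omega>
      using eq[of "W \<omega>"] by simp
    moreover have "integrable M (\<lambda>\<omega>. f' (W \<omega>))" "integrable M (\<lambda>\<omega>. W \<omega> * f (W \<omega>))"
      using amW by (auto intro!: all_moments_integrable all_moments_intros amf amf')
    ultimately show ?thesis by (simp add: prob_space)
  qed
  \<comment> \<open>Inserting s * E f'(W) separates the variance defect 1 - s from the sum of the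
    third-order errors.\<close>
  also have "\<dots> = (1 - s) * expectation (\<lambda>\<omega>. f' (W \<omega>)) - (expectation (\<lambda>\<omega>. W \<omega> * f (W \<omega>)) - s * expectation (\<lambda>\<omega>. f' (W \<omega>)))"
    by (simp add: algebra_simps)
  also have "\<bar>\<dots>\<bar> \<le> \<bar>1 - s\<bar> * \<bar>expectation (\<lambda>\<omega>. f' (W \<omega>))\<bar>
     + \<bar>expectation (\<lambda>\<omega>. W \<omega> * f (W \<omega>)) - s * expectation (\<lambda>\<omega>. f' (W \<omega>))\<bar>"
    unfolding abs_mult[symmetric] by (rule abs_triangle_ineq4)
  also have "\<dots> \<le> \<bar>1 - s\<bar> * (1 + 10 * expectation (\<lambda>\<omega>. \<bar>W \<omega>\<bar>)) + 10 * (\<Sum>i\<in>I. expectation (\<lambda>\<omega>. \<bar>\<xi> i \<omega>\<bar> ^ 3)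
      + expectation (\<lambda>\<omega>. (\<xi> i \<omega>)\<^sup>2) * expectation (\<lambda>\<omega>. \<bar>\<xi> i \<omega>\<bar>))"
    by (rule add_mono[OF 2 1])
  finally show ?thesis unfolding s_def .
qed

end

context prob_space
begin

text \<open>The constant is chosen before the index set, the variables and g, so it serves all N at
  once. A variance defect A / card L per summand changes the variance of the normalized sum by O(1 /
  card L), which is below the rate.\<close>

lemma clt_rate_nondegenerate:
  assumes m: "0 < m"
  shows "\<exists>C>0. \<forall>(L :: nat set) Y g. finite L \<longrightarrow> L \<noteq> {} \<longrightarrow> indep_vars (\<lambda>_. borel) Y L \<longrightarrow>
    (\<forall>l\<in>L. all_moments M (Y l) \<and> \<bar>expectation (Y l)\<bar> \<le> A
        \<and> \<bar>variance (Y l) - m\<bar> \<le> A / card L \<and> expectation (\<lambda>\<omega>. \<bar>Y l \<omega>\<bar> ^ 3) \<le> A) \<longrightarrow>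
    1-lipschitz_on UNIV g \<longrightarrow>
    \<bar>expectation (\<lambda>\<omega>. g ((\<Sum>l\<in>L. Y l \<omega> - expectation (Y l)) / sqrt (card L)))
      - (\<integral>x. g (sqrt m * x) \<partial>std_normal_distribution)\<bar> \<le> C / sqrt (card L)"
proof -
  \<comment> \<open>A carries no sign, so its modulus takes its place. T bounds the two third-order
    terms of one summand before scaling, and the 1 in C secures strict positivity.\<close>
  define A' where "A' = \<bar>A\<bar>"
  define T where "T = 8 * (A' + A' ^ 3) + (m + A') * (1 + (m + A'))"
  define C where "C = 1 + sqrt m * (A' / m * (1 + 10 * (1 + (m + A') / m)) + 10 * (T / (m * sqrt m)))"
  have A': "0 \<le> A'" by (simp add: A'_def)
  have T: "0 \<le> T" unfolding T_def using A' m by (intro add_nonneg_nonneg mult_nonneg_nonneg) auto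
  have C: "0 < C" unfolding C_def using A' T m
    by (intro add_pos_nonneg mult_nonneg_nonneg add_nonneg_nonneg divide_nonneg_nonneg) auto
  have bound: "\<bar>expectation (\<lambda>\<omega>. g ((\<Sum>l\<in>L. Y l \<omega> - expectation (Y l)) / sqrt (card L)))
      - (\<integral>x. g (sqrt m * x) \<partial>std_normal_distribution)\<bar> \<le> C / sqrt (card L)"
    if L: "finite L" "L \<noteq> {}" and ind: "indep_vars (\<lambda>_. borel) Y L"
      and Y: "\<And>l. l \<in> L \<Longrightarrow> all_moments M (Y l)" "\<And>l. l \<in> L \<Longrightarrow> \<bar>expectation (Y l)\<bar> \<le> A"
        "\<And>l. l \<in> L \<Longrightarrow> \<bar>variance (Y l) - m\<bar> \<le> A / card L"
        "\<And>l. l \<in> L \<Longrightarrow> expectation (\<lambda>\<omega>. \<bar>Y l \<omega>\<bar> ^ 3) \<le> A"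
      and g: "1-lipschitz_on UNIV g" for L :: "nat set" and Y g
  proof -
    define n where "n = real (card L)"
    have n: "1 \<le> n" using L by (simp add: n_def Suc_leI card_gt_0_iff)
    define D where "D l \<omega> = Y l \<omega> - expectation (Y l)" for l \<omega>
    define c where "c = 1 / (sqrt n * sqrt m)"
    have c: "0 < c" "c\<^sup>2 = 1 / (n * m)" using n m by (auto simp: c_def power_divide power_mult_distrib)
    define \<xi> where "\<xi> l \<omega> = c * D l \<omega>" for l \<omega>
    have amD: "all_moments M (D l)" if "l \<in> L" for l
      unfolding D_def [abs_def] using Y(1)[OF that] by (intro all_moments_intros)
    have am\<xi>: "all_moments M (\<xi> l)" if "l \<in> L" for l
      unfolding \<xi>_def [abs_def] using amD[OF that] by (intro all_moments_intros)
    have D0: "expectation (D l) = 0" if "l \<in> L" for l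
      unfolding D_def [abs_def] using Y(1)[OF that] by (simp add: prob_space all_moments_integrable)
    have \<xi>0: "expectation (\<xi> l) = 0" if "l \<in> L" for l
      unfolding \<xi>_def [abs_def] using D0[OF that] by simp
    have indx: "indep_vars (\<lambda>_. borel) \<xi> L"
    proof -
      have "indep_vars (\<lambda>_. borel) (\<lambda>l. (\<lambda>x. c * (x - expectation (Y l))) \<circ> Y l) L"
        by (rule indep_vars_compose[OF ind]) auto
      then show ?thesis by (simp add: \<xi>_def [abs_def] D_def comp_def)
    qed
    have varD: "expectation (\<lambda>\<omega>. (D l \<omega>)\<^sup>2) = variance (Y l)" for l by (simp add: D_def)
    have v: "\<bar>expectation (\<lambda>\<omega>. (D l \<omega>)\<^sup>2) - m\<bar> \<le> A' / n" if "l \<in> L" for l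
    proof -
      have "A / card L \<le> A' / n" unfolding A'_def n_def by (intro divide_right_mono) auto
      then show ?thesis using Y(3)[OF that] unfolding varD by (rule order_trans[rotated])
    qed
    have v2: "expectation (\<lambda>\<omega>. (D l \<omega>)\<^sup>2) \<le> m + A'" if "l \<in> L" for l
    proof -
      have "A' / n \<le> A' / 1" using n A' by (intro divide_left_mono) auto
      then show ?thesis using v[OF that] by linarith
    qed
    have D1: "expectation (\<lambda>\<omega>. \<bar>D l \<omega>\<bar>) \<le> 1 + (m + A')" if "l \<in> L" for l
      using expectation_abs_le[OF amD[OF that]] v2[OF that] by simp
    have D3: "expectation (\<lambda>\<omega>. \<bar>D l \<omega>\<bar> ^ 3) \<le> 8 * (A' + A' ^ 3)" if l: "l \<in> L" for l
    proof -
      have "expectation (\<lambda>\<omega>. \<bar>D l \<omega>\<bar> ^ 3) \<le> expectation (\<lambda>\<omega>. 8 * (\<bar>Y l \<omega>\<bar> ^ 3 + A' ^ 3))"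
      proof (rule integral_mono)
        show "\<bar>D l \<omega>\<bar> ^ 3 \<le> 8 * (\<bar>Y l \<omega>\<bar> ^ 3 + A' ^ 3)" for \<omega>
        proof -
          have "\<bar>expectation (Y l)\<bar> ^ 3 \<le> A' ^ 3"
            using Y(2)[OF l] by (intro power_mono) (auto simp: A'_def)
          then show ?thesis using abs_add_power_le[of "Y l \<omega>" "- expectation (Y l)" 3] by (simp add: D_def)
        qed
      qed (use Y(1)[OF l] amD[OF l] in \<open>auto intro!: all_moments_integrable all_moments_intros\<close>)
      also have "\<dots> = 8 * (expectation (\<lambda>\<omega>. \<bar>Y l \<omega>\<bar> ^ 3) + A' ^ 3)"
        using all_moments_integrable_abs_power[OF Y(1)[OF l], of 3] by (simp add: prob_space)
      also have "\<dots> \<le> 8 * (A' + A' ^ 3)" using Y(4)[OF l] by (simp add: A'_def)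
      finally show ?thesis .
    qed
    have e2: "expectation (\<lambda>\<omega>. (\<xi> l \<omega>)\<^sup>2) = expectation (\<lambda>\<omega>. (D l \<omega>)\<^sup>2) / (n * m)" for l
      by (simp add: \<xi>_def power_mult_distrib c)
    have c3: "c ^ 3 = 1 / (n * m) * c" using c(2) by (simp add: power3_eq_cube power2_eq_square)
    have summand: "expectation (\<lambda>\<omega>. \<bar>\<xi> l \<omega>\<bar> ^ 3)
        + expectation (\<lambda>\<omega>. (\<xi> l \<omega>)\<^sup>2) * expectation (\<lambda>\<omega>. \<bar>\<xi> l \<omega>\<bar>) \<le> c ^ 3 * T" if l: "l \<in> L" for l
    proof -
      have "expectation (\<lambda>\<omega>. \<bar>\<xi> l \<omega>\<bar> ^ 3) = c ^ 3 * expectation (\<lambda>\<omega>. \<bar>D l \<omega>\<bar> ^ 3)"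
        using c(1) by (simp add: \<xi>_def abs_mult power_mult_distrib)
      moreover have "expectation (\<lambda>\<omega>. (\<xi> l \<omega>)\<^sup>2) * expectation (\<lambda>\<omega>. \<bar>\<xi> l \<omega>\<bar>)
          = c ^ 3 * (expectation (\<lambda>\<omega>. (D l \<omega>)\<^sup>2) * expectation (\<lambda>\<omega>. \<bar>D l \<omega>\<bar>))"
      proof -
        have "expectation (\<lambda>\<omega>. (\<xi> l \<omega>)\<^sup>2) = c\<^sup>2 * expectation (\<lambda>\<omega>. (D l \<omega>)\<^sup>2)"
          by (simp add: \<xi>_def power_mult_distrib)
        moreover have "expectation (\<lambda>\<omega>. \<bar>\<xi> l \<omega>\<bar>) = c * expectation (\<lambda>\<omega>. \<bar>D l \<omega>\<bar>)"
          using c(1) by (simp add: \<xi>_def abs_mult)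
        ultimately show ?thesis by (simp add: power3_eq_cube power2_eq_square)
      qed
      moreover have "expectation (\<lambda>\<omega>. (D l \<omega>)\<^sup>2) * expectation (\<lambda>\<omega>. \<bar>D l \<omega>\<bar>) \<le> (m + A') * (1 + (m + A'))"
        using v2[OF l] D1[OF l] A' m by (intro mult_mono) auto
      ultimately have "expectation (\<lambda>\<omega>. \<bar>\<xi> l \<omega>\<bar> ^ 3)
          + expectation (\<lambda>\<omega>. (\<xi> l \<omega>)\<^sup>2) * expectation (\<lambda>\<omega>. \<bar>\<xi> l \<omega>\<bar>)
        = c ^ 3 * (expectation (\<lambda>\<omega>. \<bar>D l \<omega>\<bar> ^ 3) + expectation (\<lambda>\<omega>. (D l \<omega>)\<^sup>2) * expectation (\<lambda>\<omega>. \<bar>D l \<omega>\<bar>))"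
        by (simp add: algebra_simps)
      also have "\<dots> \<le> c ^ 3 * T" unfolding T_def
        using D3[OF l] \<open>_ \<le> (m + A') * (1 + (m + A'))\<close> c(1) by (intro mult_left_mono add_mono) auto
      finally show ?thesis .
    qed
    define s where "s = (\<Sum>l\<in>L. expectation (\<lambda>\<omega>. (\<xi> l \<omega>)\<^sup>2))"
    define W where "W \<omega> = (\<Sum>l\<in>L. \<xi> l \<omega>)" for \<omega>
    have amW: "all_moments M W" unfolding W_def [abs_def] using am\<xi> by (intro all_moments_intros)
    have s: "\<bar>1 - s\<bar> \<le> A' / (n * m)"
    proof -
      have "1 - s = (\<Sum>l\<in>L. (m - expectation (\<lambda>\<omega>. (D l \<omega>)\<^sup>2)) / (n * m))"
        using n m by (simp add: s_def e2 sum_divide_distrib[symmetric] sum_subtractf n_def[symmetric] diff_divide_distrib)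
      also have "\<bar>\<dots>\<bar> \<le> (\<Sum>l\<in>L. A' / n / (n * m))"
      proof (rule order_trans[OF sum_abs sum_mono])
        fix l assume "l \<in> L"
        show "\<bar>(m - expectation (\<lambda>\<omega>. (D l \<omega>)\<^sup>2)) / (n * m)\<bar> \<le> A' / n / (n * m)"
        proof -
          have "\<bar>(m - expectation (\<lambda>\<omega>. (D l \<omega>)\<^sup>2)) / (n * m)\<bar> = \<bar>expectation (\<lambda>\<omega>. (D l \<omega>)\<^sup>2) - m\<bar> / (n * m)"
            using n m by (simp add: abs_divide abs_mult abs_minus_commute)
          also have "\<dots> \<le> A' / n / (n * m)"
            using n m v[OF \<open>l \<in> L\<close>] by (intro divide_right_mono) auto
          finally show ?thesis .
        qed
      qed
      also have "\<dots> = A' / (n * m)" using n by (simp add: n_def[symmetric])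
      finally show ?thesis .
    qed
    have EW: "expectation (\<lambda>\<omega>. \<bar>W \<omega>\<bar>) \<le> 1 + (m + A') / m"
    proof -
      have "expectation (\<lambda>\<omega>. (W \<omega>)\<^sup>2) = s"
        unfolding W_def s_def by (rule expectation_sum_square[OF L(1) indx am\<xi> \<xi>0])
      moreover have "s \<le> (\<Sum>l\<in>L. (m + A') / (n * m))"
        unfolding s_def e2 using v2 n m by (intro sum_mono divide_right_mono) auto
      moreover have "\<dots> = (m + A') / m" using n by (simp add: n_def[symmetric])
      ultimately show ?thesis using expectation_abs_le[OF amW] by simp
    qed
    \<comment> \<open>Stein's bound is for variance 1; stretching the argument by sqrt m multiplies
      the Lipschitz constant by sqrt m, which the division undoes.\<close>
    define g' where "g' x = g (sqrt m * x) / sqrt m" for x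
    have g': "1-lipschitz_on UNIV g'"
    proof (rule lipschitz_onI)
      fix x y
      have "\<bar>g (sqrt m * x) - g (sqrt m * y)\<bar> \<le> \<bar>sqrt m * x - sqrt m * y\<bar>"
        using lipschitz_onD[OF g, of "sqrt m * x" "sqrt m * y"] by (simp add: dist_real_def)
      also have "\<dots> = sqrt m * \<bar>x - y\<bar>" using m by (simp add: right_diff_distrib[symmetric] abs_mult)
      finally show "dist (g' x) (g' y) \<le> 1 * dist x y"
        using m by (simp add: dist_real_def g'_def diff_divide_distrib[symmetric] abs_divide divide_le_eq mult.commute)
    qed simp
    have "\<bar>expectation (\<lambda>\<omega>. g' (W \<omega>)) - (\<integral>x. g' x \<partial>std_normal_distribution)\<bar>
      \<le> \<bar>1 - s\<bar> * (1 + 10 * expectation (\<lambda>\<omega>. \<bar>W \<omega>\<bar>))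
        + 10 * (\<Sum>l\<in>L. expectation (\<lambda>\<omega>. \<bar>\<xi> l \<omega>\<bar> ^ 3) + expectation (\<lambda>\<omega>. (\<xi> l \<omega>)\<^sup>2) * expectation (\<lambda>\<omega>. \<bar>\<xi> l \<omega>\<bar>))"
      unfolding s_def W_def by (rule stein_clt[OF L(1) indx am\<xi> \<xi>0 g'])
    also have "\<dots> \<le> A' / (n * m) * (1 + 10 * (1 + (m + A') / m)) + 10 * (\<Sum>l\<in>L. c ^ 3 * T)"
      using s EW A' n m by (intro add_mono mult_mono mult_left_mono sum_mono summand) auto
    also have "\<dots> = A' / m * (1 + 10 * (1 + (m + A') / m)) / n + 10 * (T / (m * sqrt m)) / sqrt n"
      using n m by (simp add: c3 n_def[symmetric]) (simp add: c_def field_simps)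
    also have "\<dots> \<le> A' / m * (1 + 10 * (1 + (m + A') / m)) / sqrt n + 10 * (T / (m * sqrt m)) / sqrt n"
    proof -
      have "sqrt n \<le> n" using n by (simp add: real_le_lsqrt power2_eq_square)
      then show ?thesis using n m A' by (intro add_right_mono divide_left_mono) auto
    qed
    finally have main: "\<bar>expectation (\<lambda>\<omega>. g' (W \<omega>)) - (\<integral>x. g' x \<partial>std_normal_distribution)\<bar>
        \<le> (A' / m * (1 + 10 * (1 + (m + A') / m)) + 10 * (T / (m * sqrt m))) / sqrt n"
      by (simp add: add_divide_distrib)
    have W': "g' (W \<omega>) = g ((\<Sum>l\<in>L. D l \<omega>) / sqrt n) / sqrt m" for \<omega>
    proof -
      have "W \<omega> = c * (\<Sum>l\<in>L. D l \<omega>)" by (simp only: W_def \<xi>_def sum_distrib_left)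
      then have "sqrt m * W \<omega> = (\<Sum>l\<in>L. D l \<omega>) / sqrt n" using m by (simp add: c_def)
      then show ?thesis by (simp add: g'_def)
    qed
    have "\<bar>expectation (\<lambda>\<omega>. g ((\<Sum>l\<in>L. D l \<omega>) / sqrt n)) - (\<integral>x. g (sqrt m * x) \<partial>std_normal_distribution)\<bar>
       = sqrt m * \<bar>expectation (\<lambda>\<omega>. g' (W \<omega>)) - (\<integral>x. g' x \<partial>std_normal_distribution)\<bar>"
      unfolding W' using m by (simp add: g'_def diff_divide_distrib[symmetric] abs_divide)
    also have "\<dots> \<le> sqrt m * ((A' / m * (1 + 10 * (1 + (m + A') / m)) + 10 * (T / (m * sqrt m))) / sqrt n)"
      using m by (intro mult_left_mono main) auto
    also have "\<dots> \<le> C / sqrt n" using n by (simp add: C_def divide_right_mono)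
    finally show ?thesis by (simp add: D_def n_def)
  qed
  show ?thesis
  proof (intro exI[of _ C] conjI allI impI C)
    fix L :: "nat set" and Y and g :: "real \<Rightarrow> real"
    assume *: "finite L" "L \<noteq> {}" "indep_vars (\<lambda>_. borel) Y L"
      "\<forall>l\<in>L. all_moments M (Y l) \<and> \<bar>expectation (Y l)\<bar> \<le> A
        \<and> \<bar>variance (Y l) - m\<bar> \<le> A / card L \<and> expectation (\<lambda>\<omega>. \<bar>Y l \<omega>\<bar> ^ 3) \<le> A"
      "1-lipschitz_on UNIV g"
    show "\<bar>expectation (\<lambda>\<omega>. g ((\<Sum>l\<in>L. Y l \<omega> - expectation (Y l)) / sqrt (card L)))
      - (\<integral>x. g (sqrt m * x) \<partial>std_normal_distribution)\<bar> \<le> C / sqrt (card L)"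
      by (rule bound[OF *(1-3) _ _ _ _ *(5)]) (simp_all add: bspec[OF *(4)])
  qed
qed

text \<open>For m = 0 the target is the point mass at 0, and a Lipschitz g moves by at most the
  first absolute moment of the normalized sum, hence by at most its standard deviation, whose square
  is at most A / card L.\<close>

lemma clt_rate_degenerate:
  assumes L: "finite L" "L \<noteq> {}" and ind: "indep_vars (\<lambda>_. borel) Y L"
    and Y: "\<And>l. l \<in> L \<Longrightarrow> all_moments M (Y l)" "\<And>l. l \<in> L \<Longrightarrow> variance (Y l) \<le> A / card L"
    and g: "1-lipschitz_on UNIV g" and A: "0 \<le> A"
  shows "\<bar>expectation (\<lambda>\<omega>. g ((\<Sum>l\<in>L. Y l \<omega> - expectation (Y l)) / sqrt (card L))) - g 0\<bar>
    \<le> sqrt A / sqrt (card L)"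
proof -
  define n where "n = real (card L)"
  have n: "1 \<le> n" using L by (simp add: n_def Suc_leI card_gt_0_iff)
  define D where "D l \<omega> = Y l \<omega> - expectation (Y l)" for l \<omega>
  define W where "W \<omega> = (\<Sum>l\<in>L. D l \<omega>) / sqrt n" for \<omega>
  have amD: "all_moments M (D l)" if "l \<in> L" for l
    unfolding D_def [abs_def] using Y(1)[OF that] by (intro all_moments_intros)
  have D0: "expectation (D l) = 0" if "l \<in> L" for l
    unfolding D_def [abs_def] using Y(1)[OF that] by (simp add: prob_space all_moments_integrable)
  have indD: "indep_vars (\<lambda>_. borel) D L"
  proof -
    have "indep_vars (\<lambda>_. borel) (\<lambda>l. (\<lambda>x. x - expectation (Y l)) \<circ> Y l) L"
      by (rule indep_vars_compose[OF ind]) auto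
    then show ?thesis by (simp add: D_def [abs_def] comp_def)
  qed
  have amW: "all_moments M W" unfolding W_def [abs_def] divide_inverse
    using amD by (subst mult.commute) (intro all_moments_intros)
  have lip: "\<bar>g x - g y\<bar> \<le> \<bar>x - y\<bar>" for x y
    using lipschitz_onD[OF g, of x y] by (simp add: dist_real_def)
  have [measurable]: "g \<in> borel_measurable borel"
    by (intro borel_measurable_continuous_onI lipschitz_on_continuous_on[OF g])
  have "all_moments M (\<lambda>\<omega>. g (W \<omega>))"
  proof (rule all_moments_bound[of _ "\<lambda>\<omega>. \<bar>g 0\<bar> + \<bar>W \<omega>\<bar>"])
    show "\<bar>g (W \<omega>)\<bar> \<le> \<bar>\<bar>g 0\<bar> + \<bar>W \<omega>\<bar>\<bar>" for \<omega> using lip[of "W \<omega>" 0] by auto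
  qed (use amW in \<open>auto intro!: all_moments_intros\<close>)
  note ig = all_moments_integrable[OF this]
  have "expectation (\<lambda>\<omega>. g (W \<omega>)) - g 0 = expectation (\<lambda>\<omega>. g (W \<omega>) - g 0)"
    using ig by (simp add: prob_space)
  also have "\<bar>\<dots>\<bar> \<le> expectation (\<lambda>\<omega>. \<bar>W \<omega>\<bar>)"
  proof (rule abs_integral_le)
    show "\<bar>g (W \<omega>) - g 0\<bar> \<le> \<bar>W \<omega>\<bar>" for \<omega> using lip[of "W \<omega>" 0] by simp
  qed (use ig all_moments_integrable_abs[OF amW] in auto)
  also have "\<dots> \<le> sqrt (expectation (\<lambda>\<omega>. (W \<omega>)\<^sup>2))" by (rule expectation_abs_le_sqrt[OF amW])
  also have "expectation (\<lambda>\<omega>. (W \<omega>)\<^sup>2) = expectation (\<lambda>\<omega>. (\<Sum>l\<in>L. D l \<omega>)\<^sup>2) / n"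
    using n by (simp add: W_def power_divide)
  also have "expectation (\<lambda>\<omega>. (\<Sum>l\<in>L. D l \<omega>)\<^sup>2) = (\<Sum>l\<in>L. expectation (\<lambda>\<omega>. (D l \<omega>)\<^sup>2))"
    by (rule expectation_sum_square[OF L(1) indD amD D0])
  also have "sqrt (\<dots> / n) \<le> sqrt ((\<Sum>l\<in>L. A / n) / n)"
    using n Y(2) by (intro real_sqrt_le_mono divide_right_mono sum_mono) (auto simp: D_def n_def)
  also have "(\<Sum>l\<in>L. A / n) = A" using n by (simp add: n_def[symmetric])
  finally show ?thesis by (simp add: real_sqrt_divide W_def D_def n_def)
qed

text \<open>Joins the two cases, because all that is known later about the variance of Z_1^p is that
  it is nonnegative. For m = 0 the Gaussian integral reduces to g 0.\<close>

lemma clt_rate: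
  assumes m: "0 \<le> m"
  shows "\<exists>C>0. \<forall>(L :: nat set) Y g. finite L \<longrightarrow> L \<noteq> {} \<longrightarrow> indep_vars (\<lambda>_. borel) Y L \<longrightarrow>
    (\<forall>l\<in>L. all_moments M (Y l) \<and> \<bar>expectation (Y l)\<bar> \<le> A
        \<and> \<bar>variance (Y l) - m\<bar> \<le> A / card L \<and> expectation (\<lambda>\<omega>. \<bar>Y l \<omega>\<bar> ^ 3) \<le> A) \<longrightarrow>
    1-lipschitz_on UNIV g \<longrightarrow>
    \<bar>expectation (\<lambda>\<omega>. g ((\<Sum>l\<in>L. Y l \<omega> - expectation (Y l)) / sqrt (card L)))
      - (\<integral>x. g (sqrt m * x) \<partial>std_normal_distribution)\<bar> \<le> C / sqrt (card L)"
proof (cases "m = 0")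
  case False
  then show ?thesis using clt_rate_nondegenerate[of m A] m by simp
next
  case True
  interpret N: prob_space std_normal_distribution by (rule prob_space_normal_density) simp
  have total: "measure std_normal_distribution UNIV = 1" using N.prob_space by simp
  show ?thesis
  proof (intro exI[of _ "1 + sqrt \<bar>A\<bar>"] conjI allI impI)
    show "0 < 1 + sqrt \<bar>A\<bar>" by (simp add: add_pos_nonneg)
    fix L :: "nat set" and Y and g :: "real \<Rightarrow> real"
    assume L: "finite L" "L \<noteq> {}" and ind: "indep_vars (\<lambda>_. borel) Y L"
      and Y: "\<forall>l\<in>L. all_moments M (Y l) \<and> \<bar>expectation (Y l)\<bar> \<le> A
        \<and> \<bar>variance (Y l) - m\<bar> \<le> A / card L \<and> expectation (\<lambda>\<omega>. \<bar>Y l \<omega>\<bar> ^ 3) \<le> A"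
      and g: "1-lipschitz_on UNIV g"
    have "\<bar>expectation (\<lambda>\<omega>. g ((\<Sum>l\<in>L. Y l \<omega> - expectation (Y l)) / sqrt (card L))) - g 0\<bar>
        \<le> sqrt \<bar>A\<bar> / sqrt (card L)"
    proof (rule clt_rate_degenerate[OF L ind _ _ g])
      fix l assume l: "l \<in> L"
      show "all_moments M (Y l)" using bspec[OF Y l] by simp
      have "variance (Y l) \<le> A / card L" using bspec[OF Y l] unfolding True by linarith
      also have "\<dots> \<le> \<bar>A\<bar> / card L" by (intro divide_right_mono) auto
      finally show "variance (Y l) \<le> \<bar>A\<bar> / card L" .
    qed simp
    also have "\<dots> \<le> (1 + sqrt \<bar>A\<bar>) / sqrt (card L)" by (intro divide_right_mono) auto
    finally show "\<bar>expectation (\<lambda>\<omega>. g ((\<Sum>l\<in>L. Y l \<omega> - expectation (Y l)) / sqrt (card L)))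
      - (\<integral>x. g (sqrt m * x) \<partial>std_normal_distribution)\<bar> \<le> (1 + sqrt \<bar>A\<bar>) / sqrt (card L)"
      unfolding True by (simp add: total)
  qed
qed

end

section \<open>Step functions and their refinements\<close>

text \<open>A common form of step functions and step integrals: \<Phi> i x = B x \<omega> gives the
  integral, and \<Phi> i x = of_bool (y i \<le> x) gives the function, its increments being
  indicators of half-open intervals. An identity that holds for every \<Phi> therefore holds for
  both.\<close>

definition grid_sum ::
  "nat \<Rightarrow> nat \<Rightarrow> (nat \<Rightarrow> real) \<Rightarrow> ((nat \<Rightarrow> nat) \<Rightarrow> real) \<Rightarrow> (nat \<Rightarrow> real \<Rightarrow> real) \<Rightarrow> real" where
  "grid_sum q n t a \<Phi> = (\<Sum>k\<in>multi_indices q n. a k * (\<Prod>i<q. \<Phi> i (t (Suc (k i))) - \<Phi> i (t (k i))))"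

text \<open>The squared L2 norm of the step function, by
  \<open>nn_integral_step_function_square\<close>.\<close>

definition grid_norm :: "nat \<Rightarrow> nat \<Rightarrow> (nat \<Rightarrow> real) \<Rightarrow> ((nat \<Rightarrow> nat) \<Rightarrow> real) \<Rightarrow> real" where
  "grid_norm q n t a = (\<Sum>k\<in>multi_indices q n. (a k)\<^sup>2 * (\<Prod>i<q. t (Suc (k i)) - t (k i)))"

lemma finite_multi_indices[simp, intro]: "finite (multi_indices q n)"
  unfolding multi_indices_def by (rule finite_subset[of _ "{..<q} \<rightarrow>\<^sub>E {..<n}"]) (auto intro: finite_PiE)

lemma multi_indices_less: "k \<in> multi_indices q n \<Longrightarrow> i < q \<Longrightarrow> k i < n"
  by (auto simp: multi_indices_def PiE_iff)

lemma grid_less: "strict_mono_on {..n} t \<Longrightarrow> j < n \<Longrightarrow> t j < t (Suc j)" for t :: "nat \<Rightarrow> real"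
  by (rule strict_mono_onD[of "{..n}" t]) auto

lemma grid_le: "strict_mono_on {..n} t \<Longrightarrow> i \<le> j \<Longrightarrow> j \<le> n \<Longrightarrow> t i \<le> t j" for t :: "nat \<Rightarrow> real"
  by (cases "i = j") (auto intro!: less_imp_le strict_mono_onD[of "{..n}" t])

lemma grid_index_less:
  fixes t :: "nat \<Rightarrow> real"
  assumes "strict_mono_on {..n} t" "t i < t j" "i \<le> n" "j \<le> n" shows "i < j"
  using grid_le[OF assms(1), of j i] assms by (meson not_less)

lemma step_integral_eq_grid_sum: "step_integral B q n t a \<omega> = grid_sum q n t a (\<lambda>i x. B x \<omega>)"
  by (simp add: step_integral_def grid_sum_def)

lemma step_function_eq_grid_sum:
  assumes t: "strict_mono_on {..n} t"
  shows "step_function q n t a y = grid_sum q n t a (\<lambda>i x. of_bool (y i \<le> x))"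
  unfolding step_function_def grid_sum_def
proof (intro sum.cong arg_cong2[of _ _ _ _ "(*)"] prod.cong refl)
  fix k i assume "k \<in> multi_indices q n" "i \<in> {..<q}"
  then have "t (k i) < t (Suc (k i))" using grid_less[OF t] multi_indices_less by auto
  then show "indicator {t (k i)<..t (Suc (k i))} (y i)
      = (of_bool (y i \<le> t (Suc (k i))) - of_bool (y i \<le> t (k i)) :: real)"
    by (auto split: split_indicator)
qed

lemma grid_sum_diff: "grid_sum q n t (\<lambda>k. a k - b k) \<Phi> = grid_sum q n t a \<Phi> - grid_sum q n t b \<Phi>"
  by (simp add: grid_sum_def sum_subtractf[symmetric] left_diff_distrib)

text \<open>An increment over a coarse interval telescopes into increments over fine ones, and the
  product of these sums expands. The new coefficients depend on the grids and on a, never on \<Phi>,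
  which is what lets one refinement serve function and integral together.\<close>

lemma grid_refine:
  assumes t: "strict_mono_on {..n} t" and s: "strict_mono_on {..m} s" and sub: "t ` {..n} \<subseteq> s ` {..m}"
  shows "\<exists>b. \<forall>\<Phi>. grid_sum q n t a \<Phi> = grid_sum q m s b \<Phi>"
proof -
  have "\<forall>j\<in>{..n}. \<exists>l. l \<le> m \<and> s l = t j" using sub by (force simp: image_subset_iff image_iff)
  \<comment> \<open>r j is the position of t j in the finer grid; J j below consists of the fine
    intervals that make up the j-th coarse one.\<close>
  then obtain r where r: "\<And>j. j \<le> n \<Longrightarrow> r j \<le> m \<and> s (r j) = t j" by (metis atMost_iff)
  have rmono: "r i < r j" if "i < j" "j \<le> n" for i j
    by (rule grid_index_less[OF s]) (use r that strict_mono_onD[OF t, of i j] in auto)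
  have rmono': "r i \<le> r j" if "i \<le> j" "j \<le> n" for i j
    using rmono[of i j] that by (cases "i = j") auto
  define J where "J j = {r j..<r (Suc j)}" for j
  have J: "\<Phi> (t (Suc j)) - \<Phi> (t j) = (\<Sum>l\<in>J j. \<Phi> (s (Suc l)) - \<Phi> (s l))" if "j < n" for j and \<Phi> :: "real \<Rightarrow> real"
    using sum_Suc_diff'[of "r j" "r (Suc j)" "\<lambda>l. \<Phi> (s l)"] rmono[of j "Suc j"] r[of j] r[of "Suc j"] that
    by (simp add: J_def)
  have disj: "j = j'" if "l \<in> J j" "l \<in> J j'" "j < n" "j' < n" for l j j'
  proof (rule ccontr)
    assume "j \<noteq> j'"
    then consider "Suc j \<le> j'" | "Suc j' \<le> j" by linarith
    then show False using that rmono'[of "Suc j" j'] rmono'[of "Suc j'" j] by cases (auto simp: J_def)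
  qed
  have sub: "PiE {..<q} (\<lambda>i. J (k i)) \<subseteq> multi_indices q m" if k: "k \<in> multi_indices q n" for k
  proof
    fix l assume l: "l \<in> PiE {..<q} (\<lambda>i. J (k i))"
    have li: "l i \<in> J (k i)" if "i < q" for i using l that by (auto simp: PiE_iff)
    have "l i < m" if "i < q" for i
      using li[OF that] r[of "Suc (k i)"] multi_indices_less[OF k that] by (auto simp: J_def)
    \<comment> \<open>Refined boxes still avoid the diagonals, since fine intervals taken from
      distinct coarse ones are distinct.\<close>
    moreover have "inj_on l {..<q}"
    proof (rule inj_onI)
      fix i i' assume i: "i \<in> {..<q}" "i' \<in> {..<q}" "l i = l i'"
      then have "l i \<in> J (k i)" "l i \<in> J (k i')" using li[of i] li[of i'] by auto
      then have "k i = k i'" by (rule disj) (use i multi_indices_less[OF k] in auto)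
      then show "i = i'" using k i by (auto simp: multi_indices_def inj_on_def)
    qed
    ultimately show "l \<in> multi_indices q m" using l by (auto simp: multi_indices_def PiE_iff)
  qed
  \<comment> \<open>At most one k contributes, as the sets J j are disjoint; the sum spares a choice
    of that k and gives 0 when there is none.\<close>
  define b where "b l = (\<Sum>k\<in>multi_indices q n. a k * of_bool (l \<in> PiE {..<q} (\<lambda>i. J (k i))))" for l
  show ?thesis
  proof (intro exI[of _ b] allI)
    fix \<Phi> :: "nat \<Rightarrow> real \<Rightarrow> real"
    let ?P = "\<lambda>l. \<Prod>i<q. \<Phi> i (s (Suc (l i))) - \<Phi> i (s (l i))"
    have "grid_sum q n t a \<Phi> = (\<Sum>k\<in>multi_indices q n. a k * (\<Prod>i<q. \<Sum>l\<in>J (k i). \<Phi> i (s (Suc l)) - \<Phi> i (s l)))"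
      unfolding grid_sum_def
      by (intro sum.cong arg_cong2[of _ _ _ _ "(*)"] prod.cong refl J) (auto intro: multi_indices_less)
    also have "\<dots> = (\<Sum>k\<in>multi_indices q n. a k * (\<Sum>l\<in>PiE {..<q} (\<lambda>i. J (k i)). ?P l))"
      by (intro sum.cong arg_cong2[of _ _ _ _ "(*)"] refl prod_sum_PiE) (auto simp: J_def)
    also have "\<dots> = (\<Sum>k\<in>multi_indices q n. \<Sum>l\<in>multi_indices q m. a k * of_bool (l \<in> PiE {..<q} (\<lambda>i. J (k i))) * ?P l)"
    proof (intro sum.cong refl)
      fix k assume k: "k \<in> multi_indices q n"
      have "(\<Sum>l\<in>PiE {..<q} (\<lambda>i. J (k i)). ?P l)
        = (\<Sum>l\<in>multi_indices q m. if l \<in> PiE {..<q} (\<lambda>i. J (k i)) then ?P l else 0)"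
        using sub[OF k] by (simp add: sum.inter_restrict[symmetric] Int_absorb1)
      then show "a k * (\<Sum>l\<in>PiE {..<q} (\<lambda>i. J (k i)). ?P l)
         = (\<Sum>l\<in>multi_indices q m. a k * of_bool (l \<in> PiE {..<q} (\<lambda>i. J (k i))) * ?P l)"
        by (simp add: sum_distrib_left) (intro sum.cong refl, simp)
    qed
    also have "\<dots> = grid_sum q m s b \<Phi>"
      unfolding grid_sum_def b_def by (subst sum.swap) (simp only: sum_distrib_right)
    finally show "grid_sum q n t a \<Phi> = grid_sum q m s b \<Phi>" .
  qed
qed

lemma grid_enumerate:
  fixes P :: "real set"
  assumes "finite P" "P \<noteq> {}"
  shows "\<exists>(m::nat) s. strict_mono_on {..m} s \<and> s ` {..m} = P"
proof -
  let ?xs = "sorted_list_of_set P"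
  have len: "length ?xs = card P" by simp
  have "card P > 0" using assms by (simp add: card_gt_0_iff)
  then have *: "{..card P - 1} = {..<length ?xs}" by auto
  have "strict_mono_on {..<length ?xs} ((!) ?xs)"
    by (rule strict_mono_onI) (auto intro: sorted_wrt_nth_less[OF strict_sorted_list_of_set])
  moreover have "(!) ?xs ` {..<length ?xs} = P"
    using assms by (metis atLeast0LessThan atLeast_upt list.set_map map_nth set_sorted_list_of_set)
  ultimately show ?thesis
    by (intro exI[of _ "card P - 1"] exI[of _ "(!) ?xs"]) (simp only: * conj_absorb simp_thms)
qed

lemma step_refine:
  assumes t: "strict_mono_on {..n} t" and s: "strict_mono_on {..m} s" and sub: "t ` {..n} \<subseteq> s ` {..m}"
  obtains b where "step_function q n t a = step_function q m s b"
    "\<And>B. step_integral B q n t a = (step_integral B q m s b :: 'a \<Rightarrow> real)"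
proof -
  from grid_refine[OF assms, of q a] obtain b where b: "\<And>\<Phi>. grid_sum q n t a \<Phi> = grid_sum q m s b \<Phi>" by blast
  show thesis
  proof (rule that)
    show "step_function q n t a = step_function q m s b"
      by (rule ext) (simp add: step_function_eq_grid_sum[OF t] step_function_eq_grid_sum[OF s] b)
    show "step_integral B q n t a = (step_integral B q m s b :: 'a \<Rightarrow> real)" for B
      by (rule ext) (simp add: step_integral_eq_grid_sum b)
  qed
qed

text \<open>Both grids are refined to their union. This is the linearity of the step integral for
  functions given on different grids, with the same coefficients on the function side and on the
  integral side.\<close>

lemma step_diff:
  assumes t: "strict_mono_on {..n} t" and s: "strict_mono_on {..m} s"
  obtains l u c where "strict_mono_on {..l} u"
    "\<And>y. step_function q l u c y = step_function q n t a y - step_function q m s b y"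
    "\<And>B \<omega>. step_integral B q l u c \<omega> = step_integral B q n t a \<omega> - (step_integral B q m s b :: 'a \<Rightarrow> real) \<omega>"
proof -
  from grid_enumerate[of "t ` {..n} \<union> s ` {..m}"] obtain l :: nat and u
    where u: "strict_mono_on {..l} u" "u ` {..l} = t ` {..n} \<union> s ` {..m}" by auto
  from step_refine[OF t u(1), of q a, where 'a='a] u obtain a' where a': "step_function q n t a = step_function q l u a'"
    "\<And>B. step_integral B q n t a = (step_integral B q l u a' :: 'a \<Rightarrow> real)" by (metis Un_upper1)
  from step_refine[OF s u(1), of q b, where 'a='a] u obtain b' where b': "step_function q m s b = step_function q l u b'"
    "\<And>B. step_integral B q m s b = (step_integral B q l u b' :: 'a \<Rightarrow> real)" by (metis Un_upper2)
  show thesis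
    by (rule that[OF u(1), of "\<lambda>k. a' k - b' k"])
       (simp_all add: a' b' step_function_eq_grid_sum[OF u(1)] step_integral_eq_grid_sum grid_sum_diff)
qed

text \<open>As u and v are grid points, every box lies either inside the cube or outside it, so
  cutting the function off amounts to discarding coefficients.\<close>

lemma step_function_truncate:
  assumes t: "strict_mono_on {..n} t" and uv: "u \<in> t ` {..n}" "v \<in> t ` {..n}"
  shows "step_function q n t (\<lambda>k. if \<forall>i<q. u \<le> t (k i) \<and> t (Suc (k i)) \<le> v then a k else 0) y
    = step_function q n t a y * of_bool (\<forall>i<q. y i \<in> {u<..v})"
  unfolding step_function_def sum_distrib_right
proof (rule sum.cong[OF refl])
  fix k assume k: "k \<in> multi_indices q n"
  let ?I = "\<Prod>i<q. indicator {t (k i)<..t (Suc (k i))} (y i) :: real"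
  show "(if \<forall>i<q. u \<le> t (k i) \<and> t (Suc (k i)) \<le> v then a k else 0) * ?I
     = a k * ?I * of_bool (\<forall>i<q. y i \<in> {u<..v})"
  proof (cases "\<forall>i<q. y i \<in> {t (k i)<..t (Suc (k i))}")
    case True
    have "(\<forall>i<q. u \<le> t (k i) \<and> t (Suc (k i)) \<le> v) \<longleftrightarrow> (\<forall>i<q. y i \<in> {u<..v})"
    proof (intro all_cong)
      fix i assume i: "i < q"
      have yi: "t (k i) < y i" "y i \<le> t (Suc (k i))" using True i by auto
      have ki: "k i < n" using multi_indices_less[OF k i] .
      obtain j j' where j: "j \<le> n" "u = t j" "j' \<le> n" "v = t j'" using uv by auto
      have "u \<le> t (k i) \<longleftrightarrow> u < y i"
      proof
        assume "u < y i"
        then have "j < Suc (k i)" using yi j ki by (intro grid_index_less[OF t]) auto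
        then show "u \<le> t (k i)" using grid_le[OF t, of j "k i"] j ki by simp
      qed (use yi in linarith)
      moreover have "t (Suc (k i)) \<le> v \<longleftrightarrow> y i \<le> v"
      proof
        assume "y i \<le> v"
        then have "k i < j'" using yi j ki by (intro grid_index_less[OF t]) auto
        then show "t (Suc (k i)) \<le> v" using grid_le[OF t, of "Suc (k i)" j'] j ki by simp
      qed (use yi in linarith)
      ultimately show "(u \<le> t (k i) \<and> t (Suc (k i)) \<le> v) \<longleftrightarrow> y i \<in> {u<..v}" by simp
    qed
    then show ?thesis by simp
  next
    case False
    then obtain i where i: "i < q" "y i \<notin> {t (k i)<..t (Suc (k i))}" by auto
    have "?I = 0" by (rule prod_zero[OF finite_lessThan], rule bexI[of _ i]) (use i in auto)
    then show ?thesis by simp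
  qed
qed

lemma borel_measurable_step_function[measurable]:
  "step_function q n t a \<in> borel_measurable (Pi\<^sub>M {..<q} (\<lambda>_. lborel))"
  unfolding step_function_def [abs_def]
  by (intro borel_measurable_sum borel_measurable_times borel_measurable_prod) (auto simp: measurable_lborel2)

text \<open>Boxes with different multi-indices are disjoint, so the mixed products in the square
  vanish and each box contributes its volume.\<close>

lemma nn_integral_step_function_square:
  assumes t: "strict_mono_on {..n} t"
  shows "(\<integral>\<^sup>+ y. ennreal ((step_function q n t a y)\<^sup>2) \<partial>Pi\<^sub>M {..<q} (\<lambda>_. lborel)) = ennreal (grid_norm q n t a)"
proof -
  interpret product_sigma_finite "\<lambda>_::nat. lborel :: real measure" by standard
  let ?I = "\<lambda>k y. \<Prod>i<q. indicator {t (k i)<..t (Suc (k i))} (y i) :: real"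
  have le: "t (k i) \<le> t (Suc (k i))" if "k \<in> multi_indices q n" "i < q" for k i
    using grid_less[OF t] multi_indices_less[OF that] by (simp add: less_imp_le)
  have orth: "?I k y * ?I k' y = (if k = k' then ?I k y else 0)"
    if k: "k \<in> multi_indices q n" "k' \<in> multi_indices q n" for k k' y
  proof (cases "k = k'")
    case True
    then show ?thesis by (simp add: prod.distrib[symmetric] indicator_inter_arith[symmetric])
  next
    case False
    then obtain i where i: "i < q" "k i \<noteq> k' i"
      using k unfolding multi_indices_def by (metis (no_types, lifting) PiE_ext lessThan_iff mem_Collect_eq)
    have "indicator {t (k i)<..t (Suc (k i))} (y i) * indicator {t (k' i)<..t (Suc (k' i))} (y i) = (0::real)"
    proof (rule ccontr)
      assume "\<not> ?thesis"
      then have "t (k i) < t (Suc (k' i))" "t (k' i) < t (Suc (k i))" by (auto split: split_indicator_asm)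
      then have "k i < Suc (k' i)" "k' i < Suc (k i)"
        using multi_indices_less[OF k(1) i(1)] multi_indices_less[OF k(2) i(1)]
        by (auto intro!: grid_index_less[OF t])
      then show False using i by simp
    qed
    then show ?thesis using i False
      by (auto simp: prod.distrib[symmetric] prod_zero_iff)
  qed
  have sq: "(step_function q n t a y)\<^sup>2 = (\<Sum>k\<in>multi_indices q n. (a k)\<^sup>2 * ?I k y)" for y
  proof -
    have "(step_function q n t a y)\<^sup>2
      = (\<Sum>k\<in>multi_indices q n. \<Sum>k'\<in>multi_indices q n. (a k * a k') * (?I k y * ?I k' y))"
      by (simp add: step_function_def power2_eq_square sum_product ac_simps)
    also have "\<dots> = (\<Sum>k\<in>multi_indices q n. \<Sum>k'\<in>multi_indices q n. if k = k' then (a k * a k') * ?I k y else 0)"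
      by (intro sum.cong refl) (simp add: orth)
    also have "\<dots> = (\<Sum>k\<in>multi_indices q n. (a k)\<^sup>2 * ?I k y)"
      by (intro sum.cong refl) (simp add: power2_eq_square)
    finally show ?thesis .
  qed
  have nn: "(\<integral>\<^sup>+ y. ennreal (?I k y) \<partial>Pi\<^sub>M {..<q} (\<lambda>_. lborel)) = ennreal (\<Prod>i<q. t (Suc (k i)) - t (k i))"
    if k: "k \<in> multi_indices q n" for k
  proof -
    have "(\<integral>\<^sup>+ y. ennreal (?I k y) \<partial>Pi\<^sub>M {..<q} (\<lambda>_. lborel))
      = (\<integral>\<^sup>+ y. (\<Prod>i<q. indicator {t (k i)<..t (Suc (k i))} (y i)) \<partial>Pi\<^sub>M {..<q} (\<lambda>_. lborel))"
      by (intro nn_integral_cong) (simp add: prod_ennreal[symmetric] ennreal_indicator)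
    also have "\<dots> = (\<Prod>i<q. \<integral>\<^sup>+ y. indicator {t (k i)<..t (Suc (k i))} y \<partial>lborel)"
      by (rule product_nn_integral_prod) auto
    also have "\<dots> = (\<Prod>i<q. ennreal (t (Suc (k i)) - t (k i)))"
      using le[OF k] by (intro prod.cong) auto
    also have "\<dots> = ennreal (\<Prod>i<q. t (Suc (k i)) - t (k i))"
      using le[OF k] by (intro prod_ennreal) auto
    finally show ?thesis .
  qed
  have "(\<integral>\<^sup>+ y. ennreal ((step_function q n t a y)\<^sup>2) \<partial>Pi\<^sub>M {..<q} (\<lambda>_. lborel))
    = (\<integral>\<^sup>+ y. (\<Sum>k\<in>multi_indices q n. ennreal ((a k)\<^sup>2) * ennreal (?I k y)) \<partial>Pi\<^sub>M {..<q} (\<lambda>_. lborel))"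
    by (intro nn_integral_cong) (simp add: sq sum_ennreal[symmetric] prod_nonneg ennreal_mult)
  also have "\<dots> = (\<Sum>k\<in>multi_indices q n. \<integral>\<^sup>+ y. ennreal ((a k)\<^sup>2) * ennreal (?I k y) \<partial>Pi\<^sub>M {..<q} (\<lambda>_. lborel))"
    by (rule nn_integral_sum) (auto simp: measurable_lborel2)
  also have "\<dots> = (\<Sum>k\<in>multi_indices q n. ennreal ((a k)\<^sup>2) * ennreal (\<Prod>i<q. t (Suc (k i)) - t (k i)))"
    by (intro sum.cong refl, subst nn_integral_cmult) (auto simp: nn measurable_lborel2)
  also have "\<dots> = ennreal (grid_norm q n t a)"
  proof -
    have nn: "0 \<le> (\<Prod>i<q. t (Suc (k i)) - t (k i))" if "k \<in> multi_indices q n" for k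
      using le[OF that] by (intro prod_nonneg) auto
    then show ?thesis
      unfolding grid_norm_def by (subst sum_ennreal[symmetric]) (auto simp: ennreal_mult)
  qed
  finally show ?thesis .
qed

lemma grid_norm_nonneg: "strict_mono_on {..n} t \<Longrightarrow> 0 \<le> grid_norm q n t a"
  unfolding grid_norm_def
  by (intro sum_nonneg mult_nonneg_nonneg prod_nonneg ballI)
     (auto simp: less_imp_le[OF grid_less] multi_indices_less)

section \<open>Moments of Gaussian chaos\<close>

lemma convex_power_real: "convex_on {0::real..} (\<lambda>x. x ^ k)"
proof (cases "even k")
  case True
  show ?thesis by (rule convex_on_subset[OF convex_power_even[OF True]]) auto
qed (rule convex_power_odd)

text \<open>Minkowski's inequality for nonnegative variables, stated without k-th roots. It is
  convexity of the k-th power at U / a and V / b with the weights a / (a + b) and b / (a +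
  b).\<close>

lemma (in prob_space) expectation_add_power_le:
  assumes U: "all_moments M U" "\<And>\<omega>. 0 \<le> U \<omega>" "expectation (\<lambda>\<omega>. U \<omega> ^ k) \<le> a ^ k" "0 \<le> a"
    and V: "all_moments M V" "\<And>\<omega>. 0 \<le> V \<omega>" "expectation (\<lambda>\<omega>. V \<omega> ^ k) \<le> b ^ k" "0 \<le> b"
  shows "expectation (\<lambda>\<omega>. (U \<omega> + V \<omega>) ^ k) \<le> (a + b) ^ k"
proof -
  have pos: "expectation (\<lambda>\<omega>. (U \<omega> + V \<omega>) ^ k) \<le> (a + b) ^ k"
    if U3: "expectation (\<lambda>\<omega>. U \<omega> ^ k) \<le> a ^ k" "0 < a" and V3: "expectation (\<lambda>\<omega>. V \<omega> ^ k) \<le> b ^ k" "0 < b" for a b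
  proof -
    define \<theta> where "\<theta> = b / (a + b)"
    have \<theta>: "0 \<le> \<theta>" "\<theta> \<le> 1" "1 - \<theta> = a / (a + b)" using U3 V3 by (auto simp: \<theta>_def field_simps)
    have le: "(U \<omega> + V \<omega>) ^ k \<le> (a + b) ^ k * ((1 - \<theta>) * (U \<omega> ^ k / a ^ k) + \<theta> * (V \<omega> ^ k / b ^ k))" for \<omega>
    proof -
      have "(U \<omega> + V \<omega>) = (a + b) * ((1 - \<theta>) * (U \<omega> / a) + \<theta> * (V \<omega> / b))"
      proof -
        have e: "(a + b) * (1 - \<theta>) = a" "(a + b) * \<theta> = b"
          unfolding \<theta>(3) using U3 V3 by (auto simp: \<theta>_def)
        have "(a + b) * ((1 - \<theta>) * (U \<omega> / a) + \<theta> * (V \<omega> / b))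
          = ((a + b) * (1 - \<theta>)) * (U \<omega> / a) + ((a + b) * \<theta>) * (V \<omega> / b)"
          by (simp only: distrib_left mult.assoc)
        then show ?thesis unfolding e using U3 V3 by simp
      qed
      then have "(U \<omega> + V \<omega>) ^ k = (a + b) ^ k * ((1 - \<theta>) * (U \<omega> / a) + \<theta> * (V \<omega> / b)) ^ k"
        by (simp add: power_mult_distrib)
      also have "((1 - \<theta>) * (U \<omega> / a) + \<theta> * (V \<omega> / b)) ^ k \<le> (1 - \<theta>) * (U \<omega> / a) ^ k + \<theta> * (V \<omega> / b) ^ k"
        using convex_onD[OF convex_power_real, of \<theta> "U \<omega> / a" "V \<omega> / b" k] \<theta> U(2) V(2) U3 V3
        by simp
      finally show ?thesis using U3 V3 by (simp add: power_divide mult_left_mono)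
    qed
    have i: "integrable M (\<lambda>\<omega>. U \<omega> ^ k)" "integrable M (\<lambda>\<omega>. V \<omega> ^ k)" "integrable M (\<lambda>\<omega>. (U \<omega> + V \<omega>) ^ k)"
      using U V by (auto intro!: all_moments_integrable all_moments_intros)
    have "expectation (\<lambda>\<omega>. (U \<omega> + V \<omega>) ^ k)
      \<le> expectation (\<lambda>\<omega>. (a + b) ^ k * ((1 - \<theta>) * (U \<omega> ^ k / a ^ k) + \<theta> * (V \<omega> ^ k / b ^ k)))"
      by (rule integral_mono) (use i le in auto)
    also have "\<dots> = (a + b) ^ k * ((1 - \<theta>) * (expectation (\<lambda>\<omega>. U \<omega> ^ k) / a ^ k) + \<theta> * (expectation (\<lambda>\<omega>. V \<omega> ^ k) / b ^ k))"
      using i by simp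
    also have "\<dots> \<le> (a + b) ^ k * ((1 - \<theta>) * 1 + \<theta> * 1)"
      using U3 V3 \<theta> by (intro mult_left_mono add_mono) (auto simp: divide_le_eq)
    finally show ?thesis by simp
  qed
  \<comment> \<open>The argument divides by a and b; zero bounds are reached as limits of positive
    ones.\<close>
  have "(\<lambda>n. ((a + 1 / Suc n) + (b + 1 / Suc n)) ^ k) \<longlonglongrightarrow> ((a + 0) + (b + 0)) ^ k"
    by (intro tendsto_intros LIMSEQ_Suc[OF lim_1_over_n])
  moreover have "expectation (\<lambda>\<omega>. (U \<omega> + V \<omega>) ^ k) \<le> ((a + 1 / Suc n) + (b + 1 / Suc n)) ^ k" for n
  proof (rule pos)
    have "a ^ k \<le> (a + 1 / Suc n) ^ k" "b ^ k \<le> (b + 1 / Suc n) ^ k" using U V by (auto intro!: power_mono)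
    then show "expectation (\<lambda>\<omega>. U \<omega> ^ k) \<le> (a + 1 / Suc n) ^ k" "expectation (\<lambda>\<omega>. V \<omega> ^ k) \<le> (b + 1 / Suc n) ^ k"
      using U V by auto
  qed (use U V in \<open>auto intro!: add_nonneg_pos\<close>)
  ultimately show ?thesis using LIMSEQ_le_const by fastforce
qed

text \<open>The double factorial (2 k - 1)!!, the moment of order 2 k of the standard normal
  law.\<close>

definition gauss_moment :: "nat \<Rightarrow> real" where
  "gauss_moment k = fact (2 * k) / (2 ^ k * fact k)"

text \<open>The sum is E (1 + N)^(2 k) for a standard normal N. It is far from optimal, but it
  dominates each of its terms, and the extra 1 makes it visibly at least 1.\<close>

definition hyper_const :: "nat \<Rightarrow> real" where
  "hyper_const k = 1 + (\<Sum>j\<le>k. real (2 * k choose (2 * j)) * gauss_moment j)"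

lemma gauss_moment_nonneg: "0 \<le> gauss_moment k"
  by (simp add: gauss_moment_def)

lemma hyper_const_ge_1: "1 \<le> hyper_const k"
  unfolding hyper_const_def by (auto intro!: sum_nonneg mult_nonneg_nonneg gauss_moment_nonneg)

text \<open>Compares the coefficients of E (x + N y)^(2 k), N standard normal, with those of (x^2 +
  K y^2)^k. For j = 0 both are 1; for j > 0 the bound K \<le> K^j does it.\<close>

lemma hyper_const_power:
  assumes j: "j \<le> k"
  shows "real (2 * k choose (2 * j)) * gauss_moment j \<le> real (k choose j) * hyper_const k ^ j"
proof (cases "j = 0")
  case True
  then show ?thesis by (simp add: gauss_moment_def)
next
  case False
  have "real (2 * k choose (2 * j)) * gauss_moment j \<le> (\<Sum>j\<le>k. real (2 * k choose (2 * j)) * gauss_moment j)"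
    using j by (intro member_le_sum) (auto intro!: mult_nonneg_nonneg gauss_moment_nonneg)
  then have "real (2 * k choose (2 * j)) * gauss_moment j \<le> hyper_const k"
    unfolding hyper_const_def by linarith
  also have "hyper_const k \<le> hyper_const k ^ j"
    using hyper_const_ge_1[of k] False by (intro self_le_power) auto
  also have "\<dots> \<le> real (k choose j) * hyper_const k ^ j"
    using hyper_const_ge_1[of k] j
    by (simp add: mult_le_cancel_right1 Suc_le_eq)
  finally show ?thesis .
qed

lemma sum_even_only:
  fixes f :: "nat \<Rightarrow> real"
  assumes "\<And>j. f (2 * j + 1) = 0"
  shows "(\<Sum>i\<le>2 * k. f i) = (\<Sum>j\<le>k. f (2 * j))"
  using assms by (induction k) auto

text \<open>Retains of a centered normal law with variance v only its moments, the one property that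
  enters the chaos estimate.\<close>

definition gaussian_moments :: "'a measure \<Rightarrow> ('a \<Rightarrow> real) \<Rightarrow> real \<Rightarrow> bool" where
  "gaussian_moments M X v \<longleftrightarrow> all_moments M X \<and>
     (\<forall>k. (\<integral>\<omega>. X \<omega> ^ (2 * k + 1) \<partial>M) = 0) \<and> (\<forall>k. (\<integral>\<omega>. X \<omega> ^ (2 * k) \<partial>M) = v ^ k * gauss_moment k)"

lemma gaussian_moments_normal:
  assumes X: "distributed M lborel X (normal_density 0 \<sigma>)" and \<sigma>: "0 < \<sigma>"
  shows "gaussian_moments M X (\<sigma>\<^sup>2)"
  unfolding gaussian_moments_def all_moments_def
proof (intro conjI allI)
  show "X \<in> borel_measurable M" using distributed_measurable[OF X] by simp
  show "integrable M (\<lambda>\<omega>. \<bar>X \<omega>\<bar> ^ k)" for k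
    using distributed_integrable[OF X, of "\<lambda>x. \<bar>x\<bar> ^ k"] integrable_normal_moment_abs[OF \<sigma>, of 0 k] by simp
  show "(\<integral>\<omega>. X \<omega> ^ (2 * k + 1) \<partial>M) = 0" for k
    using distributed_integral[OF X, of "\<lambda>x. x ^ (2 * k + 1)"] integral_normal_moment_odd[OF \<sigma>, of 0 k] by simp
  show "(\<integral>\<omega>. X \<omega> ^ (2 * k) \<partial>M) = (\<sigma>\<^sup>2) ^ k * gauss_moment k" for k
    using distributed_integral[OF X, of "\<lambda>x. x ^ (2 * k)"] integral_normal_moment_even[OF \<sigma>, of 0 k]
    by (simp add: gauss_moment_def power_divide)
qed

text \<open>One step of hypercontractivity, averaging out a Gaussian X independent of g and h. In
  the binomial expansion the odd powers of X vanish, and the even ones are compared coefficient by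
  coefficient with the expansion of the right-hand side. Independence is needed only as
  factorization of moments.\<close>

lemma (in prob_space) gaussian_mix_moment_le:
  assumes X: "gaussian_moments M X v" and v: "0 \<le> v" and g: "all_moments M g" and h: "all_moments M h"
    and ind: "\<And>i j l. expectation (\<lambda>\<omega>. (g \<omega> ^ i * h \<omega> ^ j) * X \<omega> ^ l)
        = expectation (\<lambda>\<omega>. g \<omega> ^ i * h \<omega> ^ j) * expectation (\<lambda>\<omega>. X \<omega> ^ l)"
  shows "expectation (\<lambda>\<omega>. (g \<omega> + X \<omega> * h \<omega>) ^ (2 * k))
    \<le> expectation (\<lambda>\<omega>. ((g \<omega>)\<^sup>2 + hyper_const k * v * (h \<omega>)\<^sup>2) ^ k)"
proof -
  have amX: "all_moments M X" using X by (simp add: gaussian_moments_def)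
  let ?E = "\<lambda>i. expectation (\<lambda>\<omega>. g \<omega> ^ (2 * k - i) * h \<omega> ^ i)"
  have "expectation (\<lambda>\<omega>. (g \<omega> + X \<omega> * h \<omega>) ^ (2 * k))
    = expectation (\<lambda>\<omega>. \<Sum>i\<le>2 * k. real (2 * k choose i) * ((g \<omega> ^ (2 * k - i) * h \<omega> ^ i) * X \<omega> ^ i))"
  proof -
    have "(g \<omega> + X \<omega> * h \<omega>) ^ (2 * k)
        = (\<Sum>i\<le>2 * k. real (2 * k choose i) * ((g \<omega> ^ (2 * k - i) * h \<omega> ^ i) * X \<omega> ^ i))" for \<omega>
      unfolding add.commute[of "g \<omega>"] binomial_ring
      by (intro sum.cong refl) (simp add: power_mult_distrib)
    then show ?thesis by simp
  qed
  also have "\<dots> = (\<Sum>i\<le>2 * k. expectation (\<lambda>\<omega>. real (2 * k choose i) * ((g \<omega> ^ (2 * k - i) * h \<omega> ^ i) * X \<omega> ^ i)))"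
    by (intro Bochner_Integration.integral_sum all_moments_integrable all_moments_intros amX g h)
  also have "\<dots> = (\<Sum>i\<le>2 * k. real (2 * k choose i) * (?E i * expectation (\<lambda>\<omega>. X \<omega> ^ i)))"
    by (simp add: ind)
  also have "\<dots> = (\<Sum>j\<le>k. real (2 * k choose (2 * j)) * (?E (2 * j) * expectation (\<lambda>\<omega>. X \<omega> ^ (2 * j))))"
    by (rule sum_even_only) (use X in \<open>simp add: gaussian_moments_def\<close>)
  also have "\<dots> = (\<Sum>j\<le>k. (real (2 * k choose (2 * j)) * gauss_moment j) * (v ^ j * ?E (2 * j)))"
    using X by (simp add: gaussian_moments_def ac_simps)
  also have "\<dots> \<le> (\<Sum>j\<le>k. (real (k choose j) * hyper_const k ^ j) * (v ^ j * ?E (2 * j)))"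
  proof (intro sum_mono mult_right_mono hyper_const_power)
    fix j assume "j \<in> {..k}"
    \<comment> \<open>The comparison of coefficients is legitimate because they multiply
      expectations of squares.\<close>
    then have "?E (2 * j) = expectation (\<lambda>\<omega>. (g \<omega> ^ (k - j) * h \<omega> ^ j)\<^sup>2)"
      by (simp add: power_mult_distrib power_mult[symmetric] diff_mult_distrib ac_simps)
    then show "0 \<le> v ^ j * ?E (2 * j)" using v by simp
  qed auto
  also have "\<dots> = (\<Sum>j\<le>k. expectation (\<lambda>\<omega>. real (k choose j) * (hyper_const k * v * (h \<omega>)\<^sup>2) ^ j * ((g \<omega>)\<^sup>2) ^ (k - j)))"
  proof (intro sum.cong refl)
    fix j assume "j \<in> {..k}"
    then have "(\<lambda>\<omega>. real (k choose j) * (hyper_const k * v * (h \<omega>)\<^sup>2) ^ j * ((g \<omega>)\<^sup>2) ^ (k - j))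
      = (\<lambda>\<omega>. (real (k choose j) * hyper_const k ^ j * v ^ j) * (g \<omega> ^ (2 * k - 2 * j) * h \<omega> ^ (2 * j)))"
      by (simp add: power_mult_distrib power_mult[symmetric] diff_mult_distrib ac_simps)
    then show "(real (k choose j) * hyper_const k ^ j) * (v ^ j * ?E (2 * j))
       = expectation (\<lambda>\<omega>. real (k choose j) * (hyper_const k * v * (h \<omega>)\<^sup>2) ^ j * ((g \<omega>)\<^sup>2) ^ (k - j))"
      by simp
  qed
  also have "\<dots> = expectation (\<lambda>\<omega>. \<Sum>j\<le>k. real (k choose j) * (hyper_const k * v * (h \<omega>)\<^sup>2) ^ j * ((g \<omega>)\<^sup>2) ^ (k - j))"
    by (intro Bochner_Integration.integral_sum[symmetric] all_moments_integrable all_moments_intros amX g h)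
  also have "\<dots> = expectation (\<lambda>\<omega>. ((g \<omega>)\<^sup>2 + hyper_const k * v * (h \<omega>)\<^sup>2) ^ k)"
    by (simp only: binomial_ring add.commute[of "(g _)\<^sup>2"])
  finally show ?thesis .
qed

text \<open>
  Since the boxes avoid the diagonals, a step integral is a polynomial in the increments that is
  affine in each of them; such polynomials are indexed by sets of variables.
\<close>

definition multilinear :: "nat \<Rightarrow> (nat set \<Rightarrow> real) \<Rightarrow> (nat \<Rightarrow> real) \<Rightarrow> real" where
  "multilinear n c x = (\<Sum>A\<in>Pow {..<n}. c A * (\<Prod>j\<in>A. x j))"

lemma sum_Pow_Suc:
  fixes f :: "nat set \<Rightarrow> real"
  shows "(\<Sum>A\<in>Pow {..<Suc n}. f A) = (\<Sum>A\<in>Pow {..<n}. f A) + (\<Sum>A\<in>Pow {..<n}. f (insert n A))"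
proof -
  have "(\<Sum>A\<in>Pow {..<Suc n}. f A) = (\<Sum>A\<in>Pow {..<n}. f A) + (\<Sum>A\<in>insert n ` Pow {..<n}. f A)"
    unfolding lessThan_Suc Pow_insert by (rule sum.union_disjoint) auto
  also have "(\<Sum>A\<in>insert n ` Pow {..<n}. f A) = (\<Sum>A\<in>Pow {..<n}. f (insert n A))"
    by (rule sum.reindex_cong[of "insert n"])
       (auto simp: inj_on_def insert_ident[of n] subset_eq dest!: insert_ident[THEN iffD1, rotated 2])
  finally show ?thesis .
qed

lemma multilinear_Suc:
  "multilinear (Suc n) c x = multilinear n c x + x n * multilinear n (\<lambda>A. c (insert n A)) x"
proof -
  have "(\<Prod>j\<in>insert n A. x j) = x n * (\<Prod>j\<in>A. x j)" if "A \<in> Pow {..<n}" for A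
    using that by (intro prod.insert) (auto intro: finite_subset)
  then have "(\<Sum>A\<in>Pow {..<n}. c (insert n A) * (\<Prod>j\<in>insert n A. x j))
      = (\<Sum>A\<in>Pow {..<n}. x n * (c (insert n A) * (\<Prod>j\<in>A. x j)))"
    by (intro sum.cong refl) (simp add: ac_simps)
  then show ?thesis
    by (simp add: multilinear_def sum_Pow_Suc sum_distrib_left)
qed

text \<open>Lets the polynomial be read on a product space, whose points are restricted functions,
  when independence of blocks of variables is used.\<close>

lemma multilinear_restrict: "multilinear n c (restrict x {..<n}) = multilinear n c x"
  unfolding multilinear_def
  by (intro sum.cong arg_cong2[of _ _ _ _ "(*)"] prod.cong refl) auto

lemma multilinear_measurable[measurable]: "multilinear n c \<in> borel_measurable (Pi\<^sub>M {..<n} (\<lambda>_. borel))"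
  unfolding multilinear_def [abs_def]
  by (intro borel_measurable_sum borel_measurable_times borel_measurable_prod borel_measurable_const
      measurable_component_singleton) auto

context prob_space
begin

lemma all_moments_multilinear:
  assumes "\<And>j. j < n \<Longrightarrow> all_moments M (X j)"
  shows "all_moments M (\<lambda>\<omega>. multilinear n c (\<lambda>j. X j \<omega>))"
  unfolding multilinear_def by (intro all_moments_sum all_moments_cmult all_moments_prod assms) auto

text \<open>The polynomial is g + X_n h with g and h free of the last variable.
  \<open>gaussian_mix_moment_le\<close> averages out X_n, and
  \<open>expectation_add_power_le\<close> separates the two squares. Only h pays a factor K, and its
  degree is lower by one, so the exponent of K is the degree q and not the number of variables; this
  makes the bound uniform over all grids.\<close>

lemma multilinear_moment_le:
  assumes "indep_vars (\<lambda>_. borel) X {..<n}"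
    and "\<And>j. j < n \<Longrightarrow> gaussian_moments M (X j) (v j)" "\<And>j. j < n \<Longrightarrow> 0 \<le> v j"
    and "\<And>A. A \<subseteq> {..<n} \<Longrightarrow> c A \<noteq> 0 \<Longrightarrow> card A \<le> q"
  shows "expectation (\<lambda>\<omega>. multilinear n c (\<lambda>j. X j \<omega>) ^ (2 * k))
    \<le> (hyper_const k ^ q * multilinear n (\<lambda>A. (c A)\<^sup>2) v) ^ k"
  using assms
proof (induction n arbitrary: c q)
  case 0
  have "(c {})\<^sup>2 ^ k \<le> (hyper_const k ^ q * (c {})\<^sup>2) ^ k"
    using hyper_const_ge_1[of k] one_le_power[of "hyper_const k" q]
    by (intro power_mono) (auto simp: mult_le_cancel_right1)
  then show ?case by (simp add: multilinear_def prob_space power_mult)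
next
  case (Suc n)
  let ?c = "\<lambda>A. c (insert n A)" and ?K = "hyper_const k"
  define g where "g \<omega> = multilinear n c (\<lambda>j. X j \<omega>)" for \<omega>
  define h where "h \<omega> = multilinear n ?c (\<lambda>j. X j \<omega>)" for \<omega>
  define mg where "mg = multilinear n (\<lambda>A. (c A)\<^sup>2) v"
  define mh where "mh = multilinear n (\<lambda>A. (?c A)\<^sup>2) v"
  have K: "1 \<le> ?K" by (rule hyper_const_ge_1)
  have indn: "indep_vars (\<lambda>_. borel) X {..<n}" by (rule indep_vars_subset[OF Suc.prems(1)]) auto
  have am: "all_moments M (X j)" if "j < Suc n" for j using Suc.prems(2)[OF that] by (simp add: gaussian_moments_def)
  have mnn: "0 \<le> multilinear n (\<lambda>A. (d A)\<^sup>2) v" for d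
    unfolding multilinear_def using Suc.prems(3) by (intro sum_nonneg mult_nonneg_nonneg prod_nonneg) auto
  have Eg: "expectation (\<lambda>\<omega>. g \<omega> ^ (2 * k)) \<le> (?K ^ q * mg) ^ k"
    unfolding g_def mg_def
    by (rule Suc.IH[OF indn]) (use Suc.prems(2-4) in \<open>auto simp: subset_eq less_Suc_eq\<close>)
  have Eh: "expectation (\<lambda>\<omega>. h \<omega> ^ (2 * k)) \<le> (?K ^ (q - 1) * mh) ^ k"
    unfolding h_def mh_def
  proof (rule Suc.IH[OF indn])
    fix A assume A: "A \<subseteq> {..<n}" "?c A \<noteq> 0"
    then have "card (insert n A) \<le> q" by (intro Suc.prems(4)) auto
    moreover have "card (insert n A) = Suc (card A)"
      using A(1) by (intro card_insert_disjoint) (auto intro: finite_subset)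
    ultimately show "card A \<le> q - 1" by simp
  qed (use Suc.prems(2,3) in auto)
  have amg: "all_moments M g" and amh: "all_moments M h"
    unfolding g_def [abs_def] h_def [abs_def] by (intro all_moments_multilinear am, simp)+
  have ind: "expectation (\<lambda>\<omega>. (g \<omega> ^ i * h \<omega> ^ j) * X n \<omega> ^ l)
      = expectation (\<lambda>\<omega>. g \<omega> ^ i * h \<omega> ^ j) * expectation (\<lambda>\<omega>. X n \<omega> ^ l)" for i j l
  proof -
    have "indep_var
        borel ((\<lambda>x. multilinear n c x ^ i * multilinear n ?c x ^ j) \<circ> (\<lambda>\<omega>. restrict (\<lambda>i. X i \<omega>) {..<n}))
        borel ((\<lambda>x. x n ^ l) \<circ> (\<lambda>\<omega>. restrict (\<lambda>i. X i \<omega>) {n}))"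
      by (rule indep_var_compose[OF indep_var_restrict[OF Suc.prems(1)]]) auto
    then have "indep_var borel (\<lambda>\<omega>. g \<omega> ^ i * h \<omega> ^ j) borel (\<lambda>\<omega>. X n \<omega> ^ l)"
      by (simp add: comp_def multilinear_restrict g_def h_def)
    then show ?thesis
      by (rule indep_var_lebesgue_integral) (auto intro!: all_moments_integrable all_moments_intros amg amh am)
  qed
  have "expectation (\<lambda>\<omega>. multilinear (Suc n) c (\<lambda>j. X j \<omega>) ^ (2 * k))
    = expectation (\<lambda>\<omega>. (g \<omega> + X n \<omega> * h \<omega>) ^ (2 * k))"
    by (simp add: multilinear_Suc g_def h_def)
  also have "\<dots> \<le> expectation (\<lambda>\<omega>. ((g \<omega>)\<^sup>2 + ?K * v n * (h \<omega>)\<^sup>2) ^ k)"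
    by (rule gaussian_mix_moment_le) (use Suc.prems(2,3) ind amg amh in auto)
  also have "\<dots> \<le> (?K ^ q * mg + ?K * v n * (?K ^ (q - 1) * mh)) ^ k"
  proof (rule expectation_add_power_le)
    show "expectation (\<lambda>\<omega>. ((g \<omega>)\<^sup>2) ^ k) \<le> (?K ^ q * mg) ^ k" using Eg by (simp add: power_mult)
    have "expectation (\<lambda>\<omega>. (?K * v n * (h \<omega>)\<^sup>2) ^ k) = (?K * v n) ^ k * expectation (\<lambda>\<omega>. h \<omega> ^ (2 * k))"
      by (simp add: power_mult_distrib power_mult)
    also have "\<dots> \<le> (?K * v n) ^ k * (?K ^ (q - 1) * mh) ^ k"
      using Suc.prems(3) K by (intro mult_left_mono Eh) auto
    finally show "expectation (\<lambda>\<omega>. (?K * v n * (h \<omega>)\<^sup>2) ^ k) \<le> (?K * v n * (?K ^ (q - 1) * mh)) ^ k"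
      by (simp add: power_mult_distrib)
  qed (use K mnn Suc.prems(3) in \<open>auto intro!: all_moments_intros amg amh simp: mg_def mh_def\<close>)
  \<comment> \<open>For q = 0 the difference q - 1 is truncated, and the identity holds because the
    degree bound then kills every coefficient that involves the variable n.\<close>
  also have "?K * v n * (?K ^ (q - 1) * mh) = ?K ^ q * (v n * mh)"
  proof (cases "q = 0")
    case True
    have "mh = 0" unfolding mh_def multilinear_def
    proof (intro sum.neutral ballI)
      fix A assume "A \<in> Pow {..<n}"
      then have "c (insert n A) = 0"
      proof -
        have "insert n A \<subseteq> {..<Suc n}" using \<open>A \<in> Pow {..<n}\<close> by (auto simp: lessThan_Suc)
        moreover from this have "0 < card (insert n A)"
          by (auto simp: card_gt_0_iff intro: finite_subset)
        ultimately show ?thesis using Suc.prems(4)[of "insert n A"] True by linarith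
      qed
      then show "(c (insert n A))\<^sup>2 * prod v A = 0" by simp
    qed
    then show ?thesis by simp
  next
    case False
    then show ?thesis by (cases q) auto
  qed
  also have "?K ^ q * mg + ?K ^ q * (v n * mh) = ?K ^ q * multilinear (Suc n) (\<lambda>A. (c A)\<^sup>2) v"
    by (simp add: multilinear_Suc mg_def mh_def algebra_simps)
  finally show ?case .
qed

end

section \<open>Step integrals as multilinear polynomials in the increments\<close>

text \<open>Products of increments do not see the order of the indices, so all orderings of one
  index set feed a single monomial; this is the discrete form of symmetrizing the kernel.\<close>

definition set_coeff :: "nat \<Rightarrow> nat \<Rightarrow> ((nat \<Rightarrow> nat) \<Rightarrow> real) \<Rightarrow> nat set \<Rightarrow> real" where
  "set_coeff q n a A = (\<Sum>k\<in>{k \<in> multi_indices q n. k ` {..<q} = A}. a k)"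

lemma prod_multi_index: "k \<in> multi_indices q n \<Longrightarrow> (\<Prod>i<q. x (k i)) = (\<Prod>j\<in>k ` {..<q}. x j)"
  for x :: "nat \<Rightarrow> real"
  by (subst prod.reindex) (auto simp: multi_indices_def)

lemma sum_multi_indices:
  fixes F :: "(nat \<Rightarrow> nat) \<Rightarrow> real"
  shows "(\<Sum>k\<in>multi_indices q n. F k) = (\<Sum>A\<in>Pow {..<n}. \<Sum>k\<in>{k \<in> multi_indices q n. k ` {..<q} = A}. F k)"
  by (rule sum.group[symmetric]) (auto simp: multi_indices_less)

lemma sum_multi_eq_multilinear:
  "(\<Sum>k\<in>multi_indices q n. a k * (\<Prod>i<q. x (k i))) = multilinear n (set_coeff q n a) x"
  unfolding sum_multi_indices multilinear_def set_coeff_def sum_distrib_right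
  by (intro sum.cong refl) (auto simp: prod_multi_index)

text \<open>A nonempty fibre consists of bijections onto a set of q elements. Counting all maps
  gives q^q, cruder than q!, but any constant depending on q alone will do.\<close>

lemma card_fibre_le: "card {k \<in> multi_indices q n. k ` {..<q} = A} \<le> q ^ q"
proof (cases "finite A \<and> card A = q")
  case True
  have "card {k \<in> multi_indices q n. k ` {..<q} = A} \<le> card ({..<q} \<rightarrow>\<^sub>E A)"
    using True by (intro card_mono finite_PiE) (auto simp: multi_indices_def PiE_def)
  then show ?thesis using True by (simp add: card_PiE)
next
  case False
  have "k ` {..<q} \<noteq> A" if "k \<in> multi_indices q n" for k
  proof
    assume A: "k ` {..<q} = A"
    have "inj_on k {..<q}" using that by (simp add: multi_indices_def)
    from card_image[OF this] have "card A = q" unfolding A by simp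
    moreover have "finite A" unfolding A[symmetric] by simp
    ultimately show False using False by simp
  qed
  then have "{k \<in> multi_indices q n. k ` {..<q} = A} = {}" by blast
  then show ?thesis by (simp only: card.empty)
qed

text \<open>Cauchy-Schwarz within each fibre, the loss being the size of the fibre.\<close>

lemma multilinear_set_coeff_square_le:
  assumes v: "\<And>j. j < n \<Longrightarrow> 0 \<le> v j"
  shows "multilinear n (\<lambda>A. (set_coeff q n a A)\<^sup>2) v
    \<le> real (q ^ q) * (\<Sum>k\<in>multi_indices q n. (a k)\<^sup>2 * (\<Prod>i<q. v (k i)))"
proof -
  have "(set_coeff q n a A)\<^sup>2 * prod v A
      \<le> (real (q ^ q) * (\<Sum>k\<in>{k \<in> multi_indices q n. k ` {..<q} = A}. (a k)\<^sup>2)) * prod v A" if A: "A \<in> Pow {..<n}" for A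
  proof (rule mult_right_mono)
    have "(set_coeff q n a A)\<^sup>2
      \<le> (\<Sum>k\<in>{k \<in> multi_indices q n. k ` {..<q} = A}. (a k)\<^sup>2) * real (card {k \<in> multi_indices q n. k ` {..<q} = A})"
      unfolding set_coeff_def by (rule sum_squared_le_sum_of_squares)
    also have "\<dots> \<le> (\<Sum>k\<in>{k \<in> multi_indices q n. k ` {..<q} = A}. (a k)\<^sup>2) * real (q ^ q)"
      using card_fibre_le[of q n A] by (intro mult_left_mono of_nat_mono sum_nonneg) auto
    finally show "(set_coeff q n a A)\<^sup>2 \<le> real (q ^ q) * (\<Sum>k\<in>{k \<in> multi_indices q n. k ` {..<q} = A}. (a k)\<^sup>2)"
      by (simp add: mult.commute)
    show "0 \<le> prod v A" using A v by (intro prod_nonneg) auto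
  qed
  then have "multilinear n (\<lambda>A. (set_coeff q n a A)\<^sup>2) v
    \<le> (\<Sum>A\<in>Pow {..<n}. (real (q ^ q) * (\<Sum>k\<in>{k \<in> multi_indices q n. k ` {..<q} = A}. (a k)\<^sup>2)) * prod v A)"
    unfolding multilinear_def by (rule sum_mono)
  also have "\<dots> = real (q ^ q) * (\<Sum>k\<in>multi_indices q n. (a k)\<^sup>2 * (\<Prod>i<q. v (k i)))"
    unfolding sum_multi_indices sum_distrib_left sum_distrib_right
    by (intro sum.cong refl) (auto simp: prod_multi_index)
  finally show ?thesis .
qed

locale brownian = prob_space M for M :: "'a measure" +
  fixes B :: "real \<Rightarrow> 'a \<Rightarrow> real"
  assumes bm: "two_sided_brownian_motion M B"
begin

lemma increment_gaussian: "s < t \<Longrightarrow> gaussian_moments M (\<lambda>\<omega>. B t \<omega> - B s \<omega>) (t - s)"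
  using gaussian_moments_normal[of M "\<lambda>\<omega>. B t \<omega> - B s \<omega>" "sqrt (t - s)"] bm
  by (simp add: two_sided_brownian_motion_def)

lemma increments_indep:
  "strict_mono_on {..n} t \<Longrightarrow> indep_vars (\<lambda>_. borel) (\<lambda>i \<omega>. B (t (Suc i)) \<omega> - B (t i) \<omega>) {..<n}"
  using bm by (simp add: two_sided_brownian_motion_def)

lemma step_integral_eq_multilinear:
  "step_integral B q n t a \<omega> = multilinear n (set_coeff q n a) (\<lambda>j. B (t (Suc j)) \<omega> - B (t j) \<omega>)"
  unfolding step_integral_def by (rule sum_multi_eq_multilinear)

lemma step_integral_all_moments:
  assumes t: "strict_mono_on {..n} t"
  shows "all_moments M (step_integral B q n t a)"
  unfolding step_integral_eq_multilinear [abs_def]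
  using increment_gaussian[OF grid_less[OF t]]
  by (intro all_moments_multilinear) (auto simp: gaussian_moments_def)

text \<open>The power of \<open>hyper_const\<close> comes from the degree of the polynomial, and q^q
  from merging the orderings of an index set.\<close>

lemma step_integral_moment_le:
  assumes t: "strict_mono_on {..n} t"
  shows "expectation (\<lambda>\<omega>. step_integral B q n t a \<omega> ^ (2 * k))
    \<le> ((hyper_const k * real q) ^ q * grid_norm q n t a) ^ k"
proof -
  let ?v = "\<lambda>j. t (Suc j) - t j"
  have v: "0 \<le> ?v j" if "j < n" for j using grid_less[OF t that] by simp
  have K: "0 \<le> hyper_const k" using hyper_const_ge_1[of k] by simp
  have "expectation (\<lambda>\<omega>. step_integral B q n t a \<omega> ^ (2 * k))
    \<le> (hyper_const k ^ q * multilinear n (\<lambda>A. (set_coeff q n a A)\<^sup>2) ?v) ^ k"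
    unfolding step_integral_eq_multilinear
  proof (rule multilinear_moment_le[OF increments_indep[OF t]])
    show "gaussian_moments M (\<lambda>\<omega>. B (t (Suc j)) \<omega> - B (t j) \<omega>) (?v j)" if "j < n" for j
      by (rule increment_gaussian[OF grid_less[OF t that]])
    show "card A \<le> q" if "set_coeff q n a A \<noteq> 0" for A
    proof -
      have "{k \<in> multi_indices q n. k ` {..<q} = A} \<noteq> {}"
        using that unfolding set_coeff_def by (metis sum.empty)
      then obtain k where "k \<in> multi_indices q n" "k ` {..<q} = A" by auto
      then show ?thesis using card_image_le[of "{..<q}" k] by simp
    qed
  qed (use v in auto)
  also have "\<dots> \<le> (hyper_const k ^ q * (real (q ^ q) * grid_norm q n t a)) ^ k"
  proof (intro power_mono mult_left_mono)
    show "multilinear n (\<lambda>A. (set_coeff q n a A)\<^sup>2) ?v \<le> real (q ^ q) * grid_norm q n t a"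
      unfolding grid_norm_def by (rule multilinear_set_coeff_square_le[OF v])
    show "0 \<le> hyper_const k ^ q * multilinear n (\<lambda>A. (set_coeff q n a A)\<^sup>2) ?v"
      unfolding multilinear_def using v K
      by (intro mult_nonneg_nonneg sum_nonneg prod_nonneg) auto
  qed (use K in auto)
  finally show ?thesis by (simp add: power_mult_distrib ac_simps)
qed

end

section \<open>Multiple Wiener integrals as limits of step integrals\<close>

text \<open>The squared norm, without the root, so triangle inequalities cost a factor 2. Values in
  \<open>ennreal\<close> make it meaningful without integrability assumptions.\<close>

definition l2 :: "'b measure \<Rightarrow> ('b \<Rightarrow> real) \<Rightarrow> ennreal" where
  "l2 M f = (\<integral>\<^sup>+x. ennreal ((f x)\<^sup>2) \<partial>M)"

abbreviation leb :: "nat \<Rightarrow> (nat \<Rightarrow> real) measure" where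
  "leb q \<equiv> Pi\<^sub>M {..<q} (\<lambda>_. lborel)"

lemma square_add_le: "(x + y)\<^sup>2 \<le> 2 * x\<^sup>2 + 2 * y\<^sup>2" for x y :: real
  using sum_squares_bound[of x y] by (simp add: power2_sum)

lemma l2_add_le:
  assumes [measurable]: "f \<in> borel_measurable M" "g \<in> borel_measurable M"
  shows "l2 M (\<lambda>x. f x + g x) \<le> 2 * l2 M f + 2 * l2 M g"
proof -
  have "l2 M (\<lambda>x. f x + g x) \<le> (\<integral>\<^sup>+x. 2 * ennreal ((f x)\<^sup>2) + 2 * ennreal ((g x)\<^sup>2) \<partial>M)"
    unfolding l2_def
  proof (rule nn_integral_mono)
    fix x
    have "ennreal ((f x + g x)\<^sup>2) \<le> ennreal (2 * (f x)\<^sup>2 + 2 * (g x)\<^sup>2)"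
      by (intro ennreal_leI square_add_le)
    then show "ennreal ((f x + g x)\<^sup>2) \<le> 2 * ennreal ((f x)\<^sup>2) + 2 * ennreal ((g x)\<^sup>2)"
      by (simp add: ennreal_mult)
  qed
  also have "\<dots> = 2 * l2 M f + 2 * l2 M g"
    unfolding l2_def by (simp add: nn_integral_add nn_integral_cmult)
  finally show ?thesis .
qed

lemma l2_triangle:
  assumes "f \<in> borel_measurable M" "g \<in> borel_measurable M" "h \<in> borel_measurable M"
  shows "l2 M (\<lambda>x. f x - h x) \<le> 2 * l2 M (\<lambda>x. f x - g x) + 2 * l2 M (\<lambda>x. g x - h x)"
  using l2_add_le[of "\<lambda>x. f x - g x" M "\<lambda>x. g x - h x"] assms by simp

lemma l2_diff_commute: "l2 M (\<lambda>x. f x - g x) = l2 M (\<lambda>x. g x - f x)"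
  by (simp add: l2_def power2_commute)

lemma l2_cong_AE: "AE x in M. f x = g x \<Longrightarrow> l2 M f = l2 M g"
  unfolding l2_def by (rule nn_integral_cong_AE) (auto elim: eventually_mono)

lemma l2_cmult:
  assumes [measurable]: "f \<in> borel_measurable M"
  shows "l2 M (\<lambda>x. c * f x) = ennreal (c\<^sup>2) * l2 M f"
  unfolding l2_def by (simp add: power_mult_distrib ennreal_mult nn_integral_cmult)

lemma (in prob_space) l2_all_moments:
  "all_moments M X \<Longrightarrow> l2 M X = ennreal (expectation (\<lambda>\<omega>. (X \<omega>)\<^sup>2))"
  unfolding l2_def by (rule nn_integral_eq_integral) (auto intro: all_moments_integrable_power)

lemma l2_step_function:
  "strict_mono_on {..n} t \<Longrightarrow> l2 (leb q) (step_function q n t a) = ennreal (grid_norm q n t a)"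
  unfolding l2_def by (rule nn_integral_step_function_square)

lemma ennreal_pos_below:
  fixes \<epsilon> :: ennreal
  assumes "0 < \<epsilon>" shows "\<exists>e>0. ennreal e < \<epsilon>"
proof -
  from dense[OF assms] obtain y where y: "0 < y" "y < \<epsilon>" by blast
  then obtain r where r: "0 \<le> r" "y = ennreal r" by (cases y) auto
  with y show ?thesis by (intro exI[of _ r]) auto
qed

section \<open>Powers of nearby random variables\<close>

lemma abs_power_diff_le:
  fixes x s :: real
  shows "\<bar>x ^ p - s ^ p\<bar> \<le> real p * (\<bar>x - s\<bar> * (\<bar>x\<bar> + \<bar>s\<bar>) ^ (p - 1))"
proof (induction p)
  case (Suc p)
  let ?m = "\<bar>x\<bar> + \<bar>s\<bar>"
  have "x ^ Suc p - s ^ Suc p = x * (x ^ p - s ^ p) + (x - s) * s ^ p" by (simp add: algebra_simps)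
  also have "\<bar>\<dots>\<bar> \<le> \<bar>x\<bar> * \<bar>x ^ p - s ^ p\<bar> + \<bar>x - s\<bar> * \<bar>s\<bar> ^ p"
    by (rule order_trans[OF abs_triangle_ineq]) (simp add: abs_mult power_abs)
  also have "\<dots> \<le> ?m * (real p * (\<bar>x - s\<bar> * ?m ^ (p - 1))) + \<bar>x - s\<bar> * ?m ^ p"
    by (intro add_mono mult_mono Suc power_mono) auto
  also have "\<dots> = real (Suc p) * (\<bar>x - s\<bar> * ?m ^ (Suc p - 1))"
    by (cases p) (auto simp: algebra_simps)
  finally show ?case .
qed simp

text \<open>The pointwise bound on x^p - s^p followed by Cauchy-Schwarz: closeness in L2 becomes
  closeness of the p-th powers in L1 once moments of order 2 (p - 1) are bounded.\<close>

lemma (in prob_space) expectation_power_diff_le: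
  assumes X: "all_moments M X" and S: "all_moments M S" and p: "1 \<le> p"
    and A: "expectation (\<lambda>\<omega>. X \<omega> ^ (2 * (p - 1))) \<le> A" "expectation (\<lambda>\<omega>. S \<omega> ^ (2 * (p - 1))) \<le> A"
  shows "expectation (\<lambda>\<omega>. \<bar>X \<omega> ^ p - S \<omega> ^ p\<bar>)
    \<le> real p * (2 ^ p * sqrt A) * sqrt (expectation (\<lambda>\<omega>. (X \<omega> - S \<omega>)\<^sup>2))"
proof -
  let ?T = "\<lambda>\<omega>. (\<bar>X \<omega>\<bar> + \<bar>S \<omega>\<bar>) ^ (p - 1)"
  have amT: "all_moments M ?T" and amD: "all_moments M (\<lambda>\<omega>. \<bar>X \<omega> - S \<omega>\<bar>)"
    using X S by (auto intro!: all_moments_intros)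
  have "expectation (\<lambda>\<omega>. \<bar>X \<omega> ^ p - S \<omega> ^ p\<bar>) \<le> expectation (\<lambda>\<omega>. real p * (\<bar>X \<omega> - S \<omega>\<bar> * ?T \<omega>))"
    by (intro integral_mono abs_power_diff_le all_moments_integrable all_moments_intros X S)
  also have "\<dots> = real p * expectation (\<lambda>\<omega>. \<bar>X \<omega> - S \<omega>\<bar> * ?T \<omega>)" by simp
  also have "\<dots> \<le> real p * (sqrt (expectation (\<lambda>\<omega>. (\<bar>X \<omega> - S \<omega>\<bar>)\<^sup>2)) * sqrt (expectation (\<lambda>\<omega>. (?T \<omega>)\<^sup>2)))"
    using expectation_mult_le_sqrt[OF amD amT] by (intro mult_left_mono) auto
  also have "\<dots> \<le> real p * (sqrt (expectation (\<lambda>\<omega>. (\<bar>X \<omega> - S \<omega>\<bar>)\<^sup>2)) * (2 ^ p * sqrt A))"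
  proof (intro mult_left_mono)
    have "expectation (\<lambda>\<omega>. (?T \<omega>)\<^sup>2)
      \<le> expectation (\<lambda>\<omega>. 2 ^ (2 * (p - 1)) * (X \<omega> ^ (2 * (p - 1)) + S \<omega> ^ (2 * (p - 1))))"
    proof (rule integral_mono)
      show "(?T \<omega>)\<^sup>2 \<le> 2 ^ (2 * (p - 1)) * (X \<omega> ^ (2 * (p - 1)) + S \<omega> ^ (2 * (p - 1)))" for \<omega>
        using abs_add_power_le[of "\<bar>X \<omega>\<bar>" "\<bar>S \<omega>\<bar>" "2 * (p - 1)"]
        by (simp add: power_mult[symmetric] power_even_abs mult.commute[of _ 2])
    qed (use amT X S in \<open>auto intro!: all_moments_integrable all_moments_intros\<close>)
    also have "\<dots> = 2 ^ (2 * (p - 1)) * (expectation (\<lambda>\<omega>. X \<omega> ^ (2 * (p - 1))) + expectation (\<lambda>\<omega>. S \<omega> ^ (2 * (p - 1))))"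
      using X S by (simp add: all_moments_integrable_power)
    \<comment> \<open>The sum is at most 2 * A; allowing 4 * A makes the bound equal to (2 ^ p)^2 *
      A, whose root is explicit.\<close>
    also have "\<dots> \<le> 2 ^ (2 * (p - 1)) * (4 * A)"
    proof -
      have "0 \<le> expectation (\<lambda>\<omega>. X \<omega> ^ (2 * (p - 1)))" by (simp add: power_mult)
      then have "0 \<le> A" using A(1) by (rule order_trans)
      then have "expectation (\<lambda>\<omega>. X \<omega> ^ (2 * (p - 1))) + expectation (\<lambda>\<omega>. S \<omega> ^ (2 * (p - 1))) \<le> 4 * A"
        using A by linarith
      then show ?thesis by (rule mult_left_mono) simp
    qed
    also have "\<dots> = (2 ^ p)\<^sup>2 * A"
      using p by (cases p) (auto simp: power_mult[symmetric] mult.commute)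
    finally have "sqrt (expectation (\<lambda>\<omega>. (?T \<omega>)\<^sup>2)) \<le> sqrt ((2 ^ p)\<^sup>2 * A)" by (rule real_sqrt_le_mono)
    then show "sqrt (expectation (\<lambda>\<omega>. (?T \<omega>)\<^sup>2)) \<le> 2 ^ p * sqrt A" by (simp add: real_sqrt_mult)
  qed auto
  finally show ?thesis by (simp add: ac_simps)
qed

definition chaos_const :: "nat \<Rightarrow> nat \<Rightarrow> real" where
  "chaos_const q k = (hyper_const k * real q) ^ q"

lemma chaos_const_nonneg: "0 \<le> chaos_const q k"
  unfolding chaos_const_def using hyper_const_ge_1[of k] by simp

context brownian
begin

text \<open>
  Unlike \<open>is_multiple_wiener_integral\<close>, the following variant makes it immediate that integrals of
  different functions can be approximated on a common grid.
\<close>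

definition wiener_approx :: "nat \<Rightarrow> ((nat \<Rightarrow> real) \<Rightarrow> real) \<Rightarrow> ('a \<Rightarrow> real) \<Rightarrow> bool" where
  "wiener_approx q f X \<longleftrightarrow> f \<in> borel_measurable (leb q) \<and> X \<in> borel_measurable M \<and>
     (\<forall>\<epsilon>>0. \<exists>n t a. strict_mono_on {..n} t \<and> l2 (leb q) (\<lambda>y. f y - step_function q n t a y) < \<epsilon>
        \<and> l2 M (\<lambda>\<omega>. X \<omega> - step_integral B q n t a \<omega>) < \<epsilon>)"

lemma wiener_approx_measurable:
  assumes "wiener_approx q f X"
  shows "f \<in> borel_measurable (leb q)" "X \<in> borel_measurable M"
  using assms by (auto simp: wiener_approx_def)

lemma wiener_approxE:
  assumes "wiener_approx q f X" "0 < \<epsilon>"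
  obtains n t a where "strict_mono_on {..n} t" "l2 (leb q) (\<lambda>y. f y - step_function q n t a y) < \<epsilon>"
    "l2 M (\<lambda>\<omega>. X \<omega> - step_integral B q n t a \<omega>) < \<epsilon>"
  using assms unfolding wiener_approx_def by blast

lemma wiener_approx_if_multiple_wiener_integral:
  assumes "is_multiple_wiener_integral M B q f X"
  shows "wiener_approx q f X"
  unfolding wiener_approx_def
proof (intro conjI allI impI)
  fix \<epsilon> :: ennreal assume \<epsilon>: "0 < \<epsilon>"
  from assms have "\<exists>n t a. (\<forall>j. strict_mono_on {..n j} (t j))
      \<and> (\<lambda>j. l2 (leb q) (\<lambda>y. f y - step_function q (n j) (t j) (a j) y)) \<longlonglongrightarrow> 0
      \<and> (\<lambda>j. l2 M (\<lambda>\<omega>. X \<omega> - step_integral B q (n j) (t j) (a j) \<omega>)) \<longlonglongrightarrow> 0"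
    by (simp add: is_multiple_wiener_integral_def l2_def)
  then obtain n t a where
    t: "\<forall>j. strict_mono_on {..n j} (t j)" and
    f: "(\<lambda>j. l2 (leb q) (\<lambda>y. f y - step_function q (n j) (t j) (a j) y)) \<longlonglongrightarrow> 0" and
    X: "(\<lambda>j. l2 M (\<lambda>\<omega>. X \<omega> - step_integral B q (n j) (t j) (a j) \<omega>)) \<longlonglongrightarrow> 0"
    by blast
  have "\<forall>\<^sub>F j in sequentially. l2 (leb q) (\<lambda>y. f y - step_function q (n j) (t j) (a j) y) < \<epsilon>
      \<and> l2 M (\<lambda>\<omega>. X \<omega> - step_integral B q (n j) (t j) (a j) \<omega>) < \<epsilon>"
    using order_tendstoD(2)[OF f \<epsilon>] order_tendstoD(2)[OF X \<epsilon>] by (rule eventually_conj)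
  then obtain j where "l2 (leb q) (\<lambda>y. f y - step_function q (n j) (t j) (a j) y) < \<epsilon>"
      "l2 M (\<lambda>\<omega>. X \<omega> - step_integral B q (n j) (t j) (a j) \<omega>) < \<epsilon>"
    by (auto dest: eventually_happens'[OF sequentially_bot])
  then show "\<exists>n t a. strict_mono_on {..n} t \<and> l2 (leb q) (\<lambda>y. f y - step_function q n t a y) < \<epsilon>
        \<and> l2 M (\<lambda>\<omega>. X \<omega> - step_integral B q n t a \<omega>) < \<epsilon>" using t by blast
qed (use assms in \<open>auto simp: is_multiple_wiener_integral_def\<close>)

lemma step_integral_measurable[measurable]: "step_integral B q n t a \<in> borel_measurable M"
proof -
  have [measurable]: "B s \<in> borel_measurable M" for s using bm by (simp add: two_sided_brownian_motion_def)
  show ?thesis unfolding step_integral_def [abs_def] by measurable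
qed

lemma wiener_approx_diff:
  assumes X: "wiener_approx q f X" and Y: "wiener_approx q g Y"
  shows "wiener_approx q (\<lambda>y. f y - g y) (\<lambda>\<omega>. X \<omega> - Y \<omega>)"
  unfolding wiener_approx_def
proof (intro conjI allI impI)
  note [measurable] = wiener_approx_measurable[OF X] wiener_approx_measurable[OF Y]
  show "(\<lambda>y. f y - g y) \<in> borel_measurable (leb q)" "(\<lambda>\<omega>. X \<omega> - Y \<omega>) \<in> borel_measurable M" by measurable
  fix \<epsilon> :: ennreal assume \<epsilon>: "0 < \<epsilon>"
  then obtain e where e: "0 < e" "ennreal e < \<epsilon>" using ennreal_pos_below by blast
  \<comment> \<open>With errors e / 4 on both sides, the factors 2 of \<open>l2_add_le\<close> leave
    a total of e.\<close>
  have e4: "0 < ennreal (e / 4)" using e by simp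
  from wiener_approxE[OF X e4] obtain n t a where 1: "strict_mono_on {..n} t"
    "l2 (leb q) (\<lambda>y. f y - step_function q n t a y) < ennreal (e / 4)"
    "l2 M (\<lambda>\<omega>. X \<omega> - step_integral B q n t a \<omega>) < ennreal (e / 4)" .
  from wiener_approxE[OF Y e4] obtain m s b where 2: "strict_mono_on {..m} s"
    "l2 (leb q) (\<lambda>y. g y - step_function q m s b y) < ennreal (e / 4)"
    "l2 M (\<lambda>\<omega>. Y \<omega> - step_integral B q m s b \<omega>) < ennreal (e / 4)" .
  from step_diff[OF 1(1) 2(1), where 'a='a and q=q and a=a and b=b] obtain l u c
    where c: "strict_mono_on {..l} u"
    "\<And>y. step_function q l u c y = step_function q n t a y - step_function q m s b y"
    "\<And>\<omega>. step_integral B q l u c \<omega> = step_integral B q n t a \<omega> - step_integral B q m s b \<omega>" by metis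
  have sum: "2 * x + 2 * y < \<epsilon>" if "x < ennreal (e / 4)" "y < ennreal (e / 4)" for x y
  proof -
    have "2 * x + 2 * y \<le> 2 * ennreal (e / 4) + 2 * ennreal (e / 4)"
      using that by (intro add_mono mult_left_mono) auto
    also have "\<dots> = ennreal (2 * (e / 4) + 2 * (e / 4))"
    proof -
      have "2 * ennreal (e / 4) = ennreal (2 * (e / 4))" using e by (simp only: ennreal_mult ennreal_numeral)
      then show ?thesis using e by (simp only: ennreal_plus)
    qed
    finally show ?thesis using e by simp
  qed
  have "l2 (leb q) (\<lambda>y. (f y - step_function q n t a y) + (step_function q m s b y - g y))
    \<le> 2 * l2 (leb q) (\<lambda>y. f y - step_function q n t a y) + 2 * l2 (leb q) (\<lambda>y. step_function q m s b y - g y)"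
    by (rule l2_add_le) auto
  also have "\<dots> < \<epsilon>" using 1 2 by (intro sum) (auto simp: l2_diff_commute[of _ "step_function q m s b"])
  also have "(\<lambda>y. (f y - step_function q n t a y) + (step_function q m s b y - g y))
    = (\<lambda>y. f y - g y - step_function q l u c y)" by (auto simp: c)
  finally have A: "l2 (leb q) (\<lambda>y. f y - g y - step_function q l u c y) < \<epsilon>" .
  have "l2 M (\<lambda>\<omega>. (X \<omega> - step_integral B q n t a \<omega>) + (step_integral B q m s b \<omega> - Y \<omega>))
    \<le> 2 * l2 M (\<lambda>\<omega>. X \<omega> - step_integral B q n t a \<omega>) + 2 * l2 M (\<lambda>\<omega>. step_integral B q m s b \<omega> - Y \<omega>)"
    by (rule l2_add_le) auto
  also have "\<dots> < \<epsilon>" using 1 2 by (intro sum) (auto simp: l2_diff_commute[of _ "step_integral B q m s b"])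
  also have "(\<lambda>\<omega>. (X \<omega> - step_integral B q n t a \<omega>) + (step_integral B q m s b \<omega> - Y \<omega>))
    = (\<lambda>\<omega>. X \<omega> - Y \<omega> - step_integral B q l u c \<omega>)" by (auto simp: c)
  finally have "l2 M (\<lambda>\<omega>. X \<omega> - Y \<omega> - step_integral B q l u c \<omega>) < \<epsilon>" .
  with A c(1) show "\<exists>n t a. strict_mono_on {..n} t \<and> l2 (leb q) (\<lambda>y. f y - g y - step_function q n t a y) < \<epsilon>
     \<and> l2 M (\<lambda>\<omega>. X \<omega> - Y \<omega> - step_integral B q n t a \<omega>) < \<epsilon>" by blast
qed

lemma step_function_cmult: "step_function q n t (\<lambda>k. c * a k) y = c * step_function q n t a y"
  by (simp add: step_function_def sum_distrib_left mult.assoc)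

lemma step_integral_cmult: "step_integral B q n t (\<lambda>k. c * a k) \<omega> = c * step_integral B q n t a \<omega>"
  by (simp add: step_integral_def sum_distrib_left mult.assoc)

lemma wiener_approx_cmult:
  assumes X: "wiener_approx q f X" and c: "0 < c"
  shows "wiener_approx q (\<lambda>y. c * f y) (\<lambda>\<omega>. c * X \<omega>)"
  unfolding wiener_approx_def
proof (intro conjI allI impI)
  note [measurable] = wiener_approx_measurable[OF X]
  show "(\<lambda>y. c * f y) \<in> borel_measurable (leb q)" "(\<lambda>\<omega>. c * X \<omega>) \<in> borel_measurable M" by measurable
  fix \<epsilon> :: ennreal assume \<epsilon>: "0 < \<epsilon>"
  then obtain e where e: "0 < e" "ennreal e < \<epsilon>" using ennreal_pos_below by blast
  have "0 < ennreal (e / c\<^sup>2)" using e c by simp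
  from wiener_approxE[OF X this] obtain n t a where 1: "strict_mono_on {..n} t"
    "l2 (leb q) (\<lambda>y. f y - step_function q n t a y) < ennreal (e / c\<^sup>2)"
    "l2 M (\<lambda>\<omega>. X \<omega> - step_integral B q n t a \<omega>) < ennreal (e / c\<^sup>2)" .
  have le: "ennreal (c\<^sup>2) * x < \<epsilon>" if "x < ennreal (e / c\<^sup>2)" for x
  proof -
    have "ennreal (c\<^sup>2) * x \<le> ennreal (c\<^sup>2) * ennreal (e / c\<^sup>2)" using that by (intro mult_left_mono) auto
    also have "\<dots> = ennreal e" using c e by (simp add: ennreal_mult[symmetric])
    finally show ?thesis using e by simp
  qed
  show "\<exists>n t a. strict_mono_on {..n} t \<and> l2 (leb q) (\<lambda>y. c * f y - step_function q n t a y) < \<epsilon>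
     \<and> l2 M (\<lambda>\<omega>. c * X \<omega> - step_integral B q n t a \<omega>) < \<epsilon>"
  proof (intro exI conjI)
    have "l2 (leb q) (\<lambda>y. c * (f y - step_function q n t a y)) < \<epsilon>"
      by (subst l2_cmult) (auto intro: le 1)
    then show "l2 (leb q) (\<lambda>y. c * f y - step_function q n t (\<lambda>k. c * a k) y) < \<epsilon>"
      by (simp add: step_function_cmult right_diff_distrib)
    have "l2 M (\<lambda>\<omega>. c * (X \<omega> - step_integral B q n t a \<omega>)) < \<epsilon>"
      by (subst l2_cmult) (auto intro: le 1)
    then show "l2 M (\<lambda>\<omega>. c * X \<omega> - step_integral B q n t (\<lambda>k. c * a k) \<omega>) < \<epsilon>"
      by (simp add: step_integral_cmult right_diff_distrib)
  qed (rule 1)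
qed

text \<open>The case k = 1 of the moment bound, standing in for the Ito isometry.\<close>

lemma step_integral_l2_le:
  assumes t: "strict_mono_on {..n} t"
  shows "l2 M (step_integral B q n t a) \<le> ennreal (chaos_const q 1) * l2 (leb q) (step_function q n t a)"
  using step_integral_moment_le[OF t, of q a 1] chaos_const_nonneg[of q 1] grid_norm_nonneg[OF t, of q a]
  by (simp add: l2_all_moments[OF step_integral_all_moments[OF t]] l2_step_function[OF t]
      chaos_const_def ennreal_mult[symmetric] ennreal_leI)

text \<open>X is known only through approximants of its own. One of them is compared with the given
  step integral on a common grid, and their difference is again a step integral. Hence every step
  function near f gives an approximation of X, in particular a truncated one that does not come from
  the construction of X.\<close>

lemma wiener_approx_contraction:
  assumes X: "wiener_approx q f X" and t: "strict_mono_on {..n} t"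
  shows "l2 M (\<lambda>\<omega>. X \<omega> - step_integral B q n t a \<omega>)
    \<le> ennreal (4 * chaos_const q 1) * l2 (leb q) (\<lambda>y. f y - step_function q n t a y)"
proof (rule ennreal_le_epsilon)
  fix e :: real assume e: "0 < e"
  note [measurable] = wiener_approx_measurable[OF X]
  let ?C = "chaos_const q 1"
  \<comment> \<open>Chosen so that the two error terms, 2 * \<delta> and 4 * ?C * \<delta>, add up
    to e.\<close>
  define \<delta> where "\<delta> = e / (2 + 4 * ?C)"
  have C: "0 \<le> ?C" by (rule chaos_const_nonneg)
  have \<delta>: "0 < \<delta>" using e C by (simp add: \<delta>_def add_pos_nonneg)
  have e_eq: "e = 2 * \<delta> + 4 * ?C * \<delta>"
  proof -
    have "2 + 4 * ?C \<noteq> 0" using C by linarith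
    then have "\<delta> * (2 + 4 * ?C) = e" by (simp add: \<delta>_def)
    then show ?thesis by (simp add: algebra_simps)
  qed
  from wiener_approxE[OF X, of "ennreal \<delta>"] \<delta> obtain m s b where 2: "strict_mono_on {..m} s"
    "l2 (leb q) (\<lambda>y. f y - step_function q m s b y) < ennreal \<delta>"
    "l2 M (\<lambda>\<omega>. X \<omega> - step_integral B q m s b \<omega>) < ennreal \<delta>" by auto
  from step_diff[OF 2(1) t, where 'a='a and q=q and a=b and b=a] obtain l u c
    where c: "strict_mono_on {..l} u"
    "\<And>y. step_function q l u c y = step_function q m s b y - step_function q n t a y"
    "\<And>\<omega>. step_integral B q l u c \<omega> = step_integral B q m s b \<omega> - step_integral B q n t a \<omega>" by metis
  let ?D = "l2 (leb q) (\<lambda>y. f y - step_function q n t a y)"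
  have "l2 (leb q) (\<lambda>y. step_function q m s b y - step_function q n t a y)
      \<le> 2 * l2 (leb q) (\<lambda>y. step_function q m s b y - f y) + 2 * ?D"
    by (rule l2_triangle) auto
  also have "\<dots> \<le> 2 * ennreal \<delta> + 2 * ?D"
    using 2 by (intro add_mono mult_left_mono) (auto simp: l2_diff_commute[of _ "step_function q m s b"])
  finally have 3: "l2 (leb q) (\<lambda>y. step_function q m s b y - step_function q n t a y) \<le> 2 * ennreal \<delta> + 2 * ?D" .
  have "l2 M (\<lambda>\<omega>. X \<omega> - step_integral B q n t a \<omega>)
      \<le> 2 * l2 M (\<lambda>\<omega>. X \<omega> - step_integral B q m s b \<omega>)
       + 2 * l2 M (\<lambda>\<omega>. step_integral B q m s b \<omega> - step_integral B q n t a \<omega>)"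
    by (rule l2_triangle) auto
  also have "\<dots> = 2 * l2 M (\<lambda>\<omega>. X \<omega> - step_integral B q m s b \<omega>) + 2 * l2 M (step_integral B q l u c)"
    by (simp add: c(3)[symmetric])
  also have "\<dots> \<le> 2 * ennreal \<delta> + 2 * (ennreal ?C * l2 (leb q) (step_function q l u c))"
    using 2 by (intro add_mono mult_left_mono step_integral_l2_le c) auto
  also have "\<dots> \<le> 2 * ennreal \<delta> + 2 * (ennreal ?C * (2 * ennreal \<delta> + 2 * ?D))"
    using 3 by (intro add_mono mult_left_mono) (auto simp: c(2)[symmetric])
  also have "\<dots> = (2 * ennreal \<delta> + 4 * ennreal ?C * ennreal \<delta>) + 4 * ennreal ?C * ?D"
  proof -
    have four: "(4::ennreal) = 2 * 2" by simp
    show ?thesis unfolding four by (simp only: distrib_left ac_simps)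
  qed
  also have "4 * ennreal ?C = ennreal (4 * ?C)" using C by (simp add: ennreal_mult)
  also have "2 * ennreal \<delta> + ennreal (4 * ?C) * ennreal \<delta> = ennreal e"
    unfolding e_eq using C \<delta> by (simp add: ennreal_mult)
  finally show "l2 M (\<lambda>\<omega>. X \<omega> - step_integral B q n t a \<omega>) \<le> ennreal (4 * ?C) * ?D + ennreal e"
    by (simp add: add.commute)
qed

lemma wiener_approx_l2_finite:
  assumes X: "wiener_approx q f X" shows "l2 (leb q) f < \<infinity>"
proof -
  note [measurable] = wiener_approx_measurable[OF X]
  from wiener_approxE[OF X zero_less_one] obtain n t a where 1: "strict_mono_on {..n} t"
    "l2 (leb q) (\<lambda>y. f y - step_function q n t a y) < 1" .
  have "l2 (leb q) f = l2 (leb q) (\<lambda>y. (f y - step_function q n t a y) + step_function q n t a y)" by simp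
  also have "\<dots> \<le> 2 * l2 (leb q) (\<lambda>y. f y - step_function q n t a y) + 2 * l2 (leb q) (step_function q n t a)"
    by (rule l2_add_le) auto
  also have "\<dots> < \<infinity>"
    using 1 by (auto simp: l2_step_function ennreal_mult_less_top less_top[symmetric] ennreal_add_eq_top ennreal_mult_eq_top_iff)
  finally show ?thesis .
qed

lemma step_integral_moment_le_l2:
  assumes t: "strict_mono_on {..n} t" and le: "l2 (leb q) (step_function q n t a) \<le> ennreal A" and A: "0 \<le> A"
  shows "expectation (\<lambda>\<omega>. step_integral B q n t a \<omega> ^ (2 * k)) \<le> (chaos_const q k * A) ^ k"
proof -
  have "grid_norm q n t a \<le> A" using le A by (simp add: l2_step_function[OF t])
  then have "(chaos_const q k * grid_norm q n t a) ^ k \<le> (chaos_const q k * A) ^ k"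
    using chaos_const_nonneg[of q k] grid_norm_nonneg[OF t, of q a] by (intro power_mono mult_left_mono) auto
  then show ?thesis using step_integral_moment_le[OF t, of q a k] unfolding chaos_const_def by linarith
qed

text \<open>Along a subsequence the step integrals converge almost surely, and Fatou's lemma passes
  their moment bounds to X. The number 2 * A + 2 bounds the squared norm of a step function at
  squared distance at most 1 from f.\<close>

lemma wiener_approx_moment_le:
  assumes X: "wiener_approx q f X" and A: "l2 (leb q) f \<le> ennreal A" "0 \<le> A"
  shows "all_moments M X" "expectation (\<lambda>\<omega>. X \<omega> ^ (2 * k)) \<le> (chaos_const q k * (2 * A + 2)) ^ k"
proof -
  note [measurable] = wiener_approx_measurable[OF X]
  \<comment> \<open>Grid size, grid and coefficients are packed into one tuple, so that a single
    choice gives the whole approximating sequence.\<close>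
  define P where "P j = (\<lambda>(n, t, a). strict_mono_on {..n} t
      \<and> l2 (leb q) (\<lambda>y. f y - step_function q n t a y) < ennreal (1 / Suc j)
      \<and> l2 M (\<lambda>\<omega>. X \<omega> - step_integral B q n t a \<omega>) < ennreal (1 / Suc j))" for j
  have "\<exists>x. P j x" for j
  proof -
    have "0 < ennreal (1 / Suc j)" by simp
    from wiener_approxE[OF X this] obtain n t a where "strict_mono_on {..n} t"
      "l2 (leb q) (\<lambda>y. f y - step_function q n t a y) < ennreal (1 / Suc j)"
      "l2 M (\<lambda>\<omega>. X \<omega> - step_integral B q n t a \<omega>) < ennreal (1 / Suc j)" .
    then have "P j (n, t, a)" by (simp add: P_def)
    then show ?thesis ..
  qed
  then obtain x where x: "\<And>j. P j (x j)" by metis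
  define n where "n j = fst (x j)" for j
  define t where "t j = fst (snd (x j))" for j
  define a where "a j = snd (snd (x j))" for j
  have t: "\<And>j. strict_mono_on {..n j} (t j)"
    and fa: "\<And>j. l2 (leb q) (\<lambda>y. f y - step_function q (n j) (t j) (a j) y) < ennreal (1 / Suc j)"
    and Xa: "\<And>j. l2 M (\<lambda>\<omega>. X \<omega> - step_integral B q (n j) (t j) (a j) \<omega>) < ennreal (1 / Suc j)"
    using x unfolding P_def n_def t_def a_def by (simp_all only: case_prod_unfold)
  define S where "S j = step_integral B q (n j) (t j) (a j)" for j
  have [measurable]: "S j \<in> borel_measurable M" for j unfolding S_def by measurable
  have step: "l2 (leb q) (step_function q (n j) (t j) (a j)) \<le> ennreal (2 * A + 2)" for j
  proof -
    have "l2 (leb q) (step_function q (n j) (t j) (a j))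
      = l2 (leb q) (\<lambda>y. (step_function q (n j) (t j) (a j) y - f y) + f y)" by simp
    also have "\<dots> \<le> 2 * l2 (leb q) (\<lambda>y. step_function q (n j) (t j) (a j) y - f y) + 2 * l2 (leb q) f"
      by (rule l2_add_le) auto
    also have "\<dots> \<le> 2 * ennreal 1 + 2 * ennreal A"
    proof (intro add_mono mult_left_mono A)
      have "ennreal (1 / Suc j) \<le> ennreal 1" by (intro ennreal_leI) simp
      then show "l2 (leb q) (\<lambda>y. step_function q (n j) (t j) (a j) y - f y) \<le> ennreal 1"
        using less_imp_le[OF fa[of j]]
        by (subst l2_diff_commute) (rule order_trans)
    qed auto
    also have "\<dots> = ennreal (2 * A + 2)" using A by (simp add: ennreal_mult add.commute)
    finally show ?thesis .
  qed
  let ?b = "\<lambda>k. (chaos_const q k * (2 * A + 2)) ^ k"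
  have amS: "all_moments M (S j)" for j unfolding S_def by (rule step_integral_all_moments[OF t])
  have S: "(\<integral>\<^sup>+\<omega>. ennreal (S j \<omega> ^ (2 * k)) \<partial>M) \<le> ennreal (?b k)" for j k
  proof -
    have "(\<integral>\<^sup>+\<omega>. ennreal (S j \<omega> ^ (2 * k)) \<partial>M) = ennreal (expectation (\<lambda>\<omega>. S j \<omega> ^ (2 * k)))"
      by (rule nn_integral_eq_integral[OF all_moments_integrable_power[OF amS]]) (auto simp: power_mult)
    also have "\<dots> \<le> ennreal (?b k)"
      unfolding S_def by (intro ennreal_leI step_integral_moment_le_l2[OF t step]) (use A in auto)
    finally show ?thesis .
  qed
  have i2: "integrable M (\<lambda>\<omega>. (S j \<omega> - X \<omega>)\<^sup>2)" for j
    by (rule integrableI_nonneg) (use Xa[of j] in \<open>auto simp: l2_def S_def power2_commute intro: less_trans\<close>)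
  have conv: "(\<lambda>j. \<integral>\<omega>. norm ((S j \<omega> - X \<omega>)\<^sup>2) \<partial>M) \<longlonglongrightarrow> 0"
  proof (rule tendsto_sandwich[OF _ _ tendsto_const LIMSEQ_Suc[OF lim_1_over_n]])
    show "\<forall>\<^sub>F j in sequentially. (\<integral>\<omega>. norm ((S j \<omega> - X \<omega>)\<^sup>2) \<partial>M) \<le> 1 / real (Suc j)"
    proof (rule always_eventually, rule allI)
      fix j
      have "ennreal (\<integral>\<omega>. norm ((S j \<omega> - X \<omega>)\<^sup>2) \<partial>M) = (\<integral>\<^sup>+\<omega>. ennreal ((S j \<omega> - X \<omega>)\<^sup>2) \<partial>M)"
        using i2[of j] by (simp add: nn_integral_eq_integral)
      also have "\<dots> < ennreal (1 / Suc j)"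
        using Xa[of j] by (simp add: l2_def S_def power2_commute)
      finally have "ennreal (\<integral>\<omega>. norm ((S j \<omega> - X \<omega>)\<^sup>2) \<partial>M) \<le> ennreal (1 / Suc j)" by (rule less_imp_le)
      then show "(\<integral>\<omega>. norm ((S j \<omega> - X \<omega>)\<^sup>2) \<partial>M) \<le> 1 / real (Suc j)"
        by (subst (asm) ennreal_le_iff) auto
    qed
  qed auto
  obtain r where r: "strict_mono r" "AE \<omega> in M. (\<lambda>j. (S (r j) \<omega> - X \<omega>)\<^sup>2) \<longlonglongrightarrow> 0"
    using tendsto_L1_AE_subseq[OF i2 conv] by auto
  have AE: "AE \<omega> in M. (\<lambda>j. S (r j) \<omega>) \<longlonglongrightarrow> X \<omega>"
    using r(2)
  proof eventually_elim
    case (elim \<omega>)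
    from tendsto_real_sqrt[OF elim] have "(\<lambda>j. \<bar>S (r j) \<omega> - X \<omega>\<bar>) \<longlonglongrightarrow> 0" by simp
    then show ?case by (simp add: tendsto_rabs_zero_iff LIM_zero_iff)
  qed
  have fatou: "(\<integral>\<^sup>+\<omega>. ennreal (X \<omega> ^ (2 * k)) \<partial>M) \<le> ennreal (?b k)" for k
  proof -
    have "(\<integral>\<^sup>+\<omega>. ennreal (X \<omega> ^ (2 * k)) \<partial>M) = (\<integral>\<^sup>+\<omega>. liminf (\<lambda>j. ennreal (S (r j) \<omega> ^ (2 * k))) \<partial>M)"
    proof (rule nn_integral_cong_AE)
      show "AE \<omega> in M. ennreal (X \<omega> ^ (2 * k)) = liminf (\<lambda>j. ennreal (S (r j) \<omega> ^ (2 * k)))"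
        using AE
      proof eventually_elim
        case (elim \<omega>)
        have "(\<lambda>j. ennreal (S (r j) \<omega> ^ (2 * k))) \<longlonglongrightarrow> ennreal (X \<omega> ^ (2 * k))"
          by (intro tendsto_ennrealI tendsto_power elim)
        then show ?case by (intro lim_imp_Liminf[symmetric]) auto
      qed
    qed
    also have "\<dots> \<le> liminf (\<lambda>j. \<integral>\<^sup>+\<omega>. ennreal (S (r j) \<omega> ^ (2 * k)) \<partial>M)"
      by (rule nn_integral_liminf) auto
    also have "\<dots> \<le> liminf (\<lambda>j::nat. ennreal (?b k))" by (intro Liminf_mono always_eventually allI S)
    also have "\<dots> = ennreal (?b k)" by (simp add: Liminf_const)
    finally show ?thesis .
  qed
  have int: "integrable M (\<lambda>\<omega>. X \<omega> ^ (2 * k))" for k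
    by (rule integrableI_nonneg) (use fatou[of k] in \<open>auto simp: power_mult intro: le_less_trans\<close>)
  show "all_moments M X"
    unfolding all_moments_def
  proof (intro conjI allI)
    fix k
    show "integrable M (\<lambda>\<omega>. \<bar>X \<omega>\<bar> ^ k)"
    proof (rule Bochner_Integration.integrable_bound[of M "\<lambda>\<omega>. 1 + X \<omega> ^ (2 * k)"])
      show "AE \<omega> in M. norm (\<bar>X \<omega>\<bar> ^ k) \<le> norm (1 + X \<omega> ^ (2 * k))"
      proof (rule AE_I2)
        fix \<omega>
        have "\<bar>X \<omega>\<bar> ^ k \<le> 1 + (\<bar>X \<omega>\<bar> ^ k)\<^sup>2"
        proof -
          have "0 \<le> \<bar>X \<omega>\<bar> ^ k" by simp
          then show ?thesis using sum_squares_bound[of 1 "\<bar>X \<omega>\<bar> ^ k"] unfolding power_one mult_1_right by linarith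
        qed
        also have "(\<bar>X \<omega>\<bar> ^ k)\<^sup>2 = X \<omega> ^ (2 * k)"
          by (metis power_even_abs even_mult_iff even_numeral mult.commute power_mult)
        finally show "norm (\<bar>X \<omega>\<bar> ^ k) \<le> norm (1 + X \<omega> ^ (2 * k))" by (simp add: power_mult)
      qed
    qed (use int in auto)
  qed simp
  have "ennreal (expectation (\<lambda>\<omega>. X \<omega> ^ (2 * k))) \<le> ennreal (?b k)"
    using fatou[of k] int[of k] by (subst nn_integral_eq_integral[symmetric]) (auto simp: power_mult)
  then show "expectation (\<lambda>\<omega>. X \<omega> ^ (2 * k)) \<le> ?b k"
    using chaos_const_nonneg[of q k] A by (subst (asm) ennreal_le_iff) auto
qed

end

section \<open>Affine substitution in product Lebesgue measure\<close>

lemma nn_integral_PiM_affine: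
  fixes h :: "('i \<Rightarrow> real) \<Rightarrow> ennreal"
  assumes I: "finite I" and c: "0 < c" and h: "h \<in> borel_measurable (Pi\<^sub>M I (\<lambda>_. lborel))"
  shows "(\<integral>\<^sup>+x. h x \<partial>Pi\<^sub>M I (\<lambda>_. lborel))
    = ennreal (c ^ card I) * (\<integral>\<^sup>+x. h (\<lambda>j\<in>I. b + c * x j) \<partial>Pi\<^sub>M I (\<lambda>_. lborel))"
  using I h
proof (induction I arbitrary: h)
  case empty
  interpret product_sigma_finite "\<lambda>_::'i. lborel :: real measure" by standard
  show ?case by (simp add: PiM_empty nn_integral_count_space_finite restrict_def)
next
  case (insert i I)
  interpret product_sigma_finite "\<lambda>_::'i. lborel :: real measure" by standard
  note [measurable] = insert.prems
  have upd[measurable]: "(\<lambda>(x, y). x(i := y)) \<in> measurable (Pi\<^sub>M I (\<lambda>_. lborel) \<Otimes>\<^sub>M lborel) (Pi\<^sub>M (insert i I) (\<lambda>_. lborel :: real measure))"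
    by (rule measurable_add_dim)
  have hm: "(\<lambda>(x, y). h (x(i := y))) \<in> borel_measurable (Pi\<^sub>M I (\<lambda>_. lborel) \<Otimes>\<^sub>M lborel)"
    using measurable_compose[OF upd insert.prems] by (simp add: case_prod_unfold)
  have sc[measurable]: "(\<lambda>x. \<lambda>j\<in>J. b + c * x j) \<in> measurable (Pi\<^sub>M J (\<lambda>_. lborel)) (Pi\<^sub>M J (\<lambda>_. lborel :: real measure))" for J :: "'i set"
    by (rule measurable_restrict) simp
  have outer: "(\<lambda>x. \<integral>\<^sup>+y. h (x(i := y)) \<partial>lborel) \<in> borel_measurable (Pi\<^sub>M I (\<lambda>_. lborel))"
    using lborel.borel_measurable_nn_integral[OF hm] by simp
  have sect: "(\<lambda>y. h (x(i := y))) \<in> borel_measurable lborel" if "x \<in> space (Pi\<^sub>M I (\<lambda>_. lborel :: real measure))" for x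
    using measurable_compose[OF measurable_Pair1'[OF that] hm] by simp
  have "(\<integral>\<^sup>+x. h x \<partial>Pi\<^sub>M (insert i I) (\<lambda>_. lborel)) = (\<integral>\<^sup>+x. \<integral>\<^sup>+y. h (x(i := y)) \<partial>lborel \<partial>Pi\<^sub>M I (\<lambda>_. lborel))"
    by (rule product_nn_integral_insert[OF insert.hyps insert.prems])
  \<comment> \<open>The induction hypothesis is applied to the integral over the new coordinate,
    viewed as a function of the old ones; the new coordinate is substituted afterwards.\<close>
  also have "\<dots> = ennreal (c ^ card I) * (\<integral>\<^sup>+x. \<integral>\<^sup>+y. h ((\<lambda>j\<in>I. b + c * x j)(i := y)) \<partial>lborel \<partial>Pi\<^sub>M I (\<lambda>_. lborel))"
    by (rule insert.IH[OF outer])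
  also have "(\<integral>\<^sup>+x. \<integral>\<^sup>+y. h ((\<lambda>j\<in>I. b + c * x j)(i := y)) \<partial>lborel \<partial>Pi\<^sub>M I (\<lambda>_. lborel))
     = (\<integral>\<^sup>+x. ennreal c * (\<integral>\<^sup>+y. h (\<lambda>j\<in>insert i I. b + c * (x(i := y)) j) \<partial>lborel) \<partial>Pi\<^sub>M I (\<lambda>_. lborel))"
  proof (rule nn_integral_cong)
    fix x :: "'i \<Rightarrow> real" assume "x \<in> space (Pi\<^sub>M I (\<lambda>_. lborel))"
    then have "(\<lambda>j\<in>I. b + c * x j) \<in> space (Pi\<^sub>M I (\<lambda>_. lborel :: real measure))"
      by (rule measurable_space[OF sc])
    from sect[OF this] have "(\<integral>\<^sup>+y. h ((\<lambda>j\<in>I. b + c * x j)(i := y)) \<partial>lborel)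
      = ennreal c * (\<integral>\<^sup>+y. h ((\<lambda>j\<in>I. b + c * x j)(i := b + c * y)) \<partial>lborel)"
      using c by (subst nn_integral_real_affine[where c=c and t=b]) auto
    moreover have "(\<lambda>j\<in>I. b + c * x j)(i := b + c * y) = (\<lambda>j\<in>insert i I. b + c * (x(i := y)) j)" for y
      using insert.hyps by (auto simp: fun_eq_iff)
    ultimately show "(\<integral>\<^sup>+y. h ((\<lambda>j\<in>I. b + c * x j)(i := y)) \<partial>lborel)
      = ennreal c * (\<integral>\<^sup>+y. h (\<lambda>j\<in>insert i I. b + c * (x(i := y)) j) \<partial>lborel)" by (simp only:)
  qed
  also have "\<dots> = ennreal c * (\<integral>\<^sup>+x. \<integral>\<^sup>+y. h (\<lambda>j\<in>insert i I. b + c * (x(i := y)) j) \<partial>lborel \<partial>Pi\<^sub>M I (\<lambda>_. lborel))"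
  proof (rule nn_integral_cmult)
    have "(\<lambda>(x, y). h (\<lambda>j\<in>insert i I. b + c * (x(i := y)) j)) \<in> borel_measurable (Pi\<^sub>M I (\<lambda>_. lborel) \<Otimes>\<^sub>M lborel)"
    proof -
      have "(\<lambda>p. h (\<lambda>j\<in>insert i I. b + c * (case p of (x, y) \<Rightarrow> x(i := y)) j))
          \<in> borel_measurable (Pi\<^sub>M I (\<lambda>_. lborel) \<Otimes>\<^sub>M lborel)"
        by (rule measurable_compose[OF measurable_compose[OF upd sc] insert.prems])
      then show ?thesis by (simp only: case_prod_unfold)
    qed
    then show "(\<lambda>x. \<integral>\<^sup>+y. h (\<lambda>j\<in>insert i I. b + c * (x(i := y)) j) \<partial>lborel) \<in> borel_measurable (Pi\<^sub>M I (\<lambda>_. lborel))"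
      using lborel.borel_measurable_nn_integral by force
  qed
  also have "(\<integral>\<^sup>+x. \<integral>\<^sup>+y. h (\<lambda>j\<in>insert i I. b + c * (x(i := y)) j) \<partial>lborel \<partial>Pi\<^sub>M I (\<lambda>_. lborel))
     = (\<integral>\<^sup>+x. h (\<lambda>j\<in>insert i I. b + c * x j) \<partial>Pi\<^sub>M (insert i I) (\<lambda>_. lborel))"
    by (rule product_nn_integral_insert[OF insert.hyps, symmetric]) simp
  also have "ennreal (c ^ card I) * (ennreal c * (\<integral>\<^sup>+x. h (\<lambda>j\<in>insert i I. b + c * x j) \<partial>Pi\<^sub>M (insert i I) (\<lambda>_. lborel)))
     = ennreal (c ^ card (insert i I)) * (\<integral>\<^sup>+x. h (\<lambda>j\<in>insert i I. b + c * x j) \<partial>Pi\<^sub>M (insert i I) (\<lambda>_. lborel))"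
    using insert.hyps c by (simp add: ennreal_mult ac_simps)
  finally show ?case .
qed

text \<open>The factor (1 / sqrt c)^q makes the substitution an isometry: its square cancels the
  Jacobian c^q. The relation is asked for almost everywhere because the scaling of the Hermite
  kernel is proved off the diagonals.\<close>

lemma l2_affine:
  assumes c: "0 < c" and [measurable]: "G \<in> borel_measurable (leb q)" "K \<in> borel_measurable (leb q)"
    and GK: "AE x in leb q. G (\<lambda>i\<in>{..<q}. b + c * x i) = (1 / sqrt c) ^ q * K x"
  shows "l2 (leb q) G = l2 (leb q) K"
proof -
  have "l2 (leb q) G = ennreal (c ^ q) * (\<integral>\<^sup>+x. ennreal ((G (\<lambda>i\<in>{..<q}. b + c * x i))\<^sup>2) \<partial>leb q)"
    unfolding l2_def by (subst nn_integral_PiM_affine[where c=c and b=b]) (use c in auto)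
  also have "(\<integral>\<^sup>+x. ennreal ((G (\<lambda>i\<in>{..<q}. b + c * x i))\<^sup>2) \<partial>leb q)
    = (\<integral>\<^sup>+x. ennreal (((1 / sqrt c) ^ q * K x)\<^sup>2) \<partial>leb q)"
    by (rule nn_integral_cong_AE) (use GK in \<open>auto elim!: eventually_mono\<close>)
  also have "\<dots> = ennreal (((1 / sqrt c) ^ q)\<^sup>2) * l2 (leb q) K"
    using l2_cmult[of K "leb q" "(1 / sqrt c) ^ q"] by (simp add: l2_def)
  also have "((1 / sqrt c) ^ q)\<^sup>2 = 1 / c ^ q"
    using c by (simp add: power_mult[symmetric] mult.commute[of _ 2] power_one_over)
      (simp add: power_mult)
  also have "ennreal (c ^ q) * (ennreal (1 / c ^ q) * l2 (leb q) K) = l2 (leb q) K"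
    using c by (simp add: mult.assoc[symmetric] ennreal_mult[symmetric])
  finally show ?thesis .
qed

context brownian
begin

lemma brownian_measurable[measurable]: "B s \<in> borel_measurable M"
  using bm by (simp add: two_sided_brownian_motion_def)

text \<open>The constants depend on q, p, k and A but not on the approximant, so they are the same
  for all windows and all N. The condition \<tau> \<le> 1 keeps the squared norm of the step
  function below 2 * A + 2.\<close>

lemma wiener_approx_power_expectation_diff:
  assumes X: "wiener_approx q f X" and A: "l2 (leb q) f \<le> ennreal A" "0 \<le> A" and p: "1 \<le> p"
    and t: "strict_mono_on {..n} t" and \<tau>: "l2 (leb q) (\<lambda>y. f y - step_function q n t a y) \<le> ennreal \<tau>" "0 \<le> \<tau>" "\<tau> \<le> 1"
  defines "S \<equiv> step_integral B q n t a"
    and "K \<equiv> real p * (2 ^ p * sqrt ((chaos_const q (p - 1) * (2 * A + 2)) ^ (p - 1))) * sqrt (4 * chaos_const q 1)"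
  shows "expectation (\<lambda>\<omega>. \<bar>X \<omega> ^ p - S \<omega> ^ p\<bar>) \<le> K * sqrt \<tau>"
    "expectation (\<lambda>\<omega>. S \<omega> ^ (2 * k)) \<le> (chaos_const q k * (2 * A + 2)) ^ k"
proof -
  note [measurable] = wiener_approx_measurable[OF X]
  have step: "l2 (leb q) (step_function q n t a) \<le> ennreal (2 * A + 2)"
  proof -
    have "l2 (leb q) (step_function q n t a) = l2 (leb q) (\<lambda>y. (step_function q n t a y - f y) + f y)" by simp
    also have "\<dots> \<le> 2 * l2 (leb q) (\<lambda>y. step_function q n t a y - f y) + 2 * l2 (leb q) f"
      by (rule l2_add_le) auto
    also have "\<dots> \<le> 2 * ennreal 1 + 2 * ennreal A"
      using order_trans[OF \<tau>(1) ennreal_leI[OF \<tau>(3)]] A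
      by (intro add_mono mult_left_mono) (auto simp: l2_diff_commute[of _ "step_function q n t a"])
    also have "\<dots> = ennreal (2 * A + 2)" using A by (simp add: ennreal_mult add.commute)
    finally show ?thesis .
  qed
  have amS: "all_moments M S" unfolding S_def by (rule step_integral_all_moments[OF t])
  note amX = wiener_approx_moment_le(1)[OF X A]
  show mS: "expectation (\<lambda>\<omega>. S \<omega> ^ (2 * k)) \<le> (chaos_const q k * (2 * A + 2)) ^ k" for k
    unfolding S_def by (rule step_integral_moment_le_l2[OF t step]) (use A in auto)
  have "ennreal (expectation (\<lambda>\<omega>. (X \<omega> - S \<omega>)\<^sup>2)) = l2 M (\<lambda>\<omega>. X \<omega> - S \<omega>)"
    by (rule l2_all_moments[symmetric]) (intro all_moments_intros amX amS)
  also have "\<dots> \<le> ennreal (4 * chaos_const q 1) * l2 (leb q) (\<lambda>y. f y - step_function q n t a y)"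
    unfolding S_def by (rule wiener_approx_contraction[OF X t])
  also have "\<dots> \<le> ennreal (4 * chaos_const q 1) * ennreal \<tau>" by (intro mult_left_mono \<tau>) auto
  also have "\<dots> = ennreal (4 * chaos_const q 1 * \<tau>)" using chaos_const_nonneg[of q 1] \<tau> by (simp add: ennreal_mult)
  finally have "expectation (\<lambda>\<omega>. (X \<omega> - S \<omega>)\<^sup>2) \<le> 4 * chaos_const q 1 * \<tau>"
    using chaos_const_nonneg[of q 1] \<tau> by (subst (asm) ennreal_le_iff) auto
  then have d: "sqrt (expectation (\<lambda>\<omega>. (X \<omega> - S \<omega>)\<^sup>2)) \<le> sqrt (4 * chaos_const q 1) * sqrt \<tau>"
    unfolding real_sqrt_mult[symmetric] by (rule real_sqrt_le_mono)
  have "expectation (\<lambda>\<omega>. \<bar>X \<omega> ^ p - S \<omega> ^ p\<bar>)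
    \<le> real p * (2 ^ p * sqrt ((chaos_const q (p - 1) * (2 * A + 2)) ^ (p - 1))) * sqrt (expectation (\<lambda>\<omega>. (X \<omega> - S \<omega>)\<^sup>2))"
    by (rule expectation_power_diff_le[OF amX amS p wiener_approx_moment_le(2)[OF X A] mS])
  also have "\<dots> \<le> real p * (2 ^ p * sqrt ((chaos_const q (p - 1) * (2 * A + 2)) ^ (p - 1))) * (sqrt (4 * chaos_const q 1) * sqrt \<tau>)"
    using chaos_const_nonneg[of q "p - 1"] A by (intro mult_left_mono d mult_nonneg_nonneg) auto
  finally show "expectation (\<lambda>\<omega>. \<bar>X \<omega> ^ p - S \<omega> ^ p\<bar>) \<le> K * sqrt \<tau>" by (simp add: K_def ac_simps)
qed

section \<open>Invariance of moments under affine rescaling\<close>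

text \<open>Stationarity and scaling of Brownian increments in joint law: both families are
  independent with the same normal marginals, hence have the same product law.\<close>

lemma expectation_scaled_increments:
  assumes t: "strict_mono_on {..n} t" and c: "0 < c" and G[measurable]: "G \<in> borel_measurable (Pi\<^sub>M {..<n} (\<lambda>_. borel))"
  shows "expectation (\<lambda>\<omega>. G (\<lambda>j\<in>{..<n}. (B (b + c * t (Suc j)) \<omega> - B (b + c * t j) \<omega>) / sqrt c))
    = (expectation (\<lambda>\<omega>. G (\<lambda>j\<in>{..<n}. B (t (Suc j)) \<omega> - B (t j) \<omega>)) :: real)"
\<comment> \<open>The description of independence by a product law is for nonempty index
  sets.\<close>
proof (cases "n = 0")
  case True
  then show ?thesis by (simp add: restrict_def)
next
  case False
  then have ne: "{..<n} \<noteq> {}" by auto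
  define X where "X j \<omega> = B (t (Suc j)) \<omega> - B (t j) \<omega>" for j \<omega>
  define Y where "Y j \<omega> = (B (b + c * t (Suc j)) \<omega> - B (b + c * t j) \<omega>) / sqrt c" for j \<omega>
  have mX[measurable]: "X j \<in> borel_measurable M" and mY[measurable]: "Y j \<in> borel_measurable M" for j
    unfolding X_def [abs_def] Y_def [abs_def] by measurable
  have t': "strict_mono_on {..n} (\<lambda>j. b + c * t j)"
    using t c by (auto simp: strict_mono_on_def)
  have iX: "indep_vars (\<lambda>_. borel) X {..<n}" unfolding X_def [abs_def] by (rule increments_indep[OF t])
  have "indep_vars (\<lambda>_. borel) (\<lambda>j. (\<lambda>x. x / sqrt c) \<circ> (\<lambda>\<omega>. B (b + c * t (Suc j)) \<omega> - B (b + c * t j) \<omega>)) {..<n}"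
    by (rule indep_vars_compose[OF increments_indep[OF t']]) auto
  then have iY: "indep_vars (\<lambda>_. borel) Y {..<n}" by (simp add: Y_def [abs_def] comp_def)
  have eq: "distr M borel (X j) = distr M borel (Y j)" if j: "j < n" for j
  proof -
    let ?v = "sqrt (t (Suc j) - t j)"
    have tj: "t j < t (Suc j)" by (rule grid_less[OF t j])
    have dX: "distributed M lborel (X j) (normal_density 0 ?v)"
      using bm tj by (simp add: X_def [abs_def] two_sided_brownian_motion_def)
    have "distributed M lborel (\<lambda>\<omega>. B (b + c * t (Suc j)) \<omega> - B (b + c * t j) \<omega>) (normal_density 0 (sqrt (c * (t (Suc j) - t j))))"
    proof -
      have "b + c * t j < b + c * t (Suc j)" using tj c by simp
      then have "distributed M lborel (\<lambda>\<omega>. B (b + c * t (Suc j)) \<omega> - B (b + c * t j) \<omega>)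
          (normal_density 0 (sqrt ((b + c * t (Suc j)) - (b + c * t j))))"
        using bm unfolding two_sided_brownian_motion_def by blast
      moreover have "(b + c * t (Suc j)) - (b + c * t j) = c * (t (Suc j) - t j)" by (simp add: algebra_simps)
      ultimately show ?thesis by (simp only:)
    qed
    from normal_density_affine[OF this, of "1 / sqrt c" 0] c tj
    have dY: "distributed M lborel (Y j) (normal_density 0 ?v)"
      by (simp add: Y_def [abs_def] real_sqrt_mult)
    have "distr M borel Z = density lborel (normal_density 0 ?v)" if "distributed M lborel Z (normal_density 0 ?v)" for Z
    proof -
      have "distr M borel Z = distr M lborel Z" by (rule distr_cong) auto
      then show ?thesis using that by (simp add: distributed_def)
    qed
    from this[OF dX] this[OF dY] show ?thesis by simp
  qed
  have "distr M (Pi\<^sub>M {..<n} (\<lambda>_. borel)) (\<lambda>\<omega>. \<lambda>j\<in>{..<n}. X j \<omega>) = (\<Pi>\<^sub>M j\<in>{..<n}. distr M borel (X j))"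
    using indep_vars_iff_distr_eq_PiM[OF ne, where M'="\<lambda>_. borel" and X=X, OF mX] iX by simp
  also have "\<dots> = (\<Pi>\<^sub>M j\<in>{..<n}. distr M borel (Y j))" by (rule PiM_cong) (auto simp: eq)
  also have "\<dots> = distr M (Pi\<^sub>M {..<n} (\<lambda>_. borel)) (\<lambda>\<omega>. \<lambda>j\<in>{..<n}. Y j \<omega>)"
    using indep_vars_iff_distr_eq_PiM[OF ne, where M'="\<lambda>_. borel" and X=Y, OF mY] iY by simp
  finally have D: "distr M (Pi\<^sub>M {..<n} (\<lambda>_. borel)) (\<lambda>\<omega>. \<lambda>j\<in>{..<n}. X j \<omega>)
     = distr M (Pi\<^sub>M {..<n} (\<lambda>_. borel)) (\<lambda>\<omega>. \<lambda>j\<in>{..<n}. Y j \<omega>)" .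
  have mr: "(\<lambda>\<omega>. \<lambda>j\<in>{..<n}. Z j \<omega>) \<in> measurable M (Pi\<^sub>M {..<n} (\<lambda>_. borel))"
    if "\<And>j. Z j \<in> borel_measurable M" for Z :: "nat \<Rightarrow> 'a \<Rightarrow> real"
    by (rule measurable_restrict) (rule that)
  have "expectation (\<lambda>\<omega>. G (\<lambda>j\<in>{..<n}. Y j \<omega>)) = expectation (\<lambda>\<omega>. G (\<lambda>j\<in>{..<n}. X j \<omega>))"
    unfolding integral_distr[OF mr[of X, OF mX] G, symmetric] integral_distr[OF mr[of Y, OF mY] G, symmetric] D ..
  then show ?thesis by (simp add: X_def Y_def)
qed

lemma step_integral_scaled_expectation:
  assumes t: "strict_mono_on {..n} t" and c: "0 < c"
  shows "expectation (\<lambda>\<omega>. step_integral B q n (\<lambda>j. b + c * t j) (\<lambda>k. (1 / sqrt c) ^ q * a k) \<omega> ^ p)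
    = expectation (\<lambda>\<omega>. step_integral B q n t a \<omega> ^ p)"
proof -
  let ?G = "\<lambda>x. multilinear n (set_coeff q n a) x ^ p"
  have "step_integral B q n (\<lambda>j. b + c * t j) (\<lambda>k. (1 / sqrt c) ^ q * a k) \<omega>
    = multilinear n (set_coeff q n a) (\<lambda>j\<in>{..<n}. (B (b + c * t (Suc j)) \<omega> - B (b + c * t j) \<omega>) / sqrt c)" for \<omega>
    unfolding multilinear_restrict
    by (subst sum_multi_eq_multilinear[symmetric])
       (simp add: step_integral_def prod_dividef power_one_over field_simps)
  moreover have "step_integral B q n t a \<omega>
    = multilinear n (set_coeff q n a) (\<lambda>j\<in>{..<n}. B (t (Suc j)) \<omega> - B (t j) \<omega>)" for \<omega>
    unfolding multilinear_restrict by (rule step_integral_eq_multilinear)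
  ultimately show ?thesis
    using expectation_scaled_increments[OF t c, of ?G b] by simp
qed

lemma step_function_affine:
  assumes "0 < c"
  shows "step_function q n (\<lambda>j. b + c * t j) a (\<lambda>i\<in>{..<q}. b + c * x i) = step_function q n t a x"
  unfolding step_function_def using assms
  by (intro sum.cong arg_cong2[of _ _ _ _ "(*)"] prod.cong refl) (auto split: split_indicator)

text \<open>A step function near f, moved by the substitution, is equally near g by
  \<open>l2_affine\<close>, and the two step integrals have the same moments; the integrals
  themselves then agree in the limit.\<close>

lemma wiener_approx_scaled_expectation:
  assumes X: "wiener_approx q f X" and Y: "wiener_approx q g Y" and c: "0 < c" and p: "1 \<le> p"
    and fg: "AE x in leb q. g (\<lambda>i\<in>{..<q}. b + c * x i) = (1 / sqrt c) ^ q * f x"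
  shows "expectation (\<lambda>\<omega>. Y \<omega> ^ p) = expectation (\<lambda>\<omega>. X \<omega> ^ p)"
proof -
  note [measurable] = wiener_approx_measurable[OF X] wiener_approx_measurable[OF Y]
  define A where "A = enn2real (l2 (leb q) f) + enn2real (l2 (leb q) g)"
  have A: "0 \<le> A" "l2 (leb q) f \<le> ennreal A" "l2 (leb q) g \<le> ennreal A"
    using wiener_approx_l2_finite[OF X] wiener_approx_l2_finite[OF Y] unfolding A_def
    by (auto simp: ennreal_enn2real)
  define K where "K = real p * (2 ^ p * sqrt ((chaos_const q (p - 1) * (2 * A + 2)) ^ (p - 1))) * sqrt (4 * chaos_const q 1)"
  have K: "0 \<le> K" unfolding K_def using chaos_const_nonneg[of q "p-1"] chaos_const_nonneg[of q 1] A
    by (intro mult_nonneg_nonneg) auto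
  have "\<bar>expectation (\<lambda>\<omega>. Y \<omega> ^ p) - expectation (\<lambda>\<omega>. X \<omega> ^ p)\<bar> \<le> e" if e: "0 < e" for e
  proof -
    \<comment> \<open>Makes each of the two errors K * sqrt \<tau> at most e / 2; K + 1 guards
      against K = 0, and the cap 1 is what the moment bounds require.\<close>
    define \<tau> where "\<tau> = min 1 ((e / (2 * (K + 1)))\<^sup>2)"
    have \<tau>: "0 < \<tau>" "\<tau> \<le> 1" using e K by (auto simp: \<tau>_def)
    have sq: "sqrt \<tau> \<le> e / (2 * (K + 1))"
    proof -
      have "sqrt \<tau> \<le> sqrt ((e / (2 * (K + 1)))\<^sup>2)" unfolding \<tau>_def by (intro real_sqrt_le_mono) simp
      then show ?thesis using e K by simp
    qed
    have K\<tau>: "K * sqrt \<tau> \<le> e / 2"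
    proof -
      have "K * sqrt \<tau> \<le> (K + 1) * (e / (2 * (K + 1)))" using K sq \<tau> by (intro mult_mono) auto
      also have "\<dots> = e / 2" using K by (simp add: field_simps)
      finally show ?thesis .
    qed
    have "0 < ennreal \<tau>" using \<tau> by simp
    from wiener_approxE[OF X this] obtain n t a where 1: "strict_mono_on {..n} t"
      "l2 (leb q) (\<lambda>y. f y - step_function q n t a y) < ennreal \<tau>" .
    let ?t = "\<lambda>j. b + c * t j" and ?a = "\<lambda>k. (1 / sqrt c) ^ q * a k"
    have t': "strict_mono_on {..n} ?t" using 1(1) c by (auto simp: strict_mono_on_def)
    have g\<tau>: "l2 (leb q) (\<lambda>y. g y - step_function q n ?t ?a y) \<le> ennreal \<tau>"
    proof -
      have "AE x in leb q. g (\<lambda>i\<in>{..<q}. b + c * x i) - step_function q n ?t ?a (\<lambda>i\<in>{..<q}. b + c * x i)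
          = (1 / sqrt c) ^ q * (f x - step_function q n t a x)"
        using fg by (auto elim!: eventually_mono simp: step_function_affine[OF c] step_function_cmult right_diff_distrib)
      then have "l2 (leb q) (\<lambda>y. g y - step_function q n ?t ?a y) = l2 (leb q) (\<lambda>x. f x - step_function q n t a x)"
        by (intro l2_affine[OF c]) auto
      then show ?thesis using 1 by simp
    qed
    note DX = wiener_approx_power_expectation_diff(1)[OF X A(2,1) p 1(1) less_imp_le[OF 1(2)] less_imp_le[OF \<tau>(1)] \<tau>(2), folded K_def]
    note DY = wiener_approx_power_expectation_diff(1)[OF Y A(3,1) p t' g\<tau> less_imp_le[OF \<tau>(1)] \<tau>(2), folded K_def]
    note amX = wiener_approx_moment_le(1)[OF X A(2,1)] and amY = wiener_approx_moment_le(1)[OF Y A(3,1)]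
    have dd: "\<bar>expectation (\<lambda>\<omega>. U \<omega> ^ p) - expectation (\<lambda>\<omega>. V \<omega> ^ p)\<bar> \<le> expectation (\<lambda>\<omega>. \<bar>U \<omega> ^ p - V \<omega> ^ p\<bar>)"
      if "all_moments M U" "all_moments M V" for U V
      using that integral_abs_bound[of M "\<lambda>\<omega>. U \<omega> ^ p - V \<omega> ^ p"] by (simp add: all_moments_integrable_power)
    have "\<bar>expectation (\<lambda>\<omega>. X \<omega> ^ p) - expectation (\<lambda>\<omega>. step_integral B q n t a \<omega> ^ p)\<bar> \<le> e / 2"
      using dd[OF amX step_integral_all_moments[OF 1(1)]] DX K\<tau> by (meson order_trans)
    moreover have "\<bar>expectation (\<lambda>\<omega>. Y \<omega> ^ p) - expectation (\<lambda>\<omega>. step_integral B q n t a \<omega> ^ p)\<bar> \<le> e / 2"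
      using order_trans[OF dd[OF amY step_integral_all_moments[OF t']] order_trans[OF DY K\<tau>]]
      unfolding step_integral_scaled_expectation[OF 1(1) c] .
    ultimately show ?thesis by linarith
  qed
  then have "\<bar>expectation (\<lambda>\<omega>. Y \<omega> ^ p) - expectation (\<lambda>\<omega>. X \<omega> ^ p)\<bar> \<le> 0" by (rule field_le_epsilon) simp
  then show ?thesis by simp
qed

section \<open>Independent approximants on disjoint intervals\<close>

text \<open>An approximant of g l whose boxes outside the cube over (u l, v l] are discarded depends
  only on increments within that interval. For disjoint intervals the results are functions of
  disjoint families of independent increments. The price is the part of g l outside the
  cube.\<close>

lemma independent_step_integrals:
  fixes u v :: "nat \<Rightarrow> real"
  assumes L: "finite L" "L \<noteq> {}" and Y: "\<And>l. l \<in> L \<Longrightarrow> wiener_approx q (g l) (Y l)"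
    and uv: "\<And>l l'. l \<in> L \<Longrightarrow> l' \<in> L \<Longrightarrow> l \<noteq> l' \<Longrightarrow> v l \<le> u l' \<or> v l' \<le> u l"
    and \<tau>: "0 < \<tau>"
  shows "\<exists>(n::nat) t b. strict_mono_on {..n} t \<and> indep_vars (\<lambda>_. borel) (\<lambda>l. step_integral B q n t (b l)) L \<and>
    (\<forall>l\<in>L. l2 (leb q) (\<lambda>y. g l y - step_function q n t (b l) y)
       \<le> \<tau> + l2 (leb q) (\<lambda>y. g l y * of_bool (\<not> (\<forall>i<q. y i \<in> {u l<..v l}))))"
proof -
  have "\<exists>n t a. strict_mono_on {..n} t \<and> l2 (leb q) (\<lambda>y. g l y - step_function q n t a y) < \<tau>" if "l \<in> L" for l
    using wiener_approxE[OF Y[OF that] \<tau>] by metis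
  then obtain n t a where nta: "\<And>l. l \<in> L \<Longrightarrow> strict_mono_on {..n l} (t l)"
      "\<And>l. l \<in> L \<Longrightarrow> l2 (leb q) (\<lambda>y. g l y - step_function q (n l) (t l) (a l) y) < \<tau>" by metis
  \<comment> \<open>The endpoints u l and v l join the grid so that truncation never cuts a
    box.\<close>
  let ?P = "(\<Union>l\<in>L. t l ` {..n l} \<union> {u l, v l})"
  from grid_enumerate[of ?P] L obtain m :: nat and s where s: "strict_mono_on {..m} s" "s ` {..m} = ?P" by auto
  have "\<exists>a'. step_function q (n l) (t l) (a l) = step_function q m s a'" if l: "l \<in> L" for l
    by (rule step_refine[OF nta(1)[OF l] s(1), where 'a='a and q=q and a="a l"]) (use l s(2) in auto)
  then obtain a' where a': "\<And>l. l \<in> L \<Longrightarrow> step_function q (n l) (t l) (a l) = step_function q m s (a' l)" by metis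
  define K where "K l = {j. j < m \<and> u l \<le> s j \<and> s (Suc j) \<le> v l}" for l
  define b where "b l k = (if \<forall>i<q. u l \<le> s (k i) \<and> s (Suc (k i)) \<le> v l then a' l k else 0)" for l k
  have disj: "disjoint_family_on K L"
    unfolding disjoint_family_on_def
  proof (intro ballI impI)
    fix l l' assume l: "l \<in> L" "l' \<in> L" "l \<noteq> l'"
    show "K l \<inter> K l' = {}"
    proof (rule ccontr)
      assume "K l \<inter> K l' \<noteq> {}"
      then obtain j where j: "j < m" "u l \<le> s j" "s (Suc j) \<le> v l" "u l' \<le> s j" "s (Suc j) \<le> v l'" by (auto simp: K_def)
      then show False using uv[OF l] grid_less[OF s(1) j(1)] by linarith
    qed
  qed
  have "indep_vars (\<lambda>l. Pi\<^sub>M (K l) (\<lambda>_. borel))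
      (\<lambda>l \<omega>. restrict (\<lambda>i. B (s (Suc i)) \<omega> - B (s i) \<omega>) (K l)) L"
    by (rule indep_vars_restrict[OF increments_indep[OF s(1)] _ disj]) (auto simp: K_def)
  \<comment> \<open>Each step integral is rewritten as a function of the coordinates in K l only;
    the conditional keeps it from reading coordinates at which the restricted point is
    undefined.\<close>
  then have "indep_vars (\<lambda>_. borel) (\<lambda>l. (\<lambda>x. \<Sum>k\<in>multi_indices q m. if \<forall>i<q. k i \<in> K l then a' l k * (\<Prod>i<q. x (k i)) else 0)
      \<circ> (\<lambda>\<omega>. restrict (\<lambda>i. B (s (Suc i)) \<omega> - B (s i) \<omega>) (K l))) L"
  proof (rule indep_vars_compose)
    fix l
    show "(\<lambda>x. \<Sum>k\<in>multi_indices q m. if \<forall>i<q. k i \<in> K l then a' l k * (\<Prod>i<q. x (k i)) else 0)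
        \<in> measurable (Pi\<^sub>M (K l) (\<lambda>_. borel)) borel"
    proof (rule borel_measurable_sum)
      fix k
      show "(\<lambda>x. if \<forall>i<q. k i \<in> K l then a' l k * (\<Prod>i<q. x (k i)) else 0) \<in> borel_measurable (Pi\<^sub>M (K l) (\<lambda>_. borel))"
      proof (cases "\<forall>i<q. k i \<in> K l")
        case True
        then show ?thesis
          by (auto intro!: borel_measurable_times borel_measurable_prod measurable_component_singleton)
      next
        case False
        then show ?thesis by (simp only: if_False borel_measurable_const)
      qed
    qed
  qed
  moreover have "(\<lambda>x. \<Sum>k\<in>multi_indices q m. if \<forall>i<q. k i \<in> K l then a' l k * (\<Prod>i<q. x (k i)) else 0)
      \<circ> (\<lambda>\<omega>. restrict (\<lambda>i. B (s (Suc i)) \<omega> - B (s i) \<omega>) (K l)) = step_integral B q m s (b l)" for l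
  proof
    fix \<omega>
    show "((\<lambda>x. \<Sum>k\<in>multi_indices q m. if \<forall>i<q. k i \<in> K l then a' l k * (\<Prod>i<q. x (k i)) else 0)
      \<circ> (\<lambda>\<omega>. restrict (\<lambda>i. B (s (Suc i)) \<omega> - B (s i) \<omega>) (K l))) \<omega> = step_integral B q m s (b l) \<omega>"
      unfolding comp_def step_integral_def
    proof (rule sum.cong[OF refl])
      fix k assume k: "k \<in> multi_indices q m"
      have eq: "(\<forall>i<q. u l \<le> s (k i) \<and> s (Suc (k i)) \<le> v l) \<longleftrightarrow> (\<forall>i<q. k i \<in> K l)"
        using multi_indices_less[OF k] by (auto simp: K_def)
      show "(if \<forall>i<q. k i \<in> K l then a' l k * (\<Prod>i<q. restrict (\<lambda>i. B (s (Suc i)) \<omega> - B (s i) \<omega>) (K l) (k i)) else 0)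
         = b l k * (\<Prod>i<q. B (s (Suc (k i))) \<omega> - B (s (k i)) \<omega>)"
        unfolding b_def eq by (cases "\<forall>i<q. k i \<in> K l") (auto intro!: prod.cong)
    qed
  qed
  ultimately have ind: "indep_vars (\<lambda>_. borel) (\<lambda>l. step_integral B q m s (b l)) L" by simp
  have l2le: "l2 (leb q) (\<lambda>y. g l y - step_function q m s (b l) y)
       \<le> \<tau> + l2 (leb q) (\<lambda>y. g l y * of_bool (\<not> (\<forall>i<q. y i \<in> {u l<..v l})))" if l: "l \<in> L" for l
  proof -
    note [measurable] = wiener_approx_measurable[OF Y[OF l]]
    let ?in = "\<lambda>y. \<forall>i<q. y i \<in> {u l<..v l}"
    have trunc: "step_function q m s (b l) y = step_function q m s (a' l) y * of_bool (?in y)" for y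
      unfolding b_def by (rule step_function_truncate[OF s(1)]) (use l s(2) in auto)
    \<comment> \<open>Inside the cube only the approximation error is present, outside only g l, so
      the squares add without a factor 2.\<close>
    have "l2 (leb q) (\<lambda>y. g l y - step_function q m s (b l) y)
      \<le> (\<integral>\<^sup>+y. ennreal ((g l y - step_function q m s (a' l) y)\<^sup>2) + ennreal ((g l y * of_bool (\<not> ?in y))\<^sup>2) \<partial>leb q)"
      unfolding l2_def by (rule nn_integral_mono) (auto simp: trunc simp flip: ennreal_plus)
    also have "\<dots> = l2 (leb q) (\<lambda>y. g l y - step_function q m s (a' l) y) + l2 (leb q) (\<lambda>y. g l y * of_bool (\<not> ?in y))"
      unfolding l2_def by (rule nn_integral_add) measurable
    also have "\<dots> \<le> \<tau> + l2 (leb q) (\<lambda>y. g l y * of_bool (\<not> ?in y))"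
      using nta(2)[OF l] by (intro add_right_mono) (simp add: a'[OF l] less_imp_le)
    finally show ?thesis .
  qed
  show ?thesis using s(1) ind l2le by blast
qed

end

section \<open>The kernel of the Hermite process\<close>

lemma pos_powr_measurable[measurable]: "(\<lambda>x. pos_powr x a) \<in> borel_measurable borel"
  unfolding pos_powr_def by measurable

lemma pos_powr_nonneg[simp]: "0 \<le> pos_powr x a"
  by (simp add: pos_powr_def)

lemma pos_powr_mult: "0 < c \<Longrightarrow> pos_powr (c * x) a = c powr a * pos_powr x a"
  by (simp add: pos_powr_def powr_mult zero_less_mult_iff)

lemma pos_powr_antimono: "0 < x \<Longrightarrow> x \<le> y \<Longrightarrow> a \<le> 0 \<Longrightarrow> pos_powr y a \<le> pos_powr x a"
  by (simp add: pos_powr_def powr_mono2')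

text \<open>Off the diagonals the integral over u defining the kernel converges, so its identities
  hold almost everywhere. By Fubini, each hyperplane x i = x j is null because its sections in the
  coordinate i are single points.\<close>

lemma AE_leb_distinct: "AE x in leb q. inj_on x {..<q}"
proof -
  interpret product_sigma_finite "\<lambda>_::nat. lborel :: real measure" by standard
  have pair: "AE x in leb q. x i \<noteq> x j" if ij: "i < q" "j < q" "i \<noteq> j" for i j
  proof -
    let ?I = "{..<q} - {i}"
    let ?h = "\<lambda>x :: nat \<Rightarrow> real. indicator {x. x i = x j} x :: ennreal"
    have I: "insert i ?I = {..<q}" using ij by auto
    have [measurable]: "(\<lambda>x. x i) \<in> borel_measurable (leb q)" "(\<lambda>x. x j) \<in> borel_measurable (leb q)"
      using ij by (auto intro!: measurable_component_singleton[of _ "{..<q}" "\<lambda>_. lborel :: real measure", simplified])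
    have m: "{x \<in> space (leb q). x i = x j} \<in> sets (leb q)" by measurable
    have hm: "?h \<in> borel_measurable (Pi\<^sub>M (insert i ?I) (\<lambda>_. lborel))"
      unfolding I using m by (subst borel_measurable_indicator_iff) (simp add: Int_def conj_commute)
    have "(\<integral>\<^sup>+x. ?h x \<partial>leb q) = (\<integral>\<^sup>+x. \<integral>\<^sup>+y. ?h (x(i := y)) \<partial>lborel \<partial>Pi\<^sub>M ?I (\<lambda>_. lborel))"
      using product_nn_integral_insert[OF _ _ hm] I by simp
    also have "\<dots> = (\<integral>\<^sup>+x. 0 \<partial>Pi\<^sub>M ?I (\<lambda>_. lborel :: real measure))"
    proof (rule nn_integral_cong)
      fix x :: "nat \<Rightarrow> real"
      have "(\<integral>\<^sup>+y. ?h (x(i := y)) \<partial>lborel) = (\<integral>\<^sup>+y. indicator {x j} y \<partial>lborel)"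
        using ij by (intro nn_integral_cong) (auto split: split_indicator)
      then show "(\<integral>\<^sup>+y. ?h (x(i := y)) \<partial>lborel) = 0" by simp
    qed
    finally have "(\<integral>\<^sup>+x. ?h x \<partial>leb q) = 0" by simp
    then have "AE x in leb q. ?h x = 0" using hm unfolding I by (simp add: nn_integral_0_iff_AE)
    then show ?thesis by (auto elim!: eventually_mono split: split_indicator_asm)
  qed
  have "AE x in leb q. \<forall>i\<in>{..<q}. \<forall>j\<in>{..<q}. i \<noteq> j \<longrightarrow> x i \<noteq> x j"
    by (intro AE_finite_allI) (auto intro: pair AE_I2)
  then show ?thesis by (auto elim!: eventually_mono simp: inj_on_def)
qed

lemma integrable_pos_powr:
  assumes "-1 < a"
  shows "integrable lborel (\<lambda>u. indicator {m..b} u * pos_powr (u - m) a)"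
proof -
  define c where "c = max 0 (b - m)"
  have "((\<lambda>x. x powr a) has_integral (c powr (a + 1) / (a + 1))) {0..c}"
    by (rule has_integral_powr_from_0[OF assms]) (simp add: c_def)
  then have "(\<lambda>x. x powr a) absolutely_integrable_on {0..c}"
    by (intro nonnegative_absolutely_integrable_1) (auto simp: has_integral_integrable)
  then have "integrable lebesgue (\<lambda>x. indicator {0..c} x *\<^sub>R x powr a)" by (simp add: set_integrable_def)
  then have "integrable lborel (\<lambda>x. indicator {0..c} x *\<^sub>R x powr a)"
    by (subst (asm) integrable_completion) auto
  from lborel_integrable_real_affine[OF this, of 1 "-m"]
  have "integrable lborel (\<lambda>u. indicator {0..c} (u - m) * (u - m) powr a)" by (simp add: algebra_simps)
  then show ?thesis
    by (rule Bochner_Integration.integrable_bound)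
       (auto simp: pos_powr_def c_def split: split_indicator)
qed

locale hermite_kernel_params =
  fixes d :: real and q :: nat and H :: real
  assumes d: "0 < d" and q: "1 \<le> q" and H: "1/2 < H" "H < 1"
begin

text \<open>The order of the singularity. The bound \<alpha> < 1 makes it integrable in u, and
  \<alpha> > 1/2 makes the kernel square integrable far to the left.\<close>

definition \<alpha> :: real where "\<alpha> = 1/2 + (1 - H) / real q"

lemma alpha_bounds: "1/2 < \<alpha>" "\<alpha> < 1"
proof -
  have "(1 - H) / real q \<le> (1 - H) / 1" using q H by (intro divide_left_mono) auto
  then show "1/2 < \<alpha>" "\<alpha> < 1" using q H by (auto simp: \<alpha>_def)
qed

abbreviation kern :: "real \<Rightarrow> (nat \<Rightarrow> real) \<Rightarrow> real" where
  "kern \<equiv> hermite_kernel d q H"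

lemma kern_eq: "kern u y = d * (\<Prod>i<q. pos_powr (u - y i) (- \<alpha>))"
  by (simp add: hermite_kernel_def \<alpha>_def)

lemma kern_nonneg: "0 \<le> kern u y"
  unfolding kern_eq using d by (intro mult_nonneg_nonneg prod_nonneg) auto

lemma kern_measurable[measurable]: "(\<lambda>u. kern u y) \<in> borel_measurable borel"
  unfolding kern_eq by measurable

text \<open>Only the largest coordinate m produces a singularity: the kernel vanishes for u \<le> m,
  and for u > m the other factors are at most their values at m, which are finite since the
  coordinates are distinct.\<close>

lemma kern_set_integrable:
  assumes y: "inj_on y {..<q}"
  shows "set_integrable lborel {a..b} (\<lambda>u. kern u y)"
proof -
  let ?Y = "y ` {..<q}"
  have "0 \<in> {..<q}" using q by simp
  then have fin: "finite ?Y" "?Y \<noteq> {}" by blast+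
  from Max_in[OF fin] obtain i0 where i0: "i0 < q" "y i0 = Max ?Y" by auto
  define m where "m = y i0"
  have mx: "y i < m" if "i < q" "i \<noteq> i0" for i
  proof -
    have "y i \<le> m" unfolding m_def i0(2) using that fin by (intro Max_ge) auto
    moreover have "y i \<noteq> m" using inj_onD[OF y, of i i0] that i0 by (auto simp: m_def)
    ultimately show ?thesis by simp
  qed
  define c where "c = d * (\<Prod>i\<in>{..<q} - {i0}. pos_powr (m - y i) (- \<alpha>))"
  have c: "0 \<le> c" unfolding c_def using d by (intro mult_nonneg_nonneg prod_nonneg) auto
  have le: "kern u y \<le> c * pos_powr (u - m) (- \<alpha>)" for u
  proof (cases "u \<le> m")
    case True
    then have "(\<Prod>i<q. pos_powr (u - y i) (- \<alpha>)) = 0"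
      using i0 by (intro prod_zero) (auto simp: m_def pos_powr_def intro!: bexI[of _ i0])
    then have "kern u y = 0" unfolding kern_eq by (simp only: mult_zero_right)
    then show ?thesis using c by simp
  next
    case False
    have "(\<Prod>i\<in>{..<q} - {i0}. pos_powr (u - y i) (- \<alpha>)) \<le> (\<Prod>i\<in>{..<q} - {i0}. pos_powr (m - y i) (- \<alpha>))"
      using mx False alpha_bounds by (intro prod_mono conjI pos_powr_antimono) auto
    moreover have "(\<Prod>i<q. pos_powr (u - y i) (- \<alpha>)) = pos_powr (u - m) (- \<alpha>) * (\<Prod>i\<in>{..<q} - {i0}. pos_powr (u - y i) (- \<alpha>))"
      using i0(1) by (subst prod.remove[of _ i0]) (auto simp: m_def)
    ultimately show ?thesis
      unfolding kern_eq c_def using d by (simp add: mult_left_mono mult_right_mono ac_simps)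
  qed
  have "integrable lborel (\<lambda>u. c * (indicator {m..b} u * pos_powr (u - m) (- \<alpha>)))"
    using integrable_pos_powr[of "- \<alpha>" m b] alpha_bounds by simp
  then show ?thesis
    unfolding set_integrable_def
  proof (rule Bochner_Integration.integrable_bound)
    show "AE u in lborel. norm (indicator {a..b} u *\<^sub>R kern u y)
        \<le> norm (c * (indicator {m..b} u * pos_powr (u - m) (- \<alpha>)))"
    proof (rule AE_I2)
      fix u
      have "kern u y = 0" if "u < m" using le[of u] kern_nonneg[of u y] that by (simp add: pos_powr_def)
      then show "norm (indicator {a..b} u *\<^sub>R kern u y)
        \<le> norm (c * (indicator {m..b} u * pos_powr (u - m) (- \<alpha>)))"
        using le[of u] kern_nonneg[of u y] c by (cases "u < m") (auto simp: abs_mult split: split_indicator)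
    qed
  qed measurable
qed

section \<open>Scaling and tails of the integrated kernel\<close>

definition F :: "real \<Rightarrow> (nat \<Rightarrow> real) \<Rightarrow> real" where
  "F t y = (LBINT u:{0..t}. kern u y)"

lemma F_nonneg: "0 \<le> F t y"
  unfolding F_def set_lebesgue_integral_def by (intro Bochner_Integration.integral_nonneg) (simp add: kern_nonneg)

lemma kern_affine:
  assumes "0 < \<delta>"
  shows "kern (a + \<delta> * u) (\<lambda>i\<in>{..<q}. a + \<delta> * x i) = \<delta> powr (- \<alpha> * real q) * kern u x"
proof -
  have "(\<Prod>i<q. pos_powr (a + \<delta> * u - (\<lambda>i\<in>{..<q}. a + \<delta> * x i) i) (- \<alpha>))
    = (\<Prod>i<q. \<delta> powr (- \<alpha>) * pos_powr (u - x i) (- \<alpha>))"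
  proof (rule prod.cong[OF refl])
    fix i assume "i \<in> {..<q}"
    then have "a + \<delta> * u - (\<lambda>i\<in>{..<q}. a + \<delta> * x i) i = \<delta> * (u - x i)" by (simp add: algebra_simps)
    then show "pos_powr (a + \<delta> * u - (\<lambda>i\<in>{..<q}. a + \<delta> * x i) i) (- \<alpha>) = \<delta> powr (- \<alpha>) * pos_powr (u - x i) (- \<alpha>)"
      by (simp only: pos_powr_mult[OF assms])
  qed
  also have "\<dots> = \<delta> powr (- \<alpha> * real q) * (\<Prod>i<q. pos_powr (u - x i) (- \<alpha>))"
  proof -
    have "(\<delta> powr (- \<alpha>)) ^ q = \<delta> powr (- \<alpha> * real q)"
      using assms by (subst powr_realpow[symmetric]) (auto simp: powr_powr)
    then show ?thesis by (simp add: prod.distrib)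
  qed
  finally show ?thesis by (simp add: kern_eq)
qed

text \<open>The substitution contributes \<delta> and the kernel \<delta> powr (- \<alpha> * q),
  where 1 - \<alpha> * q = H - q / 2. The first part of this exponent is the self-similarity index,
  the second the isometric factor of \<open>l2_affine\<close>. Distinct coordinates ensure that the
  integrals exist and may be split at a.\<close>

lemma F_increment_affine:
  assumes \<delta>: "0 < \<delta>" and a: "0 \<le> a" and x: "inj_on x {..<q}"
  shows "F (a + \<delta>) (\<lambda>i\<in>{..<q}. a + \<delta> * x i) - F a (\<lambda>i\<in>{..<q}. a + \<delta> * x i)
    = \<delta> powr H * (1 / sqrt \<delta>) ^ q * F 1 x"
proof -
  let ?y = "\<lambda>i\<in>{..<q}. a + \<delta> * x i"
  have y: "inj_on ?y {..<q}" using x \<delta> by (auto simp: inj_on_def)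
  have "F (a + \<delta>) ?y = F a ?y + (LBINT u:{a<..a + \<delta>}. kern u ?y)"
  proof -
    have "{0..a + \<delta>} = {0..a} \<union> {a<..a + \<delta>}" using a \<delta> by auto
    moreover have "set_integrable lborel {a<..a + \<delta>} (\<lambda>u. kern u ?y)"
      by (rule set_integrable_subset[OF kern_set_integrable[OF y, of a "a + \<delta>"]]) auto
    ultimately show ?thesis
      unfolding F_def by (simp add: set_integral_Un kern_set_integrable[OF y] disjoint_iff)
  qed
  then have "F (a + \<delta>) ?y - F a ?y = (\<integral>u. indicator {a<..a + \<delta>} u *\<^sub>R kern u ?y \<partial>lborel)"
    by (simp add: set_lebesgue_integral_def)
  also have "\<dots> = \<delta> * (\<integral>u. indicator {a<..a + \<delta>} (a + \<delta> * u) *\<^sub>R kern (a + \<delta> * u) ?y \<partial>lborel)"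
    using \<delta> by (subst lborel_integral_real_affine[where c=\<delta> and t=a]) auto
  also have "(\<integral>u. indicator {a<..a + \<delta>} (a + \<delta> * u) *\<^sub>R kern (a + \<delta> * u) ?y \<partial>lborel)
    = (\<integral>u. \<delta> powr (- \<alpha> * real q) * (indicator {0<..1} u *\<^sub>R kern u x) \<partial>lborel)"
    using \<delta> by (intro Bochner_Integration.integral_cong refl) (auto simp: kern_affine[OF \<delta>] zero_less_mult_iff split: split_indicator)
  also have "\<dots> = \<delta> powr (- \<alpha> * real q) * (\<integral>u. indicator {0<..1} u *\<^sub>R kern u x \<partial>lborel)" by simp
  also have "(\<integral>u. indicator {0<..1} u *\<^sub>R kern u x \<partial>lborel) = F 1 x"
    unfolding F_def set_lebesgue_integral_def
    by (rule integral_cong_AE) (use AE_lborel_singleton[of "0::real"] in \<open>auto split: split_indicator elim!: eventually_mono\<close>)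
  also have "\<delta> * (\<delta> powr (- \<alpha> * real q) * F 1 x) = \<delta> powr (1 - \<alpha> * real q) * F 1 x"
    using \<delta> by (simp add: powr_diff powr_minus field_simps)
  also have "1 - \<alpha> * real q = H - real q / 2" using q by (simp add: \<alpha>_def field_simps)
  also have "\<delta> powr (H - real q / 2) = \<delta> powr H * (1 / sqrt \<delta>) ^ q"
    using \<delta> by (simp add: powr_diff powr_half_sqrt[symmetric] power_divide powr_powr flip: powr_realpow)
  finally show ?thesis .
qed

lemma F_1_eq_0: "i < q \<Longrightarrow> 1 < x i \<Longrightarrow> F 1 x = 0"
proof -
  assume i: "i < q" "1 < x i"
  have "kern u x = 0" if "u \<le> 1" for u
    unfolding kern_eq using i that by (auto simp: pos_powr_def intro!: bexI[of _ i])
  then have "(\<lambda>u. indicator {0..1} u *\<^sub>R kern u x) = (\<lambda>u. 0)" by (auto split: split_indicator)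
  then show ?thesis by (simp add: F_def set_lebesgue_integral_def)
qed

lemma kern_upd:
  assumes "i < q"
  shows "kern u (x(i := z)) = pos_powr (u - z) (- \<alpha>) * (d * (\<Prod>j\<in>{..<q} - {i}. pos_powr (u - x j) (- \<alpha>)))"
proof -
  have "(\<Prod>j<q. pos_powr (u - (x(i := z)) j) (- \<alpha>))
    = pos_powr (u - z) (- \<alpha>) * (\<Prod>j\<in>{..<q} - {i}. pos_powr (u - (x(i := z)) j) (- \<alpha>))"
    using assms by (subst prod.remove[of _ i]) auto
  also have "(\<Prod>j\<in>{..<q} - {i}. pos_powr (u - (x(i := z)) j) (- \<alpha>)) = (\<Prod>j\<in>{..<q} - {i}. pos_powr (u - x j) (- \<alpha>))"
    by (intro prod.cong) auto
  finally show ?thesis by (simp add: kern_eq)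
qed

text \<open>
  A coordinate far to the left enters the kernel almost as a constant factor, so the kernel there is
  controlled by its values with that coordinate in a fixed interval.
\<close>

lemma F_1_compare:
  assumes i: "i < q" and z: "z \<le> -1" and w: "w \<in> {-2..-1}"
  shows "F 1 (x(i := z)) \<le> 3 powr \<alpha> * (- z) powr (- \<alpha>) * F 1 (x(i := w))"
proof -
  have a: "0 < \<alpha>" using alpha_bounds by simp
  define R where "R u = d * (\<Prod>j\<in>{..<q} - {i}. pos_powr (u - x j) (- \<alpha>))" for u
  have R: "0 \<le> R u" for u unfolding R_def using d by (intro mult_nonneg_nonneg prod_nonneg) auto
  have kz: "kern u (x(i := z)) = pos_powr (u - z) (- \<alpha>) * R u"
    and kw: "kern u (x(i := w)) = pos_powr (u - w) (- \<alpha>) * R u" for u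
    by (simp_all add: kern_upd[OF i] R_def)
  \<comment> \<open>For u in [0, 1] one has u - z \<ge> - z and u - w \<le> 3, whence the factor 3
    powr \<alpha>.\<close>
  have up: "pos_powr (u - z) (- \<alpha>) \<le> 3 powr \<alpha> * (- z) powr (- \<alpha>) * pos_powr (u - w) (- \<alpha>)" if u: "u \<in> {0..1}" for u
  proof -
    have "pos_powr (u - z) (- \<alpha>) \<le> (- z) powr (- \<alpha>)"
      using pos_powr_antimono[of "- z" "u - z" "- \<alpha>"] z u a by (simp add: pos_powr_def)
    moreover have "3 powr (- \<alpha>) \<le> pos_powr (u - w) (- \<alpha>)"
      using pos_powr_antimono[of "u - w" 3 "- \<alpha>"] w u a by (simp add: pos_powr_def)
    then have "1 \<le> 3 powr \<alpha> * pos_powr (u - w) (- \<alpha>)"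
      by (simp add: powr_minus field_simps)
    ultimately have "pos_powr (u - z) (- \<alpha>) * 1 \<le> (- z) powr (- \<alpha>) * (3 powr \<alpha> * pos_powr (u - w) (- \<alpha>))"
      by (intro mult_mono) auto
    then show ?thesis by (simp add: ac_simps)
  qed
  \<comment> \<open>The reverse comparison, with a factor that depends on z, carries integrability
    from z to w, so that F 1 (x(i := w)) is not merely the default value 0.\<close>
  have down: "pos_powr (u - w) (- \<alpha>) \<le> (1 - z) powr \<alpha> * pos_powr (u - z) (- \<alpha>)" if u: "u \<in> {0..1}" for u
  proof -
    have "pos_powr (u - w) (- \<alpha>) \<le> pos_powr 1 (- \<alpha>)"
      using w u a by (intro pos_powr_antimono) auto
    also have "\<dots> = 1" by (simp add: pos_powr_def)
    also have "1 = (1 - z) powr \<alpha> * pos_powr (1 - z) (- \<alpha>)"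
      using z by (simp add: pos_powr_def powr_add[symmetric])
    also have "\<dots> \<le> (1 - z) powr \<alpha> * pos_powr (u - z) (- \<alpha>)"
      using z u a by (intro mult_left_mono pos_powr_antimono) auto
    finally show ?thesis .
  qed
  show ?thesis
  proof (cases "set_integrable lborel {0..1} (\<lambda>u. kern u (x(i := z)))")
    case True
    have "set_integrable lborel {0..1} (\<lambda>u. (1 - z) powr \<alpha> * kern u (x(i := z)))" using True by simp
    then have W: "set_integrable lborel {0..1} (\<lambda>u. kern u (x(i := w)))"
      unfolding set_integrable_def
    proof (rule Bochner_Integration.integrable_bound)
      show "AE u in lborel. norm (indicator {0..1} u *\<^sub>R kern u (x(i := w)))
          \<le> norm (indicator {0..1} u *\<^sub>R ((1 - z) powr \<alpha> * kern u (x(i := z))))"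
      proof (rule AE_I2)
        fix u :: real
        have "kern u (x(i := w)) \<le> (1 - z) powr \<alpha> * kern u (x(i := z))" if "u \<in> {0..1}"
          using mult_right_mono[OF down[OF that] R[of u]] by (simp add: kz kw ac_simps)
        then show "norm (indicator {0..1} u *\<^sub>R kern u (x(i := w)))
          \<le> norm (indicator {0..1} u *\<^sub>R ((1 - z) powr \<alpha> * kern u (x(i := z))))"
          using kern_nonneg by (auto split: split_indicator)
      qed
    qed measurable
    have "F 1 (x(i := z)) \<le> (LBINT u:{0..1}. 3 powr \<alpha> * (- z) powr (- \<alpha>) * kern u (x(i := w)))"
      unfolding F_def
    proof (rule set_integral_mono[OF True])
      show "set_integrable lborel {0..1} (\<lambda>u. 3 powr \<alpha> * (- z) powr (- \<alpha>) * kern u (x(i := w)))" using W by simp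
      show "kern u (x(i := z)) \<le> 3 powr \<alpha> * (- z) powr (- \<alpha>) * kern u (x(i := w))" if "u \<in> {0..1}" for u
        using mult_right_mono[OF up[OF that] R[of u]] by (simp add: kz kw ac_simps)
    qed
    then show ?thesis by (simp add: F_def)
  next
    case False
    \<comment> \<open>A divergent integral has the default value 0, which makes the claim
      trivial.\<close>
    then have "F 1 (x(i := z)) = 0"
      unfolding F_def set_lebesgue_integral_def set_integrable_def by (rule not_integrable_integral_eq)
    then show ?thesis using F_nonneg[of 1 "x(i := w)"] by simp
  qed
qed

lemma powr_tail_measurable:
  "(\<lambda>z. ennreal ((- z) powr (- 2 * \<alpha>)) * indicator {..- T} z) \<in> borel_measurable lborel"
  by measurable

lemma nn_integral_powr_tail:
  assumes T: "0 < T"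
  shows "(\<integral>\<^sup>+z. ennreal ((- z) powr (- 2 * \<alpha>)) * indicator {..- T} z \<partial>lborel) = ennreal (T powr (1 - 2 * \<alpha>) / (2 * \<alpha> - 1))"
proof -
  have a: "0 < 2 * \<alpha> - 1" using alpha_bounds by simp
  have "(\<integral>\<^sup>+z. ennreal ((- z) powr (- 2 * \<alpha>)) * indicator {..- T} z \<partial>lborel)
    = (\<integral>\<^sup>+z. ennreal (z powr (- 2 * \<alpha>)) * indicator {T..} z \<partial>lborel)"
    by (subst nn_integral_real_affine[where c="-1" and t=0]) (auto intro!: nn_integral_cong split: split_indicator)
  also have "\<dots> = ennreal (0 - (- (T powr (1 - 2 * \<alpha>) / (2 * \<alpha> - 1))))"
  proof (rule nn_integral_FTC_atLeast[where F="\<lambda>z. - (z powr (1 - 2 * \<alpha>) / (2 * \<alpha> - 1))"])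
    fix z assume z: "T \<le> z"
    have "((\<lambda>z. - (z powr (1 - 2 * \<alpha>) / (2 * \<alpha> - 1))) has_real_derivative
        - ((1 - 2 * \<alpha>) * z powr (1 - 2 * \<alpha> - 1) / (2 * \<alpha> - 1))) (at z)"
      using z T by (intro DERIV_minus DERIV_cdivide has_real_derivative_powr) auto
    moreover have "- ((1 - 2 * \<alpha>) * z powr (1 - 2 * \<alpha> - 1) / (2 * \<alpha> - 1)) = z powr (- 2 * \<alpha>)"
      using a by (simp add: field_simps)
    ultimately show "((\<lambda>z. - (z powr (1 - 2 * \<alpha>) / (2 * \<alpha> - 1))) has_real_derivative z powr (- 2 * \<alpha>)) (at z)"
      by simp
  next
    have "((\<lambda>z. z powr (1 - 2 * \<alpha>)) \<longlongrightarrow> 0) at_top"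
      by (rule tendsto_neg_powr) (use a in \<open>auto intro: filterlim_ident\<close>)
    then have "((\<lambda>z. - (z powr (1 - 2 * \<alpha>) / (2 * \<alpha> - 1))) \<longlongrightarrow> - (0 / (2 * \<alpha> - 1))) at_top"
      by (intro tendsto_intros) (use a in auto)
    then show "((\<lambda>z. - (z powr (1 - 2 * \<alpha>) / (2 * \<alpha> - 1))) \<longlongrightarrow> 0) at_top" by simp
  qed auto
  finally show ?thesis by simp
qed

text \<open>The bound of \<open>F_1_compare\<close> is squared, integrated in w over an interval and
  then in z over the tail, all in the single coordinate i. Squaring gives 9 powr \<alpha>, the
  integral in z gives the power of T, and the integral in w is at most the full one.\<close>

lemma F_1_tail_coordinate:
  assumes i: "i < q" and T: "1 \<le> T" and m[measurable]: "F 1 \<in> borel_measurable (leb q)"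
  shows "l2 (leb q) (\<lambda>x. F 1 x * of_bool (x i \<le> - T))
    \<le> ennreal (9 powr \<alpha> * T powr (1 - 2 * \<alpha>) / (2 * \<alpha> - 1)) * l2 (leb q) (F 1)"
proof -
  interpret product_sigma_finite "\<lambda>_::nat. lborel :: real measure" by standard
  have a: "0 < 2 * \<alpha> - 1" using alpha_bounds by simp
  let ?I = "{..<q} - {i}"
  have I: "insert i ?I = {..<q}" using i by auto
  have [measurable]: "(\<lambda>x. x i) \<in> borel_measurable (leb q)"
    using i by (auto intro!: measurable_component_singleton[of _ "{..<q}" "\<lambda>_. lborel :: real measure", simplified])
  let ?h = "\<lambda>x. ennreal ((F 1 x * of_bool (x i \<le> - T))\<^sup>2)"
  have "(\<lambda>x. F 1 x * of_bool (x i \<le> - T)) \<in> borel_measurable (leb q)"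
    unfolding of_bool_def by measurable
  then have hm: "?h \<in> borel_measurable (Pi\<^sub>M (insert i ?I) (\<lambda>_. lborel))"
    unfolding I by measurable
  have gm: "(\<lambda>x. ennreal ((F 1 x)\<^sup>2)) \<in> borel_measurable (Pi\<^sub>M (insert i ?I) (\<lambda>_. lborel))"
    unfolding I by measurable
  let ?G = "\<lambda>x. \<integral>\<^sup>+w. ennreal ((F 1 (x(i := w)))\<^sup>2) \<partial>lborel"
  have upd: "(\<lambda>(x, y). x(i := y)) \<in> measurable (Pi\<^sub>M ?I (\<lambda>_. lborel) \<Otimes>\<^sub>M lborel) (Pi\<^sub>M (insert i ?I) (\<lambda>_. lborel :: real measure))"
    by (rule measurable_add_dim)
  have pm: "(\<lambda>(x, y). ennreal ((F 1 (x(i := y)))\<^sup>2)) \<in> borel_measurable (Pi\<^sub>M ?I (\<lambda>_. lborel) \<Otimes>\<^sub>M lborel)"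
    using measurable_compose[OF upd gm] by (simp only: case_prod_unfold)
  have Gm: "?G \<in> borel_measurable (Pi\<^sub>M ?I (\<lambda>_. lborel))"
    using lborel.borel_measurable_nn_integral[OF pm] by simp
  have inner: "(\<integral>\<^sup>+z. ?h (x(i := z)) \<partial>lborel) \<le> ennreal (9 powr \<alpha> * T powr (1 - 2 * \<alpha>) / (2 * \<alpha> - 1)) * ?G x"
    if x: "x \<in> space (Pi\<^sub>M ?I (\<lambda>_. lborel :: real measure))" for x
  proof -
    have Fm: "(\<lambda>w. ennreal ((F 1 (x(i := w)))\<^sup>2)) \<in> borel_measurable lborel"
      using measurable_compose[OF measurable_Pair1'[OF x] pm] by simp
    have sq: "ennreal ((F 1 (x(i := z)))\<^sup>2) \<le> ennreal (9 powr \<alpha> * (- z) powr (- 2 * \<alpha>)) * ?G x" if z: "z \<le> - T" for z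
    proof -
      let ?c = "9 powr \<alpha> * (- z) powr (- 2 * \<alpha>)"
      have pt: "(F 1 (x(i := z)))\<^sup>2 \<le> ?c * (F 1 (x(i := w)))\<^sup>2" if "w \<in> {-2..-1}" for w
      proof -
        have "(F 1 (x(i := z)))\<^sup>2 \<le> (3 powr \<alpha> * (- z) powr (- \<alpha>) * F 1 (x(i := w)))\<^sup>2"
          using z T by (intro power_mono F_1_compare[OF i] that F_nonneg) auto
        also have "\<dots> = ?c * (F 1 (x(i := w)))\<^sup>2"
        proof -
          have "(3 powr \<alpha>)\<^sup>2 = 9 powr \<alpha>" by (simp add: power2_eq_square powr_mult[symmetric])
          moreover have "((- z) powr (- \<alpha>))\<^sup>2 = (- z) powr (- 2 * \<alpha>)"
            by (simp add: power2_eq_square powr_add[symmetric])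
          ultimately show ?thesis by (simp add: power_mult_distrib)
        qed
        finally show ?thesis .
      qed
      \<comment> \<open>The interval [-2, -1] has length 1, so a constant equals its integral over
        it and the pointwise bound can be integrated in w.\<close>
      have "ennreal ((F 1 (x(i := z)))\<^sup>2) = (\<integral>\<^sup>+w. ennreal ((F 1 (x(i := z)))\<^sup>2) * indicator {-2..-1::real} w \<partial>lborel)"
        by (subst nn_integral_cmult) auto
      also have "\<dots> \<le> (\<integral>\<^sup>+w. ennreal ?c * ennreal ((F 1 (x(i := w)))\<^sup>2) \<partial>lborel)"
        using pt by (intro nn_integral_mono) (auto simp: ennreal_mult[symmetric] intro!: ennreal_leI split: split_indicator)
      also have "\<dots> = ennreal ?c * ?G x" using Fm by (rule nn_integral_cmult)
      finally show ?thesis .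
    qed
    have "(\<integral>\<^sup>+z. ?h (x(i := z)) \<partial>lborel)
      \<le> (\<integral>\<^sup>+z. (ennreal (9 powr \<alpha>) * ?G x) * (ennreal ((- z) powr (- 2 * \<alpha>)) * indicator {..- T} z) \<partial>lborel)"
      using sq by (intro nn_integral_mono) (auto simp: ennreal_mult ac_simps split: split_indicator)
    also have "\<dots> = (ennreal (9 powr \<alpha>) * ?G x) * ennreal (T powr (1 - 2 * \<alpha>) / (2 * \<alpha> - 1))"
    proof -
      have "0 < T" using T by simp
      show ?thesis unfolding nn_integral_powr_tail[OF \<open>0 < T\<close>, symmetric]
        by (rule nn_integral_cmult[OF powr_tail_measurable])
    qed
    also have "\<dots> = ennreal (9 powr \<alpha> * T powr (1 - 2 * \<alpha>) / (2 * \<alpha> - 1)) * ?G x"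
    proof -
      have "ennreal (9 powr \<alpha> * T powr (1 - 2 * \<alpha>) / (2 * \<alpha> - 1)) = ennreal (9 powr \<alpha>) * ennreal (T powr (1 - 2 * \<alpha>) / (2 * \<alpha> - 1))"
        using a by (subst ennreal_mult[symmetric]) auto
      then show ?thesis by (simp only: ac_simps)
    qed
    finally show ?thesis .
  qed
  have "l2 (leb q) (\<lambda>x. F 1 x * of_bool (x i \<le> - T)) = (\<integral>\<^sup>+x. \<integral>\<^sup>+z. ?h (x(i := z)) \<partial>lborel \<partial>Pi\<^sub>M ?I (\<lambda>_. lborel))"
    using product_nn_integral_insert[OF _ _ hm] I by (simp add: l2_def)
  also have "\<dots> \<le> (\<integral>\<^sup>+x. ennreal (9 powr \<alpha> * T powr (1 - 2 * \<alpha>) / (2 * \<alpha> - 1)) * ?G x \<partial>Pi\<^sub>M ?I (\<lambda>_. lborel))"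
    by (rule nn_integral_mono) (rule inner)
  also have "\<dots> = ennreal (9 powr \<alpha> * T powr (1 - 2 * \<alpha>) / (2 * \<alpha> - 1)) * (\<integral>\<^sup>+x. ?G x \<partial>Pi\<^sub>M ?I (\<lambda>_. lborel))"
    by (rule nn_integral_cmult[OF Gm])
  also have "(\<integral>\<^sup>+x. ?G x \<partial>Pi\<^sub>M ?I (\<lambda>_. lborel)) = l2 (leb q) (F 1)"
    using product_nn_integral_insert[OF _ _ gm] I by (simp add: l2_def)
  finally show ?thesis .
qed

text \<open>A coordinate above 1 makes F 1 vanish, so leaving the cube means that some coordinate is
  at most - T; summing over the coordinates costs the factor q.\<close>

lemma F_1_tail:
  assumes T: "1 \<le> T" and m: "F 1 \<in> borel_measurable (leb q)"
  shows "l2 (leb q) (\<lambda>x. F 1 x * of_bool (\<not> (\<forall>i<q. x i \<in> {- T<..1})))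
    \<le> ennreal (real q * (9 powr \<alpha> * T powr (1 - 2 * \<alpha>) / (2 * \<alpha> - 1))) * l2 (leb q) (F 1)"
proof -
  have a: "0 < 2 * \<alpha> - 1" using alpha_bounds by simp
  let ?c = "9 powr \<alpha> * T powr (1 - 2 * \<alpha>) / (2 * \<alpha> - 1)"
  note [measurable] = m
  have [measurable]: "(\<lambda>x. F 1 x * of_bool (x i \<le> - T)) \<in> borel_measurable (leb q)" if "i < q" for i
  proof -
    have [measurable]: "(\<lambda>x. x i) \<in> borel_measurable (leb q)"
      using that by (auto intro!: measurable_component_singleton[of _ "{..<q}" "\<lambda>_. lborel :: real measure", simplified])
    show ?thesis unfolding of_bool_def by measurable
  qed
  have "l2 (leb q) (\<lambda>x. F 1 x * of_bool (\<not> (\<forall>i<q. x i \<in> {- T<..1})))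
    \<le> (\<integral>\<^sup>+x. (\<Sum>i<q. ennreal ((F 1 x * of_bool (x i \<le> - T))\<^sup>2)) \<partial>leb q)"
    unfolding l2_def
  proof (rule nn_integral_mono)
    fix x :: "nat \<Rightarrow> real"
    show "ennreal ((F 1 x * of_bool (\<not> (\<forall>i<q. x i \<in> {- T<..1})))\<^sup>2)
      \<le> (\<Sum>i<q. ennreal ((F 1 x * of_bool (x i \<le> - T))\<^sup>2))"
    proof (cases "\<exists>i<q. x i \<le> - T")
      case True
      then obtain i where i: "i < q" "x i \<le> - T" by auto
      have "ennreal ((F 1 x * of_bool (\<not> (\<forall>i<q. x i \<in> {- T<..1})))\<^sup>2) \<le> ennreal ((F 1 x * of_bool (x i \<le> - T))\<^sup>2)"
        using i by (intro ennreal_leI) auto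
      also have "\<dots> \<le> (\<Sum>i<q. ennreal ((F 1 x * of_bool (x i \<le> - T))\<^sup>2))"
        using i by (intro member_le_sum) auto
      finally show ?thesis .
    next
      case False
      then have "F 1 x * of_bool (\<not> (\<forall>i<q. x i \<in> {- T<..1})) = 0"
        using F_1_eq_0[of _ x] by (auto simp: not_le)
      then show ?thesis by (simp only: power_zero_numeral ennreal_0 zero_le)
    qed
  qed
  also have "\<dots> = (\<Sum>i<q. l2 (leb q) (\<lambda>x. F 1 x * of_bool (x i \<le> - T)))"
    unfolding l2_def by (rule nn_integral_sum) auto
  also have "\<dots> \<le> (\<Sum>i<q. ennreal ?c * l2 (leb q) (F 1))"
    by (intro sum_mono F_1_tail_coordinate T m) auto
  also have "\<dots> = ennreal (real q * ?c) * l2 (leb q) (F 1)"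
  proof -
    have "ennreal (real q * ?c) = ennreal (real q) * ennreal ?c" using a by (intro ennreal_mult) auto
    then show ?thesis by (simp only: sum_constant card_lessThan ennreal_of_nat_eq_real_of_nat mult.assoc)
  qed
  finally show ?thesis .
qed

end

section \<open>Increments of the Hermite process\<close>

lemma scale_exp_le: "real (scale_exp \<gamma> N) \<le> real N powr \<gamma>"
  unfolding scale_exp_def by simp

lemma scale_exp_ge: "real N powr \<gamma> - 1 \<le> real (scale_exp \<gamma> N)"
  unfolding scale_exp_def by simp

text \<open>With k the scale exponent and n = 2^k, the target 1 / n^2 is the squared L2 accuracy
  required of each increment. In logarithms it follows from (2 + \<beta>) k + \<beta> + log c \<le>
  \<beta> N, which holds for large N because k \<le> N powr \<gamma> with \<gamma> < 1.\<close>

lemma eventually_scale_small: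
  fixes \<gamma> \<beta> c :: real
  assumes \<gamma>: "0 < \<gamma>" "\<gamma> < 1" and \<beta>: "0 < \<beta>" and c: "0 < c"
  shows "\<forall>\<^sub>F N in sequentially. scale_exp \<gamma> N + 1 \<le> N
    \<and> c * (2 ^ (N - scale_exp \<gamma> N) - 1) powr (- \<beta>) \<le> 1 / (2 ^ scale_exp \<gamma> N)\<^sup>2"
proof -
  have "(\<lambda>N. real N powr (\<gamma> - 1)) \<longlonglongrightarrow> 0"
    by (rule tendsto_neg_powr) (use \<gamma> filterlim_real_sequentially in auto)
  then have "(\<lambda>N. (2 + \<beta>) * real N powr (\<gamma> - 1) + (\<beta> + log 2 c) * (1 / real N)) \<longlonglongrightarrow> (2 + \<beta>) * 0 + (\<beta> + log 2 c) * 0"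
    by (intro tendsto_intros lim_1_over_n)
  then have "\<forall>\<^sub>F N in sequentially. (2 + \<beta>) * real N powr (\<gamma> - 1) + (\<beta> + log 2 c) * (1 / real N) < \<beta>"
    by (rule order_tendstoD(2)) (use \<beta> in simp)
  moreover have "(\<lambda>N. real N powr (\<gamma> - 1) + 1 / real N) \<longlonglongrightarrow> 0 + 0"
    using \<open>(\<lambda>N. real N powr (\<gamma> - 1)) \<longlonglongrightarrow> 0\<close> by (intro tendsto_intros lim_1_over_n)
  then have "\<forall>\<^sub>F N in sequentially. real N powr (\<gamma> - 1) + 1 / real N < 1"
    by (rule order_tendstoD(2)) simp
  ultimately show ?thesis
    using eventually_gt_at_top[of 0]
  proof eventually_elim
    case (elim N)
    let ?k = "scale_exp \<gamma> N" and ?r = "real N powr \<gamma>"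
    have N: "0 < real N" using elim(3) by simp
    have r: "real N powr (\<gamma> - 1) = ?r / real N" using N by (simp add: powr_diff)
    have "?r + 1 < real N" using elim(2) N by (simp add: r field_simps)
    then have kN: "?k + 1 \<le> N" using scale_exp_le[of \<gamma> N] by linarith
    have big: "(2 + \<beta>) * ?r + \<beta> + log 2 c < \<beta> * real N"
    proof -
      have "((2 + \<beta>) * ?r + \<beta> + log 2 c) / real N = (2 + \<beta>) * (?r / real N) + (\<beta> + log 2 c) * (1 / real N)"
        by (simp add: add_divide_distrib)
      also have "\<dots> < \<beta>" using elim(1) by (simp only: r)
      finally show ?thesis using N by (simp only: pos_divide_less_eq)
    qed
    have "(2 + \<beta>) * real ?k \<le> (2 + \<beta>) * ?r" using scale_exp_le[of \<gamma> N] \<beta> by (intro mult_left_mono) auto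
    then have exp: "log 2 c - \<beta> * (real N - real ?k - 1) \<le> - 2 * real ?k"
      using big by (simp add: algebra_simps)
    \<comment> \<open>Giving up one factor 2 absorbs the subtracted 1; this is the origin of the
      isolated \<beta> in \<open>big\<close>.\<close>
    have T: "2 powr (real N - real ?k - 1) \<le> 2 ^ (N - ?k) - 1"
    proof -
      obtain j where j: "N = ?k + Suc j" using kN by (metis Suc_eq_plus1 add.assoc le_iff_add add.commute)
      have "real N - real ?k - 1 = real j" using j by linarith
      moreover have "N - ?k = Suc j" using j by linarith
      moreover have "(1::real) \<le> 2 ^ j" by simp
      ultimately show ?thesis by (simp add: powr_realpow)
    qed
    have "c * (2 ^ (N - ?k) - 1) powr (- \<beta>) \<le> 2 powr (log 2 c) * (2 powr (real N - real ?k - 1)) powr (- \<beta>)"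
      using c \<beta> T by (intro mult_mono powr_mono2') auto
    also have "\<dots> = 2 powr (log 2 c - \<beta> * (real N - real ?k - 1))"
      by (simp add: powr_powr powr_add[symmetric] mult.commute)
    also have "\<dots> \<le> 2 powr (- 2 * real ?k)" using exp by simp
    also have "\<dots> = 1 / (2 ^ ?k)\<^sup>2"
      by (simp add: powr_minus powr_realpow[symmetric] powr_powr divide_inverse power2_eq_square powr_add[symmetric])
    finally show ?case using kN by simp
  qed
qed

lemma leb_box_pred:
  "Measurable.pred (leb q) (\<lambda>x. \<forall>i<q. x i \<in> {a<..b})" for a b :: real
proof -
  have "(\<lambda>x. x i) \<in> borel_measurable (leb q)" if "i < q" for i
    using that by (auto intro!: measurable_component_singleton[of _ "{..<q}" "\<lambda>_. lborel :: real measure", simplified])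
  then have "{x \<in> space (leb q). x i \<in> {a<..b}} \<in> sets (leb q)" if "i < q" for i
    using measurable_sets[of "\<lambda>x. x i" "leb q" borel "{a<..b}"] that
    by (simp add: vimage_def Int_def conj_commute)
  then have "{x \<in> space (leb q). \<forall>i\<in>{..<q}. x i \<in> {a<..b}} \<in> sets (leb q)"
    by (intro sets.sets_Collect_finite_All) auto
  then show ?thesis by (simp add: pred_def Ball_def)
qed

locale hermite = brownian M B + hermite_kernel_params d q H
  for M :: "'a measure" and B d q H +
  fixes Z :: "real \<Rightarrow> 'a \<Rightarrow> real"
  assumes Z_integral: "\<And>t. 0 \<le> t \<Longrightarrow>
    is_multiple_wiener_integral M B q (\<lambda>y. LBINT u:{0..t}. hermite_kernel d q H u y) (Z t)"
begin

lemma Z_approx: "0 \<le> t \<Longrightarrow> wiener_approx q (F t) (Z t)"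
  using wiener_approx_if_multiple_wiener_integral[OF Z_integral] by (simp add: F_def [abs_def])

definition incr :: "real \<Rightarrow> real \<Rightarrow> 'a \<Rightarrow> real" where
  "incr a \<delta> \<omega> = \<delta> powr (- H) * (Z (a + \<delta>) \<omega> - Z a \<omega>)"

definition incr_kernel :: "real \<Rightarrow> real \<Rightarrow> (nat \<Rightarrow> real) \<Rightarrow> real" where
  "incr_kernel a \<delta> y = \<delta> powr (- H) * (F (a + \<delta>) y - F a y)"

context
  fixes a \<delta> :: real
  assumes a: "0 \<le> a" and \<delta>: "0 < \<delta>"
begin

lemma incr_approx: "wiener_approx q (incr_kernel a \<delta>) (incr a \<delta>)"
  unfolding incr_kernel_def [abs_def] incr_def [abs_def]
  using a \<delta> by (intro wiener_approx_cmult wiener_approx_diff Z_approx) auto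

lemma incr_kernel_affine:
  "AE x in leb q. incr_kernel a \<delta> (\<lambda>i\<in>{..<q}. a + \<delta> * x i) = (1 / sqrt \<delta>) ^ q * F 1 x"
  using AE_leb_distinct
proof eventually_elim
  case (elim x)
  show ?case
    unfolding incr_kernel_def F_increment_affine[OF \<delta> a elim] using \<delta> by (simp add: powr_minus)
qed

text \<open>Stationary increments and self-similarity, at the level of moments; the normalization in
  \<open>incr\<close> leaves exactly the isometric factor in the kernel.\<close>

lemma incr_moment: "1 \<le> p \<Longrightarrow> expectation (\<lambda>\<omega>. incr a \<delta> \<omega> ^ p) = expectation (\<lambda>\<omega>. Z 1 \<omega> ^ p)"
  by (rule wiener_approx_scaled_expectation[OF Z_approx incr_approx \<delta> _ incr_kernel_affine]) auto

lemma incr_l2: "l2 (leb q) (incr_kernel a \<delta>) = l2 (leb q) (F 1)"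
  by (rule l2_affine[OF \<delta> _ _ incr_kernel_affine])
     (use wiener_approx_measurable(1)[OF incr_approx] wiener_approx_measurable(1)[OF Z_approx[of 1]] in auto)

text \<open>The substitution x -> a + \<delta> x carries (-T, 1] to (a - \<delta> T, a + \<delta>],
  so all increments have the truncation error of F 1.\<close>

lemma incr_tail:
  assumes T: "1 \<le> T"
  shows "l2 (leb q) (\<lambda>y. incr_kernel a \<delta> y * of_bool (\<not> (\<forall>i<q. y i \<in> {a - \<delta> * T<..a + \<delta>})))
    \<le> ennreal (real q * (9 powr \<alpha> * T powr (1 - 2 * \<alpha>) / (2 * \<alpha> - 1))) * l2 (leb q) (F 1)"
proof -
  have m1[measurable]: "F 1 \<in> borel_measurable (leb q)" by (rule wiener_approx_measurable(1)[OF Z_approx]) simp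
  note [measurable] = wiener_approx_measurable(1)[OF incr_approx] leb_box_pred
  have "l2 (leb q) (\<lambda>y. incr_kernel a \<delta> y * of_bool (\<not> (\<forall>i<q. y i \<in> {a - \<delta> * T<..a + \<delta>})))
    = l2 (leb q) (\<lambda>x. F 1 x * of_bool (\<not> (\<forall>i<q. x i \<in> {- T<..1})))"
  proof (rule l2_affine[OF \<delta>, where b=a])
    have iff: "(\<lambda>i\<in>{..<q}. a + \<delta> * x i) i \<in> {a - \<delta> * T<..a + \<delta>} \<longleftrightarrow> x i \<in> {- T<..1}" if "i < q" for i x
    proof -
      have "a - \<delta> * T < a + \<delta> * x i \<longleftrightarrow> \<delta> * (- T) < \<delta> * x i" by auto
      also have "\<dots> \<longleftrightarrow> - T < x i" using \<delta> by (simp only: mult_less_cancel_left_pos)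
      finally show ?thesis using that \<delta> by auto
    qed
    show "AE x in leb q. incr_kernel a \<delta> (\<lambda>i\<in>{..<q}. a + \<delta> * x i)
          * of_bool (\<not> (\<forall>i<q. (\<lambda>i\<in>{..<q}. a + \<delta> * x i) i \<in> {a - \<delta> * T<..a + \<delta>}))
        = (1 / sqrt \<delta>) ^ q * (F 1 x * of_bool (\<not> (\<forall>i<q. x i \<in> {- T<..1})))"
      using incr_kernel_affine
    proof eventually_elim
      case (elim x)
      have "(\<forall>i<q. (\<lambda>i\<in>{..<q}. a + \<delta> * x i) i \<in> {a - \<delta> * T<..a + \<delta>}) \<longleftrightarrow> (\<forall>i<q. x i \<in> {- T<..1})"
        using iff by blast
      then show ?case unfolding elim by (simp only: mult.assoc)
    qed
    show "(\<lambda>y. incr_kernel a \<delta> y * of_bool (\<not> (\<forall>i<q. y i \<in> {a - \<delta> * T<..a + \<delta>}))) \<in> borel_measurable (leb q)"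
      "(\<lambda>x. F 1 x * of_bool (\<not> (\<forall>i<q. x i \<in> {- T<..1}))) \<in> borel_measurable (leb q)"
      unfolding of_bool_def by measurable
  qed
  also have "\<dots> \<le> ennreal (real q * (9 powr \<alpha> * T powr (1 - 2 * \<alpha>) / (2 * \<alpha> - 1))) * l2 (leb q) (F 1)"
    by (rule F_1_tail[OF T m1])
  finally show ?thesis .
qed

end

lemma Z_all_moments: "0 \<le> t \<Longrightarrow> all_moments M (Z t)"
proof -
  assume t: "0 \<le> t"
  have "l2 (leb q) (F t) \<le> ennreal (enn2real (l2 (leb q) (F t)))"
    using wiener_approx_l2_finite[OF Z_approx[OF t]] by (simp add: ennreal_enn2real)
  then show ?thesis by (rule wiener_approx_moment_le(1)[OF Z_approx[OF t]]) simp
qed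

lemma power_variation_all_moments: "all_moments M (power_variation M Z H \<gamma> p N)"
  unfolding power_variation_def [abs_def] hermite_increment_def
  by (intro all_moments_intros Z_all_moments) auto

text \<open>Moving the factor 2 powr (p * H * N) into the increments exhibits the power variation as
  a normalized sum of centered p-th powers, the form in which \<open>clt_rate\<close> can be
  used.\<close>

lemma power_variation_eq:
  fixes \<gamma> p N
  defines "n \<equiv> (2::nat) ^ scale_exp \<gamma> N"
  shows "power_variation M Z H \<gamma> p N \<omega>
    = (\<Sum>l=1..n. incr (real l / n) (1 / 2 ^ N) \<omega> ^ p - expectation (\<lambda>\<omega>. Z 1 \<omega> ^ p)) / sqrt n"
proof -
  have n: "0 < real n" "real n = 2 ^ scale_exp \<gamma> N" by (simp_all add: n_def)
  have "incr (real l / n) (1 / 2 ^ N) \<omega> ^ p = 2 powr (real p * H * real N) * hermite_increment Z \<gamma> l N \<omega> ^ p" for l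
  proof -
    have "(1 / 2 ^ N) powr (- H) = 2 powr (H * real N)"
    proof -
      have "(1 / 2 ^ N :: real) = 2 powr (- real N)" by (simp add: powr_minus powr_realpow divide_inverse)
      then show ?thesis by (simp add: powr_powr mult.commute)
    qed
    moreover have "(2 powr (H * real N)) ^ p = 2 powr (real p * H * real N)"
      by (subst powr_realpow[symmetric]) (simp_all add: powr_powr mult_ac)
    ultimately show ?thesis by (simp add: incr_def hermite_increment_def power_mult_distrib n)
  qed
  then have "(\<Sum>l=1..n. incr (real l / n) (1 / 2 ^ N) \<omega> ^ p - expectation (\<lambda>\<omega>. Z 1 \<omega> ^ p))
    = 2 powr (real p * H * real N) * (\<Sum>l=1..n. hermite_increment Z \<gamma> l N \<omega> ^ p) - real n * expectation (\<lambda>\<omega>. Z 1 \<omega> ^ p)"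
    by (simp add: sum_subtractf sum_distrib_left)
  moreover have "sqrt n * (A / n * S - e) = (A * S - n * e) / sqrt n" for A S e :: real
  proof -
    have "sqrt n * (A / n * S - e) = (sqrt n * sqrt n) * (A / n * S - e) / sqrt n"
      using n by (simp del: real_sqrt_mult_self)
    also have "\<dots> = (A * S - n * e) / sqrt n" using n by (simp add: field_simps)
    finally show ?thesis .
  qed
  moreover have "{1..2 ^ scale_exp \<gamma> N} = {1..n}" by (simp add: n_def)
  ultimately show ?thesis unfolding power_variation_def by (simp only: n(2)[symmetric])
qed

section \<open>The rate for Lipschitz test functions\<close>

text \<open>Three errors of order 1 / sqrt n add up, n = 2^k: passing to powers of independent
  approximants, exchanging \<mu> for their means, and the central limit theorem. The quantifier over
  g stands inside \<open>eventually\<close>, so one threshold in N serves the whole supremum of the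
  Wasserstein distance.\<close>

lemma power_variation_rate:
  assumes \<gamma>: "0 < \<gamma>" "\<gamma> < 1" and p: "1 \<le> p"
  shows "\<exists>C>0. \<forall>\<^sub>F N in sequentially. \<forall>g. 1-lipschitz_on UNIV g \<longrightarrow>
    \<bar>expectation (\<lambda>\<omega>. g (power_variation M Z H \<gamma> p N \<omega>))
      - (\<integral>x. g (sqrt (variance (\<lambda>\<omega>. Z 1 \<omega> ^ p)) * x) \<partial>std_normal_distribution)\<bar>
    \<le> C * 2 powr (- (real N powr \<gamma> / 2))"
proof -
  define \<mu> where "\<mu> = expectation (\<lambda>\<omega>. Z 1 \<omega> ^ p)"
  define \<mu>2 where "\<mu>2 = expectation (\<lambda>\<omega>. Z 1 \<omega> ^ (2 * p))"
  define m where "m = variance (\<lambda>\<omega>. Z 1 \<omega> ^ p)"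
  have m_eq: "m = \<mu>2 - \<mu>\<^sup>2"
  proof -
    have "m = expectation (\<lambda>\<omega>. (Z 1 \<omega> ^ p)\<^sup>2) - \<mu>\<^sup>2"
      unfolding m_def \<mu>_def
      by (intro variance_eq all_moments_integrable all_moments_intros Z_all_moments) auto
    then show ?thesis by (simp add: \<mu>2_def power_mult[symmetric] mult.commute)
  qed
  define A where "A = enn2real (l2 (leb q) (F 1))"
  have A: "0 \<le> A" "l2 (leb q) (F 1) = ennreal A"
    using wiener_approx_l2_finite[OF Z_approx[of 1]] by (auto simp: A_def ennreal_enn2real)
  define K where "K p = real p * (2 ^ p * sqrt ((chaos_const q (p - 1) * (2 * A + 2)) ^ (p - 1))) * sqrt (4 * chaos_const q 1)" for p
  have K: "0 \<le> K p" for p unfolding K_def using chaos_const_nonneg[of q "p-1"] chaos_const_nonneg[of q 1] A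
    by (intro mult_nonneg_nonneg) auto
  define M3 where "M3 = (chaos_const q (3 * p) * (2 * A + 2)) ^ (3 * p)"
  have M3: "0 \<le> M3" unfolding M3_def using chaos_const_nonneg[of q "3 * p"] A by simp
  \<comment> \<open>One number above the three bounds that \<open>clt_rate\<close> asks for: the
    mean, n times the variance defect, and the third absolute moment.\<close>
  define A' where "A' = \<bar>\<mu>\<bar> + K p + (K (2 * p) + K p * (2 * \<bar>\<mu>\<bar> + K p)) + (1 + M3)"
  have A'_ge: "\<bar>\<mu>\<bar> + K p \<le> A'" "K (2 * p) + K p * (2 * \<bar>\<mu>\<bar> + K p) \<le> A'" "1 + M3 \<le> A'"
    unfolding A'_def using M3 K[of p] K[of "2 * p"] by (auto intro!: add_nonneg_nonneg mult_nonneg_nonneg)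
  have "0 \<le> m" unfolding m_def by simp
  from clt_rate[OF this, of A'] obtain C where C: "0 < C" and
    clt: "\<And>(L :: nat set) Y g. finite L \<Longrightarrow> L \<noteq> {} \<Longrightarrow> indep_vars (\<lambda>_. borel) Y L \<Longrightarrow>
      (\<forall>l\<in>L. all_moments M (Y l) \<and> \<bar>expectation (Y l)\<bar> \<le> A'
        \<and> \<bar>variance (Y l) - m\<bar> \<le> A' / card L \<and> expectation (\<lambda>\<omega>. \<bar>Y l \<omega>\<bar> ^ 3) \<le> A') \<Longrightarrow>
      1-lipschitz_on UNIV g \<Longrightarrow>
      \<bar>expectation (\<lambda>\<omega>. g ((\<Sum>l\<in>L. Y l \<omega> - expectation (Y l)) / sqrt (card L)))
        - (\<integral>x. g (sqrt m * x) \<partial>std_normal_distribution)\<bar> \<le> C / sqrt (card L)" by blast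
  define \<beta> where "\<beta> = 2 * \<alpha> - 1"
  have \<beta>: "0 < \<beta>" using alpha_bounds by (simp add: \<beta>_def)
  \<comment> \<open>The factor of \<tau> in the squared L2 error: 1 for the step approximation, the
    rest for the tail of the kernel.\<close>
  define c where "c = 1 + real q * (9 powr \<alpha> / \<beta>) * A"
  have c: "0 < c" unfolding c_def using \<beta> A by (intro add_pos_nonneg mult_nonneg_nonneg) auto
  have rate: "\<bar>expectation (\<lambda>\<omega>. g (power_variation M Z H \<gamma> p N \<omega>)) - (\<integral>x. g (sqrt m * x) \<partial>std_normal_distribution)\<bar>
      \<le> ((2 * K p + C) * sqrt 2) * 2 powr (- (real N powr \<gamma> / 2))"
    if N: "scale_exp \<gamma> N + 1 \<le> N" and small: "c * (2 ^ (N - scale_exp \<gamma> N) - 1) powr (- \<beta>) \<le> 1 / (2 ^ scale_exp \<gamma> N)\<^sup>2"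
      and g: "1-lipschitz_on UNIV g" for N and g :: "real \<Rightarrow> real"
  proof -
    define k where "k = scale_exp \<gamma> N"
    define n where "n = (2::nat) ^ k"
    have n: "1 \<le> real n" "real n = 2 ^ k" by (simp_all add: n_def)
    define \<delta> where "\<delta> = 1 / (2::real) ^ N"
    \<comment> \<open>With this T the left end a l - \<delta> * T of the l-th cut is (l - 1) / n +
      \<delta>, the end of the preceding window.\<close>
    define T where "T = 2 ^ (N - k) - (1::real)"
    define a where "a l = real l / real n" for l :: nat
    have \<delta>: "0 < \<delta>" by (simp add: \<delta>_def)
    have a0: "0 \<le> a l" for l by (simp add: a_def)
    have T: "1 \<le> T"
    proof -
      have "(2::real) ^ 1 \<le> 2 ^ (N - k)" using N by (intro power_increasing) (auto simp: k_def)
      then show ?thesis by (simp add: T_def)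
    qed
    have \<delta>T: "\<delta> * T = 1 / real n - \<delta>"
    proof -
      have "(2::real) ^ N = 2 ^ (N - k) * 2 ^ k" using N by (simp add: k_def flip: power_add)
      then show ?thesis by (simp add: \<delta>_def T_def n field_simps)
    qed
    define L where "L = {1..n}"
    have L: "finite L" "L \<noteq> {}" "card L = n" using n by (auto simp: L_def n_def)
    \<comment> \<open>The accuracy of the step approximation is matched to the order of the
      truncation error.\<close>
    define \<tau> where "\<tau> = T powr (- \<beta>)"
    have \<tau>: "0 < \<tau>" using T by (simp add: \<tau>_def)
    have "\<exists>(n'::nat) t b. strict_mono_on {..n'} t \<and> indep_vars (\<lambda>_. borel) (\<lambda>l. step_integral B q n' t (b l)) L \<and>
      (\<forall>l\<in>L. l2 (leb q) (\<lambda>y. incr_kernel (a l) \<delta> y - step_function q n' t (b l) y)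
         \<le> ennreal \<tau> + l2 (leb q) (\<lambda>y. incr_kernel (a l) \<delta> y
              * of_bool (\<not> (\<forall>i<q. y i \<in> {a l - \<delta> * T<..a l + \<delta>}))))"
    proof (rule independent_step_integrals[OF L(1,2)])
      show "wiener_approx q (incr_kernel (a l) \<delta>) (incr (a l) \<delta>)" for l by (rule incr_approx[OF a0 \<delta>])
      have gap: "a l + \<delta> \<le> a l' - \<delta> * T" if "l < l'" for l l'
      proof -
        have "a l + 1 / real n = real (Suc l) / real n" by (simp add: a_def add_divide_distrib)
        also have "\<dots> \<le> a l'" unfolding a_def using that by (intro divide_right_mono) auto
        finally show ?thesis unfolding \<delta>T by simp
      qed
      show "a l + \<delta> \<le> a l' - \<delta> * T \<or> a l' + \<delta> \<le> a l - \<delta> * T" if "l \<noteq> l'" for l l'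
        using gap[of l l'] gap[of l' l] that by (cases "l < l'") auto
      show "0 < ennreal \<tau>" using \<tau> by simp
    qed
    then obtain n' :: nat and t b where t: "strict_mono_on {..n'} t"
      and ind: "indep_vars (\<lambda>_. borel) (\<lambda>l. step_integral B q n' t (b l)) L"
      and dist: "\<And>l. l \<in> L \<Longrightarrow> l2 (leb q) (\<lambda>y. incr_kernel (a l) \<delta> y - step_function q n' t (b l) y)
         \<le> ennreal \<tau> + l2 (leb q) (\<lambda>y. incr_kernel (a l) \<delta> y
              * of_bool (\<not> (\<forall>i<q. y i \<in> {a l - \<delta> * T<..a l + \<delta>})))" by blast
    define X where "X l = incr (a l) \<delta>" for l
    define S where "S l = step_integral B q n' t (b l)" for l
    define Y where "Y l \<omega> = S l \<omega> ^ p" for l \<omega>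
    have X: "wiener_approx q (incr_kernel (a l) \<delta>) (X l)" for l unfolding X_def by (rule incr_approx[OF a0 \<delta>])
    have Al: "l2 (leb q) (incr_kernel (a l) \<delta>) \<le> ennreal A" for l by (simp add: incr_l2[OF a0 \<delta>] A)
    note amX = wiener_approx_moment_le(1)[OF X Al A(1)]
    have amS: "all_moments M (S l)" for l unfolding S_def by (rule step_integral_all_moments[OF t])
    have amY: "all_moments M (Y l)" for l unfolding Y_def [abs_def] by (intro all_moments_intros amS)
    \<comment> \<open>Summing n errors of size sqrt \<eta> = 1 / n and dividing by sqrt n gives the
      rate.\<close>
    define \<eta> where "\<eta> = 1 / (real n)\<^sup>2"
    have \<eta>: "0 \<le> \<eta>" "\<eta> \<le> 1" "sqrt \<eta> = 1 / real n"
      using n(1) by (auto simp: \<eta>_def real_sqrt_divide divide_le_eq one_le_power)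
    have close: "l2 (leb q) (\<lambda>y. incr_kernel (a l) \<delta> y - step_function q n' t (b l) y) \<le> ennreal \<eta>" if l: "l \<in> L" for l
    proof -
      have "l2 (leb q) (\<lambda>y. incr_kernel (a l) \<delta> y - step_function q n' t (b l) y)
        \<le> ennreal \<tau> + ennreal (real q * (9 powr \<alpha> * T powr (1 - 2 * \<alpha>) / (2 * \<alpha> - 1))) * ennreal A"
        using dist[OF l] incr_tail[OF a0 \<delta> T, of l] unfolding A(2) by (rule order_trans[OF _ add_left_mono])
      also have "\<dots> = ennreal (\<tau> + real q * (9 powr \<alpha> * T powr (1 - 2 * \<alpha>) / (2 * \<alpha> - 1)) * A)"
      proof -
        have "0 \<le> real q * (9 powr \<alpha> * T powr (1 - 2 * \<alpha>) / (2 * \<alpha> - 1))"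
          using \<beta> unfolding \<beta>_def by (intro mult_nonneg_nonneg divide_nonneg_pos) auto
        then show ?thesis using \<tau> A(1) by (simp only: ennreal_plus ennreal_mult mult_nonneg_nonneg less_imp_le)
      qed
      also have "\<tau> + real q * (9 powr \<alpha> * T powr (1 - 2 * \<alpha>) / (2 * \<alpha> - 1)) * A = c * \<tau>"
        by (simp add: c_def \<tau>_def \<beta>_def field_simps)
      also have "c * \<tau> \<le> \<eta>" using small by (simp add: \<tau>_def T_def \<eta>_def n k_def)
      finally show ?thesis by (simp add: ennreal_leI)
    qed
    have diff: "expectation (\<lambda>\<omega>. \<bar>X l \<omega> ^ j - S l \<omega> ^ j\<bar>) \<le> K j / real n" if "l \<in> L" "1 \<le> j" for l j
      using wiener_approx_power_expectation_diff(1)[OF X Al A(1) that(2) t close[OF that(1)] \<eta>(1,2)]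
      unfolding K_def S_def by (simp add: \<eta>(3))
    have diff': "\<bar>expectation (\<lambda>\<omega>. S l \<omega> ^ j) - expectation (\<lambda>\<omega>. Z 1 \<omega> ^ j)\<bar> \<le> K j / real n" if "l \<in> L" "1 \<le> j" for l j
    proof -
      have "expectation (\<lambda>\<omega>. X l \<omega> ^ j) - expectation (\<lambda>\<omega>. S l \<omega> ^ j) = expectation (\<lambda>\<omega>. X l \<omega> ^ j - S l \<omega> ^ j)"
        by (simp add: all_moments_integrable_power amX amS)
      also have "\<bar>\<dots>\<bar> \<le> expectation (\<lambda>\<omega>. \<bar>X l \<omega> ^ j - S l \<omega> ^ j\<bar>)" by (rule integral_abs_bound)
      also have "\<dots> \<le> K j / real n" by (rule diff[OF that])
      finally show ?thesis
        unfolding X_def incr_moment[OF a0 \<delta> that(2)] by (simp add: abs_minus_commute)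
    qed
    have indY: "indep_vars (\<lambda>_. borel) Y L"
    proof -
      have "indep_vars (\<lambda>_. borel) (\<lambda>l. (\<lambda>x. x ^ p) \<circ> S l) L"
        unfolding S_def by (rule indep_vars_compose[OF ind]) auto
      then show ?thesis by (simp add: Y_def [abs_def] comp_def)
    qed
    have EY: "\<bar>expectation (Y l) - \<mu>\<bar> \<le> K p / real n" if "l \<in> L" for l
      using diff'[OF that p] by (simp add: Y_def [abs_def] \<mu>_def)
    have EY': "\<bar>expectation (Y l) - \<mu>\<bar> \<le> K p" if "l \<in> L" for l
    proof -
      have "K p / real n \<le> K p / 1" using n(1) K[of p] by (intro divide_left_mono) auto
      then show ?thesis using EY[OF that] by simp
    qed
    have Yprops: "\<forall>l\<in>L. all_moments M (Y l) \<and> \<bar>expectation (Y l)\<bar> \<le> A'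
        \<and> \<bar>variance (Y l) - m\<bar> \<le> A' / card L \<and> expectation (\<lambda>\<omega>. \<bar>Y l \<omega>\<bar> ^ 3) \<le> A'"
    proof (intro ballI conjI)
      fix l assume l: "l \<in> L"
      show "all_moments M (Y l)" by (rule amY)
      show "\<bar>expectation (Y l)\<bar> \<le> A'" using EY'[OF l] A'_ge(1) by linarith
      have "variance (Y l) = expectation (\<lambda>\<omega>. (Y l \<omega>)\<^sup>2) - (expectation (Y l))\<^sup>2"
        by (intro variance_eq all_moments_integrable all_moments_intros amY)
      also have "expectation (\<lambda>\<omega>. (Y l \<omega>)\<^sup>2) = expectation (\<lambda>\<omega>. S l \<omega> ^ (2 * p))"
        by (simp add: Y_def power_mult[symmetric] mult.commute)
      \<comment> \<open>The defect comes from the moments of order 2 p and, by factoring a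
        difference of squares, from the means; both are O(1 / n).\<close>
      finally have "variance (Y l) - m = (expectation (\<lambda>\<omega>. S l \<omega> ^ (2 * p)) - \<mu>2)
          - (expectation (Y l) - \<mu>) * (expectation (Y l) + \<mu>)"
        by (simp add: m_eq power2_eq_square algebra_simps)
      also have "\<bar>\<dots>\<bar> \<le> \<bar>expectation (\<lambda>\<omega>. S l \<omega> ^ (2 * p)) - \<mu>2\<bar>
          + \<bar>expectation (Y l) - \<mu>\<bar> * \<bar>expectation (Y l) + \<mu>\<bar>"
        unfolding abs_mult[symmetric] by (rule abs_triangle_ineq4)
      also have "\<dots> \<le> K (2 * p) / real n + K p / real n * (2 * \<bar>\<mu>\<bar> + K p)"
      proof (intro add_mono mult_mono)
        show "\<bar>expectation (\<lambda>\<omega>. S l \<omega> ^ (2 * p)) - \<mu>2\<bar> \<le> K (2 * p) / real n"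
          unfolding \<mu>2_def using p by (intro diff'[OF l]) auto
        show "\<bar>expectation (Y l) + \<mu>\<bar> \<le> 2 * \<bar>\<mu>\<bar> + K p" using EY'[OF l] by linarith
      qed (use EY[OF l] K[of p] in auto)
      also have "\<dots> = (K (2 * p) + K p * (2 * \<bar>\<mu>\<bar> + K p)) / real n" by (simp add: add_divide_distrib)
      also have "\<dots> \<le> A' / card L" unfolding L(3) using A'_ge(2) by (intro divide_right_mono) auto
      finally show "\<bar>variance (Y l) - m\<bar> \<le> A' / card L" .
      \<comment> \<open>The third absolute moment is traded for a moment of S l of the even order 6
        p, to which the chaos bound applies.\<close>
      have "expectation (\<lambda>\<omega>. \<bar>Y l \<omega>\<bar> ^ 3) \<le> 1 + expectation (\<lambda>\<omega>. (\<bar>Y l \<omega>\<bar> ^ 3)\<^sup>2)"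
        using expectation_abs_le[of "\<lambda>\<omega>. \<bar>Y l \<omega>\<bar> ^ 3"] by (simp add: all_moments_intros amY)
      also have "expectation (\<lambda>\<omega>. (\<bar>Y l \<omega>\<bar> ^ 3)\<^sup>2) = expectation (\<lambda>\<omega>. S l \<omega> ^ (2 * (3 * p)))"
      proof (rule Bochner_Integration.integral_cong[OF refl])
        fix \<omega>
        have "(\<bar>Y l \<omega>\<bar> ^ 3)\<^sup>2 = (Y l \<omega>) ^ (2 * 3)" by (simp add: power_mult[symmetric] power_even_abs)
        then show "(\<bar>Y l \<omega>\<bar> ^ 3)\<^sup>2 = S l \<omega> ^ (2 * (3 * p))"
          by (simp add: Y_def power_mult[symmetric] mult.commute)
      qed
      also have "\<dots> \<le> M3"
        unfolding S_def M3_def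
        by (rule wiener_approx_power_expectation_diff(2)[OF X Al A(1) p t close[OF l] \<eta>(1,2)])
      finally show "expectation (\<lambda>\<omega>. \<bar>Y l \<omega>\<bar> ^ 3) \<le> A'" using A'_ge(3) by linarith
    qed
    define V where "V = power_variation M Z H \<gamma> p N"
    define W where "W \<omega> = (\<Sum>l\<in>L. Y l \<omega> - expectation (Y l)) / sqrt (real n)" for \<omega>
    have V_eq: "V \<omega> = (\<Sum>l\<in>L. X l \<omega> ^ p - \<mu>) / sqrt (real n)" for \<omega>
      unfolding V_def power_variation_eq X_def L_def \<mu>_def a_def \<delta>_def n_def k_def by simp
    have amV: "all_moments M V" unfolding V_def by (rule power_variation_all_moments)
    have amW: "all_moments M W"
    proof -
      have "W = (\<lambda>\<omega>. (1 / sqrt (real n)) * (\<Sum>l\<in>L. Y l \<omega> - expectation (Y l)))" by (auto simp: W_def)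
      then show ?thesis by (simp only:) (intro all_moments_intros amY)
    qed
    have lip: "\<bar>g x - g y\<bar> \<le> \<bar>x - y\<bar>" for x y
      using lipschitz_onD[OF g, of x y] by (simp add: dist_real_def)
    have [measurable]: "g \<in> borel_measurable borel"
      by (intro borel_measurable_continuous_onI lipschitz_on_continuous_on[OF g])
    have amg: "all_moments M (\<lambda>\<omega>. g (R \<omega>))" if R: "all_moments M R" for R
    proof (rule all_moments_bound[of _ "\<lambda>\<omega>. \<bar>g 0\<bar> + \<bar>R \<omega>\<bar>"])
      show "\<bar>g (R \<omega>)\<bar> \<le> \<bar>\<bar>g 0\<bar> + \<bar>R \<omega>\<bar>\<bar>" for \<omega> using lip[of "R \<omega>" 0] by auto
    qed (use R in \<open>auto intro!: all_moments_intros\<close>)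
    have VW: "\<bar>expectation (\<lambda>\<omega>. g (V \<omega>)) - expectation (\<lambda>\<omega>. g (W \<omega>))\<bar> \<le> 2 * K p / sqrt (real n)"
    proof -
      have "expectation (\<lambda>\<omega>. g (V \<omega>)) - expectation (\<lambda>\<omega>. g (W \<omega>)) = expectation (\<lambda>\<omega>. g (V \<omega>) - g (W \<omega>))"
        using amg[OF amV] amg[OF amW] by (simp add: all_moments_integrable)
      also have "\<bar>\<dots>\<bar> \<le> expectation (\<lambda>\<omega>. (\<Sum>l\<in>L. \<bar>X l \<omega> ^ p - S l \<omega> ^ p\<bar> + \<bar>expectation (Y l) - \<mu>\<bar>) / sqrt (real n))"
      proof (rule abs_integral_le)
        show "\<bar>g (V \<omega>) - g (W \<omega>)\<bar> \<le> (\<Sum>l\<in>L. \<bar>X l \<omega> ^ p - S l \<omega> ^ p\<bar> + \<bar>expectation (Y l) - \<mu>\<bar>) / sqrt (real n)" for \<omega>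
        proof -
          have "V \<omega> - W \<omega> = (\<Sum>l\<in>L. (X l \<omega> ^ p - S l \<omega> ^ p) + (expectation (Y l) - \<mu>)) / sqrt (real n)"
            unfolding V_eq W_def diff_divide_distrib[symmetric] sum_subtractf[symmetric]
            by (simp add: Y_def algebra_simps)
          then have "\<bar>V \<omega> - W \<omega>\<bar> = \<bar>\<Sum>l\<in>L. (X l \<omega> ^ p - S l \<omega> ^ p) + (expectation (Y l) - \<mu>)\<bar> / sqrt (real n)"
            by (simp add: abs_divide)
          also have "\<dots> \<le> (\<Sum>l\<in>L. \<bar>X l \<omega> ^ p - S l \<omega> ^ p\<bar> + \<bar>expectation (Y l) - \<mu>\<bar>) / sqrt (real n)"
            by (intro divide_right_mono order_trans[OF sum_abs sum_mono] abs_triangle_ineq) auto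
          finally show ?thesis using lip[of "V \<omega>" "W \<omega>"] by linarith
        qed
      qed (use amX amS amg[OF amV] amg[OF amW] in
          \<open>auto intro!: all_moments_integrable all_moments_intros integrable_divide\<close>)
      also have "\<dots> = (\<Sum>l\<in>L. expectation (\<lambda>\<omega>. \<bar>X l \<omega> ^ p - S l \<omega> ^ p\<bar>) + \<bar>expectation (Y l) - \<mu>\<bar>) / sqrt (real n)"
      proof -
        have i: "integrable M (\<lambda>\<omega>. \<bar>X l \<omega> ^ p - S l \<omega> ^ p\<bar>)" for l
          by (intro all_moments_integrable all_moments_intros amX amS)
        then show ?thesis by (simp add: Bochner_Integration.integral_sum prob_space)
      qed
      also have "\<dots> \<le> (\<Sum>l\<in>L. K p / real n + K p / real n) / sqrt (real n)"
        by (intro divide_right_mono sum_mono add_mono diff EY p) auto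
      also have "\<dots> = 2 * K p / sqrt (real n)" using n(1) L(3) by simp
      finally show ?thesis .
    qed
    have "\<bar>expectation (\<lambda>\<omega>. g (W \<omega>)) - (\<integral>x. g (sqrt m * x) \<partial>std_normal_distribution)\<bar> \<le> C / sqrt (real n)"
      using clt[OF L(1,2) indY Yprops g] unfolding W_def L(3) .
    with VW have "\<bar>expectation (\<lambda>\<omega>. g (V \<omega>)) - (\<integral>x. g (sqrt m * x) \<partial>std_normal_distribution)\<bar>
      \<le> 2 * K p / sqrt (real n) + C / sqrt (real n)" by linarith
    also have "\<dots> = (2 * K p + C) * (1 / sqrt (real n))" by (simp add: add_divide_distrib)
    also have "\<dots> \<le> (2 * K p + C) * (sqrt 2 * 2 powr (- (real N powr \<gamma> / 2)))"
    proof (rule mult_left_mono)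
      have "1 / sqrt (real n) = 2 powr (- (real k / 2))"
      proof -
        have n_powr: "real n = 2 powr real k" by (simp add: n powr_realpow)
        have "sqrt (real n) = real n powr (1 / 2)" by (rule powr_half_sqrt[symmetric]) simp
        also have "\<dots> = (2 powr real k) powr (1 / 2)" by (simp only: n_powr)
        also have "(2 powr real k) powr (1 / 2) = 2 powr (real k * (1 / 2))" by (rule powr_powr)
        finally have "sqrt (real n) = 2 powr (real k / 2)" by simp
        then show ?thesis by (simp only: powr_minus_divide)
      qed
      \<comment> \<open>Taking the integer part lowers the exponent by at most 1, whence the factor
        sqrt 2.\<close>
      also have "\<dots> \<le> 2 powr (1 / 2 + - (real N powr \<gamma> / 2))"
        using scale_exp_ge[of N \<gamma>] by (simp add: k_def)
      also have "\<dots> = sqrt 2 * 2 powr (- (real N powr \<gamma> / 2))"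
        by (subst powr_add) (simp add: powr_half_sqrt)
      finally show "1 / sqrt (real n) \<le> sqrt 2 * 2 powr (- (real N powr \<gamma> / 2))" .
    qed (use C K[of p] in auto)
    finally show ?thesis by (simp add: V_def mult.assoc)
  qed
  show ?thesis
  proof (intro exI[of _ "(2 * K p + C) * sqrt 2"] conjI)
    show "0 < (2 * K p + C) * sqrt 2" using C K[of p] by (simp add: add_nonneg_pos)
    show "\<forall>\<^sub>F N in sequentially. \<forall>g. 1-lipschitz_on UNIV g \<longrightarrow>
      \<bar>expectation (\<lambda>\<omega>. g (power_variation M Z H \<gamma> p N \<omega>))
        - (\<integral>x. g (sqrt (variance (\<lambda>\<omega>. Z 1 \<omega> ^ p)) * x) \<partial>std_normal_distribution)\<bar>
      \<le> ((2 * K p + C) * sqrt 2) * 2 powr (- (real N powr \<gamma> / 2))"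
      using eventually_scale_small[OF \<gamma> \<beta> c]
      by eventually_elim (use rate in \<open>auto simp: m_def\<close>)
  qed
qed

end

section \<open>Convergence of laws\<close>

lemma integral_gaussian_law:
  fixes g :: "real \<Rightarrow> real"
  assumes [measurable]: "g \<in> borel_measurable borel"
  shows "(\<integral>x. g x \<partial>gaussian_law 0 v) = (\<integral>x. g (sqrt v * x) \<partial>std_normal_distribution)"
  unfolding gaussian_law_def by (subst integral_distr) auto

lemma integrable_gaussian_law: "integrable (gaussian_law 0 v) (\<lambda>x. x)"
proof -
  have "integrable std_normal_distribution (\<lambda>x. x)"
    using integrable_std_normal_moment[of 1] by (simp add: integrable_density)
  then have i: "integrable std_normal_distribution (\<lambda>x. 0 + sqrt v * x)"
    unfolding add_0 by (rule integrable_mult_right)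
  have "(\<lambda>x. 0 + sqrt v * x) \<in> measurable std_normal_distribution borel" by measurable
  then have "integrable (gaussian_law 0 v) (\<lambda>x. x) \<longleftrightarrow> integrable std_normal_distribution (\<lambda>x. 0 + sqrt v * x)"
    unfolding gaussian_law_def by (rule integrable_distr_eq) measurable
  with i show ?thesis by (simp only:)
qed

text \<open>Continuous step functions suffice to test weak convergence, and this scaling makes them
  admissible for the Lipschitz estimate.\<close>

lemma cts_step_lipschitz:
  assumes xy: "x < y" shows "1-lipschitz_on UNIV (\<lambda>z. (y - x) * cts_step x y z)"
proof (rule lipschitz_onI)
  have "(y - x) * cts_step x y z = max 0 (min (y - x) (y - z))" for z
    using xy by (auto simp: cts_step_def)
  then show "dist ((y - x) * cts_step x y u) ((y - x) * cts_step x y v) \<le> 1 * dist u v" for u v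
    by (auto simp: dist_real_def)
qed simp

theorem theorem2:
  fixes M :: "'a measure"
    and B Z :: "real \<Rightarrow> 'a \<Rightarrow> real"
    and q p :: nat
    and H \<gamma> :: real
  assumes "prob_space M"
    and "two_sided_brownian_motion M B"
    and "1 \<le> q"
    and "1/2 < H" and "H < 1"
    and "hermite_process M B q H Z"
    and "0 < \<gamma>" and "\<gamma> < 1"
    and "2 \<le> p"
  shows "weak_conv_m
           (\<lambda>N. distr M borel (power_variation M Z H \<gamma> p N))
           (gaussian_law 0 (prob_space.variance M (\<lambda>\<omega>. (Z 1 \<omega>) ^ p)))
       \<and> (\<exists>C::real. C > 0 \<and>
           (\<forall>\<^sub>F N in sequentially.
              wasserstein_dist
                (distr M borel (power_variation M Z H \<gamma> p N))
                (gaussian_law 0 (prob_space.variance M (\<lambda>\<omega>. (Z 1 \<omega>) ^ p)))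
              \<le> ennreal (C * 2 powr (- (real N powr \<gamma> / 2)))))"
proof -
  interpret prob_space M by fact
  from assms(6) obtain d where d: "0 < d" and Z: "\<And>t. 0 \<le> t \<Longrightarrow>
    is_multiple_wiener_integral M B q (\<lambda>y. LBINT u:{0..t}. hermite_kernel d q H u y) (Z t)"
    unfolding hermite_process_def by blast
  interpret hermite M B d q H Z
    by unfold_locales (use assms d Z in auto)
  define m where "m = variance (\<lambda>\<omega>. Z 1 \<omega> ^ p)"
  define \<nu> where "\<nu> = gaussian_law 0 m"
  define \<mu> where "\<mu> N = distr M borel (power_variation M Z H \<gamma> p N)" for N
  have [measurable]: "power_variation M Z H \<gamma> p N \<in> borel_measurable M" for N
    using power_variation_all_moments by (simp add: all_moments_def)
  obtain C where C: "0 < C" and rate: "\<forall>\<^sub>F N in sequentially. \<forall>g. 1-lipschitz_on UNIV g \<longrightarrow>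
      \<bar>expectation (\<lambda>\<omega>. g (power_variation M Z H \<gamma> p N \<omega>)) - (\<integral>x. g (sqrt m * x) \<partial>std_normal_distribution)\<bar>
      \<le> C * 2 powr (- (real N powr \<gamma> / 2))"
    using power_variation_rate[of \<gamma> p] assms unfolding m_def by auto
  have meas: "g \<in> borel_measurable borel" if "1-lipschitz_on UNIV g" for g :: "real \<Rightarrow> real"
    by (intro borel_measurable_continuous_onI lipschitz_on_continuous_on[OF that])
  have rate': "\<forall>\<^sub>F N in sequentially. \<forall>g. 1-lipschitz_on UNIV g \<longrightarrow>
      \<bar>(\<integral>x. g x \<partial>\<mu> N) - (\<integral>x. g x \<partial>\<nu>)\<bar> \<le> C * 2 powr (- (real N powr \<gamma> / 2))"
    using rate
  proof eventually_elim
    case (elim N)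
    then show ?case
      by (auto simp: \<mu>_def \<nu>_def integral_gaussian_law meas integral_distr)
  qed
  have wass: "\<forall>\<^sub>F N in sequentially. wasserstein_dist (\<mu> N) \<nu> \<le> ennreal (C * 2 powr (- (real N powr \<gamma> / 2)))"
    using rate'
  proof eventually_elim
    case (elim N)
    \<comment> \<open>Finite first moments of both laws exclude the value \<infinity> in
      \<open>wasserstein_dist\<close>.\<close>
    have "integrable (\<mu> N) (\<lambda>x. x)"
      unfolding \<mu>_def by (subst integrable_distr_eq) (auto intro: all_moments_integrable power_variation_all_moments)
    moreover have "integrable \<nu> (\<lambda>x. x)" unfolding \<nu>_def by (rule integrable_gaussian_law)
    ultimately show ?case
      unfolding wasserstein_dist_def using elim by (auto intro!: SUP_least ennreal_leI)
  qed
  have "(\<lambda>N. C * 2 powr (- (real N powr \<gamma> / 2))) \<longlonglongrightarrow> C * 0"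
  proof (intro tendsto_mult tendsto_const)
    show "(\<lambda>N. 2 powr (- (real N powr \<gamma> / 2))) \<longlonglongrightarrow> 0"
      using assms(7) by real_asymp
  qed
  then have lim: "(\<lambda>N. C * 2 powr (- (real N powr \<gamma> / 2))) \<longlonglongrightarrow> 0" by simp
  have "weak_conv_m \<mu> \<nu>"
  proof (rule integral_cts_step_conv_imp_weak_conv)
    show "real_distribution (\<mu> N)" for N unfolding \<mu>_def by (rule real_distribution_distr) simp
    interpret N: prob_space std_normal_distribution by (rule prob_space_normal_density) simp
    show "real_distribution \<nu>" unfolding \<nu>_def gaussian_law_def by (rule N.real_distribution_distr) simp
    fix x y :: real assume xy: "x < y"
    have "(\<lambda>N. (\<integral>z. (y - x) * cts_step x y z \<partial>\<mu> N) - (\<integral>z. (y - x) * cts_step x y z \<partial>\<nu>)) \<longlonglongrightarrow> 0"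
    proof (rule Lim_null_comparison[OF _ lim])
      show "\<forall>\<^sub>F N in sequentially. norm ((\<integral>z. (y - x) * cts_step x y z \<partial>\<mu> N) - (\<integral>z. (y - x) * cts_step x y z \<partial>\<nu>))
          \<le> C * 2 powr (- (real N powr \<gamma> / 2))"
        using rate' by eventually_elim (use cts_step_lipschitz[OF xy] in auto)
    qed
    then have "(\<lambda>N. ((y - x) * integral\<^sup>L (\<mu> N) (cts_step x y) - (y - x) * integral\<^sup>L \<nu> (cts_step x y)) / (y - x)) \<longlonglongrightarrow> 0 / (y - x)"
      by (intro tendsto_divide tendsto_const) (use xy in auto)
    then have "(\<lambda>N. integral\<^sup>L (\<mu> N) (cts_step x y) - integral\<^sup>L \<nu> (cts_step x y)) \<longlonglongrightarrow> 0"
      using xy by (simp add: right_diff_distrib[symmetric])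
    then show "(\<lambda>N. integral\<^sup>L (\<mu> N) (cts_step x y)) \<longlonglongrightarrow> integral\<^sup>L \<nu> (cts_step x y)"
      by (rule LIM_zero_cancel)
  qed
  with wass C show ?thesis unfolding \<mu>_def [abs_def] \<nu>_def m_def by blast
qed

end
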